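(* Consider the random intersection graph with communities $\mathrm{RIGC}(\boldsymbol d^{\ell},\mathbf{Com})$ under Assumptions (A), (B), (C), (D) listed in the context, and further assume that $p_2+q_2<2$. Let $\mathscr C_1$ and $\mathscr C_2$ denote the largest and second largest connected components of the RIGC (by number of vertices, ties broken arbitrarily). Then there exists $\eta_{\ell}\in[0,1]$, the smallest solution in $[0,1]$ of the fixed point equation $$\eta_{\ell}=G_{\widetilde D^{r}}\bigl(G_{\widetilde D^{\ell}}(\eta_{\ell})\bigr),$$ and $\xi_{\ell}:=1-G_{D^{\ell}}(\eta_{\ell})\in[0,1]$ such that, as $n\to\infty$, $$|\mathscr C_1|/N_n\xrightarrow{\ \mathbb P\ }\xi_{\ell}.$$ Furthermore, $\xi_{\ell}>0$ if and only if $$\mathbb E[\widetilde D^{\ell}]\,\mathbb E[\widetilde D^{r}]>1 .$$ In this (supercritical) case, $\mathscr C_1$ is unique in the sense that $|\mathscr C_2|/N_n\xrightarrow{\ \mathbb P\ }0$.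
   Context: Notation: $\mathbb Z^+=\{1,2,\dots\}$, $\mathbb N=\{0,1,2,\dots\}$. For an $\mathbb N$-valued random variable $X$ with $0<\mathbb E[X]<\infty$, the size-biased variable $X^\star$ has $\mathbb P(X^\star=k)=k\,\mathbb P(X=k)/\mathbb E[X]$, and $\widetilde X:=X^\star-1$. $G_X(z)=\mathbb E[z^X]$ for $z\in[0,1]$. $\mathbb E[\widetilde D^{\ell}],\mathbb E[\widetilde D^{r}]$ may be $+\infty$ (convention $0\cdot\infty=0$). Model. All quantities depend on $n\in\mathbb N$ (often suppressed). There are $N_n$ individuals ($\ell$-vertices) $[N_n]$ and $M_n$ groups ($r$-vertices) $[M_n]$, with $N_n,M_n\to\infty$. Let $\mathscr H$ be the set of finite, simple, connected graphs $H$ with at least one vertex, each vertex-labelled by $[|H|]$, such that isomorphic graphs in $\mathscr H$ are labelled identically ($|H|$ is the number of vertices). Parameters: $\boldsymbol d^{\ell}=(d^{\ell}_v)_{v\in[N_n]}$ with $d^{\ell}_v\in\mathbb Z^+$, and $\mathbf{Com}=(\mathrm{Com}_a)_{a\in[M_n]}$ with $\mathrm{Com}_a\in\mathscr H$; put $d^{r}_a=|\mathrm{Com}_a|$ and assume $\mathscr h_n:=\sum_v d^{\ell}_v=\sum_a d^{r}_a$. Let $\mathscr V(\mathbf{Com})$ and $\mathscr E(\mathbf{Com})$ be the disjoint unions of the vertex sets and edge sets of all $\mathrm{Com}_a$. Give each $v\in[N_n]$ $d_v^{\ell}$ half-edges and let $\omega_n$ be a uniformly random bijection from the set of all these $\ell$-half-edges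 to $\mathscr V(\mathbf{Com})$ (equivalently, to the $r$-half-edges, with one $r$-half-edge $(a,l)$ for the vertex with label $l$ of $\mathrm{Com}_a$). Write $v\mapsfrom j$ if a half-edge of $v$ is matched to $j\in\mathscr V(\mathbf{Com})$. The graph $\mathrm{RIGC}(\boldsymbol d^{\ell},\mathbf{Com})$ is the random multigraph on $[N_n]$ in which the pair $(v,w)$ has edge multiplicity $X(v,w)=\sum_{(j_1,j_2)\in\mathscr E(\mathbf{Com})}\mathbf 1_{\{v\mapsfrom j_1,\,w\mapsfrom j_2\}\cup\{v\mapsfrom j_2,\,w\mapsfrom j_1\}}$. Assumptions. Let $D_n^{\ell}=d^{\ell}_{V}$ with $V$ uniform on $[N_n]$ and $D_n^{r}=d^{r}_{W}$ with $W$ uniform on $[M_n]$. Let $\mu^{(n)}_H=|\{a:\mathrm{Com}_a=H\}|/M_n$ for $H\in\mathscr H$. (A) $D_n^{\ell}\to D^{\ell}$ in distribution for a random variable $D^{\ell}$ with pmf $\boldsymbol p=(p_k)_{k\in\mathbb Z^+}$. (B) $\mathbb E[D^{\ell}]<\infty$ and $\mathbb E[D_n^{\ell}]\to\mathbb E[D^{\ell}]$. (C) There is a probability mass function $\boldsymbol\mu$ on $\mathscr H$ with $\mu^{(n)}_H\to\mu_H$ for every $H\in\mathscr H$; consequently $D_n^{r}\to D^{r}$ in distribution, where $D^{r}$ has pmf $q_k=\sum_{H:|H|=k}\mu_H$. (D) $\mathbb E[D^{r}]<\infty$ and $\mathbb E[D_n^{r}]\to\mathbb E[D^{r}]$. 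*)

theory Defs
  imports "HOL-Probability.Probability"
begin

section \<open>Connectivity\<close>

definition connectivity :: "'a set \<Rightarrow> ('a \<Rightarrow> 'a \<Rightarrow> bool) \<Rightarrow> 'a rel" where
  "connectivity V adj =
     {(v, w) \<in> V \<times> V. (\<lambda>x y. x \<in> V \<and> y \<in> V \<and> adj x y)\<^sup>*\<^sup>* v w}"


section \<open>Community graphs\<close>

text \<open>A simple graph on the vertex (label) set \<open>{1..order}\<close>; an edge is a two-element set of labels.\<close>

datatype graph = Graph (order: nat) (edges: "nat set set")

definition connected_simple_graph :: "graph \<Rightarrow> bool" where
  "connected_simple_graph H \<longleftrightarrow>
     1 \<le> order H \<and>
     (\<forall>e \<in> edges H. e \<subseteq> {1..order H} \<and> card e = 2) \<and>
     connectivity {1..order H} (\<lambda>u v. {u, v} \<in> edges H) = {1..order H} \<times> {1..order H}"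

definition isomorphic :: "graph \<Rightarrow> graph \<Rightarrow> bool" where
  "isomorphic G H \<longleftrightarrow>
     (\<exists>f. bij_betw f {1..order G} {1..order H} \<and>
          (\<forall>u \<in> {1..order G}. \<forall>v \<in> {1..order G}.
             {u, v} \<in> edges G \<longleftrightarrow> {f u, f v} \<in> edges H))"

text \<open>
  The set of admissible communities contains every finite simple connected graph up to isomorphism,
  and isomorphic members carry the same labelling. Hence it has exactly one labelled graph in each
  isomorphism class; which one is a free choice of the model.
\<close>

definition community_set :: "graph set \<Rightarrow> bool" where
  "community_set \<H> \<longleftrightarrow>
     (\<forall>H \<in> \<H>. connected_simple_graph H) \<and>
     (\<forall>G. connected_simple_graph G \<longrightarrow> (\<exists>!H. H \<in> \<H> \<and> isomorphic G H))"


section \<open>The random intersection graph with communities\<close>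

text \<open>Individuals are \<open>{1..N}\<close>, groups are \<open>{1..M}\<close>. The half-edges of \<open>v\<close> are the pairs \<open>(v, i)\<close>
  with \<open>1 \<le> i \<le> d v\<close>; the community vertex with label \<open>l\<close> in \<open>Com a\<close> is the pair \<open>(a, l)\<close>.\<close>

definition half_edges :: "nat \<Rightarrow> (nat \<Rightarrow> nat) \<Rightarrow> (nat \<times> nat) set" where
  "half_edges N d = (SIGMA v:{1..N}. {1..d v})"

definition com_vertices :: "nat \<Rightarrow> (nat \<Rightarrow> graph) \<Rightarrow> (nat \<times> nat) set" where
  "com_vertices M Com = (SIGMA a:{1..M}. {1..order (Com a)})"

definition com_edges :: "nat \<Rightarrow> (nat \<Rightarrow> graph) \<Rightarrow> (nat \<times> nat) set set" where
  "com_edges M Com = (\<Union>a \<in> {1..M}. (\<lambda>e. Pair a ` e) ` edges (Com a))"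

type_synonym matching = "nat \<times> nat \<Rightarrow> nat \<times> nat"

text \<open>Functions are made extensional outside the half-edges, so that every bijection is counted
  exactly once.\<close>

definition matchings :: "nat \<Rightarrow> nat \<Rightarrow> (nat \<Rightarrow> nat) \<Rightarrow> (nat \<Rightarrow> graph) \<Rightarrow> matching set" where
  "matchings N M d Com =
     {\<omega> \<in> half_edges N d \<rightarrow>\<^sub>E com_vertices M Com.
        bij_betw \<omega> (half_edges N d) (com_vertices M Com)}"

definition random_matching :: "nat \<Rightarrow> nat \<Rightarrow> (nat \<Rightarrow> nat) \<Rightarrow> (nat \<Rightarrow> graph) \<Rightarrow> matching pmf" where
  "random_matching N M d Com = pmf_of_set (matchings N M d Com)"

definition takes_role :: "(nat \<Rightarrow> nat) \<Rightarrow> matching \<Rightarrow> nat \<Rightarrow> nat \<times> nat \<Rightarrow> bool" where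
  "takes_role d \<omega> v j \<longleftrightarrow> (\<exists>i \<in> {1..d v}. \<omega> (v, i) = j)"

datatype multigraph = Multigraph (mverts: "nat set") (mult: "nat \<Rightarrow> nat \<Rightarrow> nat")

definition RIGC :: "nat \<Rightarrow> nat \<Rightarrow> (nat \<Rightarrow> nat) \<Rightarrow> (nat \<Rightarrow> graph) \<Rightarrow> matching \<Rightarrow> multigraph" where
  "RIGC N M d Com \<omega> = Multigraph {1..N} (\<lambda>v w.
     \<Sum>e \<in> com_edges M Com.
       of_bool (\<exists>j\<^sub>1 j\<^sub>2. e = {j\<^sub>1, j\<^sub>2} \<and>
         (takes_role d \<omega> v j\<^sub>1 \<and> takes_role d \<omega> w j\<^sub>2 \<or>
          takes_role d \<omega> v j\<^sub>2 \<and> takes_role d \<omega> w j\<^sub>1)))"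

definition components :: "multigraph \<Rightarrow> nat set set" where
  "components G = mverts G // connectivity (mverts G) (\<lambda>v w. mult G v w > 0)"

text \<open>\<open>C\<^sub>1\<close> is a largest and \<open>C\<^sub>2\<close> a second largest component, for some breaking of ties; for a
  connected graph \<open>C\<^sub>2\<close> is empty.\<close>

definition two_largest_components :: "multigraph \<Rightarrow> nat set \<Rightarrow> nat set \<Rightarrow> bool" where
  "two_largest_components G C\<^sub>1 C\<^sub>2 \<longleftrightarrow>
     C\<^sub>1 \<in> components G \<and> (\<forall>C \<in> components G. card C \<le> card C\<^sub>1) \<and>
     (if components G = {C\<^sub>1} then C\<^sub>2 = {}
      else C\<^sub>2 \<in> components G - {C\<^sub>1} \<and> (\<forall>C \<in> components G - {C\<^sub>1}. card C \<le> card C\<^sub>2))"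


section \<open>Distributions on the natural numbers\<close>

definition mean :: "nat pmf \<Rightarrow> real" where
  "mean X = measure_pmf.expectation X real"

definition ext_mean :: "nat pmf \<Rightarrow> ennreal" where
  "ext_mean X = (\<integral>\<^sup>+k. of_nat k \<partial>measure_pmf X)"

definition pgf :: "nat pmf \<Rightarrow> real \<Rightarrow> real" where
  "pgf X z = measure_pmf.expectation X (\<lambda>k. z ^ k)"

definition size_biased :: "nat pmf \<Rightarrow> nat pmf" where
  "size_biased X = embed_pmf (\<lambda>k. real k * pmf X k / mean X)"

text \<open>\<open>embed_pmf\<close> is only specified for genuine mass functions; the following lemma discharges this.\<close>

lemma pmf_size_biased:
  assumes "integrable (measure_pmf X) real" and "mean X > 0"
  shows "pmf (size_biased X) k = real k * pmf X k / mean X"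
  unfolding size_biased_def
proof (rule pmf_embed_pmf)
  show "0 \<le> real k * pmf X k / mean X" for k
    using assms by simp
  have "(\<integral>\<^sup>+k. ennreal (real k * pmf X k / mean X) \<partial>count_space UNIV)
      = (\<integral>\<^sup>+k. ennreal (pmf X k) * ennreal (real k / mean X) \<partial>count_space UNIV)"
    using assms by (intro nn_integral_cong) (simp flip: ennreal_mult' add: mult.commute)
  also have "\<dots> = (\<integral>\<^sup>+k. ennreal (real k / mean X) \<partial>measure_pmf X)"
    by (simp add: nn_integral_measure_pmf)
  also have "\<dots> = ennreal (measure_pmf.expectation X (\<lambda>k. real k / mean X))"
    using assms by (intro nn_integral_eq_integral) auto
  also have "\<dots> = 1"
    using assms by (simp add: mean_def)
  finally show "(\<integral>\<^sup>+k. ennreal (real k * pmf X k / mean X) \<partial>count_space UNIV) = 1" .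
qed

definition tilde :: "nat pmf \<Rightarrow> nat pmf" where
  "tilde X = map_pmf (\<lambda>k. k - 1) (size_biased X)"

definition conv_in_distribution :: "(nat \<Rightarrow> nat pmf) \<Rightarrow> nat pmf \<Rightarrow> bool" where
  "conv_in_distribution X Y \<longleftrightarrow>
     weak_conv_m (\<lambda>n. distr (measure_pmf (X n)) borel real) (distr (measure_pmf Y) borel real)"

text \<open>Convergence in probability to a constant; the probability space may change with \<open>n\<close>.\<close>

definition conv_in_probability :: "(nat \<Rightarrow> 'a pmf) \<Rightarrow> (nat \<Rightarrow> 'a \<Rightarrow> real) \<Rightarrow> real \<Rightarrow> bool" where
  "conv_in_probability P X c \<longleftrightarrow>
     (\<forall>\<epsilon>>0. (\<lambda>n. measure_pmf.prob (P n) {\<omega>. \<bar>X n \<omega> - c\<bar> > \<epsilon>}) \<longlonglongrightarrow> 0)"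

definition empirical_law :: "nat \<Rightarrow> (nat \<Rightarrow> 'a) \<Rightarrow> 'a pmf" where
  "empirical_law K x = map_pmf x (pmf_of_set {1..K})"

end

theory Submission
  imports Defs
begin

text \<open>
  Communities are connected, so the components of the RIGC are the sets of individuals that lie in
  one component of the bipartite configuration model given by the random matching. That model is
  explored one half-edge at a time: pick an unmatched half-edge of a vertex already seen and reveal
  its partner, which is uniform among the unmatched half-edges of the other side.

  Let \<open>z\<close> and \<open>y\<close> be the products of the factors \<open>1 - 1/m\<close> over the steps that revealed a half-edge
  of an individual or of a group respectively, \<open>m\<close> being the number of unmatched half-edges at that
  time. Each step lowers \<open>m\<close> by one, so exactly \<open>h z y\<close> of the \<open>h\<close> half-edges of a side are unmatched.
  An untouched individual of degree \<open>k\<close> survives a reveal with probability \<open>1 - k/m\<close>, which is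
  \<open>(1 - 1/m)^k\<close> up to order \<open>1/m^2\<close>. Hence the number of untouched individuals of degree \<open>k\<close> divided
  by \<open>z^k\<close> is almost a martingale with bounded jumps, and its square deviation grows by at most a
  constant per step (\<open>excess_one_step\<close>). For every such strategy and every stopping rule, a second
  moment bound at the one final state (\<open>run_concentration\<close>) then says that the untouched individuals
  own about \<open>h z G(z)\<close> half-edges, \<open>G\<close> being the generating function of the reduced size-biased
  degree; the same holds for groups with \<open>y\<close>. The half-edges of touched vertices that remain
  unmatched thus number about \<open>h z (y - G_l(z))\<close> and \<open>h y (z - G_r(y))\<close>, and an exploration that has
  nothing left to do sits where both vanish, that is at a fixed point of \<open>f = G_r o G_l\<close>.

  Upper bound (\<open>reach_from_two\<close>). Start from at most two individuals. The two numbers above are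
  nonnegative, and for \<open>z\<close> below the smallest fixed point \<open>\<eta>\<close> this is impossible since \<open>f(z) > z\<close>
  there. So the exploration stops before \<open>z\<close> passes \<open>\<eta>\<close> and leaves at least about \<open>N G_D(\<eta>)\<close>
  individuals untouched. Applied to two uniformly chosen individuals this bounds the size of the largest
  component, and of the union of the two largest ones unless the second is small (\<open>many_pairs\<close>).

  Lower bound (\<open>large_component\<close>). Explore component after component, starting a new one whenever the
  old one is finished. In the supercritical case \<open>f(z) < z\<close> for \<open>\<eta> < z < 1\<close>, so away from the start
  \<open>(1, 1)\<close> and as long as \<open>z > \<eta>\<close> one of the two numbers is of order \<open>h\<close>. Therefore no component is
  finished in between, and a single component takes \<open>z\<close> from near \<open>1\<close> to near \<open>\<eta>\<close>. New starts only
  remove untouched vertices, which does no harm as only upper bounds for their number are needed.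

  Both bounds together give the limit of the largest component, and they leave no room for a second
  component of linear size. The condition on the product of the means is the condition \<open>f'(1) > 1\<close>,
  which decides whether \<open>\<eta> < 1\<close>; the excluded case of all degrees equal to two on both sides is the
  one in which \<open>f\<close> is the identity.
\<close>

section \<open>Revealing a uniform random matching step by step\<close>

type_synonym half_edge = "nat \<times> nat"
type_synonym entry = "bool \<times> half_edge \<times> half_edge"
type_synonym history = "entry list"

text \<open>
  \<open>True\<close> stands for the side of the individuals and \<open>False\<close> for the side of the groups; using a Boolean
  lets every argument be given once for both sides. An entry \<open>(b, x, r)\<close> records that \<open>x\<close> and \<open>r\<close> are
  matched and that the partner on side \<open>b\<close> was the one revealed. Histories have the newest entry first.
\<close>

definition side :: "bool \<Rightarrow> entry \<Rightarrow> half_edge" where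
  "side c e = (if c then fst (snd e) else snd (snd e))"

text \<open>The half-edge \<open>q\<close> of side \<open>\<not> b\<close> was picked and \<open>p\<close> is its revealed partner.\<close>

definition entry :: "bool \<Rightarrow> half_edge \<Rightarrow> half_edge \<Rightarrow> entry" where
  "entry b q p = (b, if b then p else q, if b then q else p)"

lemma side_entry [simp]: "side c (entry b q p) = (if c = b then p else q)"
  by (auto simp: side_def entry_def)

lemma fst_entry [simp]: "fst (entry b q p) = b"
  by (simp add: entry_def)

locale matching_exploration =
  fixes H :: "bool \<Rightarrow> half_edge set" and h :: nat
  assumes finite_H: "finite (H c)" and card_H: "card (H c) = h"
begin

definition bijs :: "matching set" where
  "bijs = {\<omega> \<in> H True \<rightarrow>\<^sub>E H False. bij_betw \<omega> (H True) (H False)}"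

definition valid :: "history \<Rightarrow> bool" where
  "valid s \<longleftrightarrow> (\<forall>c. side c ` set s \<subseteq> H c \<and> distinct (map (side c) s))"

definition alive :: "bool \<Rightarrow> history \<Rightarrow> half_edge set" where
  "alive c s = H c - side c ` set s"

definition consistent :: "history \<Rightarrow> matching set" where
  "consistent s = {\<omega> \<in> bijs. \<forall>e \<in> set s. \<omega> (side True e) = side False e}"

definition partner :: "matching \<Rightarrow> bool \<Rightarrow> half_edge \<Rightarrow> half_edge" where
  "partner \<omega> b q = (if b then inv_into (H True) \<omega> q else \<omega> q)"

lemma finite_bijs: "finite bijs"
  unfolding bijs_def
  by (rule finite_subset[OF _ finite_PiE[of "H True" "\<lambda>_. H False"]]) (auto simp: finite_H)

lemma finite_consistent: "finite (consistent s)"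
  using finite_bijs by (simp add: consistent_def)

lemma consistent_bijs: "\<omega> \<in> consistent s \<Longrightarrow> \<omega> \<in> bijs"
  by (simp add: consistent_def)

lemma consistent_Nil [simp]: "consistent [] = bijs"
  by (simp add: consistent_def)

lemma valid_Nil [simp]: "valid []"
  by (simp add: valid_def)

lemma finite_alive [simp]: "finite (alive c s)"
  using finite_H by (simp add: alive_def)

lemma card_alive:
  assumes "valid s" shows "card (alive c s) = h - length s"
proof -
  have "card (side c ` set s) = length s"
    using assms by (metis valid_def distinct_card length_map set_map)
  thus ?thesis using assms
    by (simp add: alive_def card_Diff_subset card_H valid_def)
qed

lemma length_valid:
  assumes "valid s" shows "length s \<le> h"
proof -
  have "card (side True ` set s) = length s"
    using assms by (metis valid_def distinct_card length_map set_map)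
  thus ?thesis using assms card_mono[OF finite_H, of "side True ` set s" True]
    by (simp add: card_H valid_def)
qed

lemma valid_entry:
  assumes "valid s" "q \<in> alive (\<not> b) s" "p \<in> alive b s"
  shows "valid (entry b q p # s)"
  using assms by (auto simp: valid_def alive_def)

lemma partner_props:
  assumes "\<omega> \<in> bijs" "q \<in> H (\<not> b)"
  shows "partner \<omega> b q \<in> H b"
    and "\<omega> (side True (entry b q (partner \<omega> b q))) = side False (entry b q (partner \<omega> b q))"
proof -
  have *: "bij_betw \<omega> (H True) (H False)" using assms by (simp add: bijs_def)
  show "partner \<omega> b q \<in> H b"
    using assms(2) * by (cases b) (auto simp: partner_def bij_betw_def intro: inv_into_into)
  show "\<omega> (side True (entry b q (partner \<omega> b q))) = side False (entry b q (partner \<omega> b q))"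
    using assms(2) * by (cases b) (auto simp: partner_def bij_betw_def f_inv_into_f)
qed

lemma partner_eq:
  assumes "\<omega> \<in> bijs" "q \<in> H (\<not> b)" "p \<in> H b"
    and "\<omega> (side True (entry b q p)) = side False (entry b q p)"
  shows "partner \<omega> b q = p"
proof -
  have "bij_betw \<omega> (H True) (H False)" using assms by (simp add: bijs_def)
  thus ?thesis
    using assms by (cases b) (auto simp: partner_def bij_betw_def inv_into_f_f)
qed

lemma partner_alive:
  assumes "\<omega> \<in> consistent s" "valid s" "q \<in> alive (\<not> b) s"
  shows "partner \<omega> b q \<in> alive b s"
proof -
  have \<omega>: "\<omega> \<in> bijs" using assms by (simp add: consistent_def)
  have q: "q \<in> H (\<not> b)" using assms by (simp add: alive_def)
  note pp = partner_props[OF \<omega> q]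
  have "partner \<omega> b q \<notin> side b ` set s"
  proof
    assume "partner \<omega> b q \<in> side b ` set s"
    then obtain e where e: "e \<in> set s" "partner \<omega> b q = side b e" by auto
    have "\<omega> (side True e) = side False e" using assms e by (simp add: consistent_def)
    moreover have "side True e \<in> H True" using assms(2) e by (auto simp: valid_def)
    moreover have "inj_on \<omega> (H True)" using \<omega> by (simp add: bijs_def bij_betw_def)
    ultimately have "side (\<not> b) e = q"
      using pp(2) e(2) q by (cases b) (auto simp: inj_on_def)
    thus False using assms(3) e(1) by (auto simp: alive_def)
  qed
  thus ?thesis using pp(1) by (simp add: alive_def)
qed

lemma consistent_Cons_iff:
  "\<omega> \<in> consistent (e # s) \<longleftrightarrow> \<omega> \<in> consistent s \<and> \<omega> (side True e) = side False e"
  by (auto simp: consistent_def)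

lemma consistent_entry:
  assumes "valid s" "q \<in> alive (\<not> b) s" "p \<in> alive b s"
  shows "consistent (entry b q p # s) = {\<omega> \<in> consistent s. partner \<omega> b q = p}"
proof -
  have q: "q \<in> H (\<not> b)" and p: "p \<in> H b" using assms by (auto simp: alive_def)
  have "\<omega> (side True (entry b q p)) = side False (entry b q p) \<longleftrightarrow> partner \<omega> b q = p"
    if "\<omega> \<in> consistent s" for \<omega>
    using partner_props(2)[OF consistent_bijs[OF that] q] partner_eq[OF consistent_bijs[OF that] q p]
    by blast
  thus ?thesis by (auto simp: consistent_Cons_iff simp del: side_entry)
qed

text \<open>
  Deferred decisions: given the history, the partner of a picked half-edge ranges over the unmatched
  half-edges of the other side, and each value leaves a set of matchings of the same kind.
\<close>

lemma sum_consistent: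
  assumes "valid s" "q \<in> alive (\<not> b) s"
  shows "(\<Sum>\<omega>\<in>consistent s. g \<omega> (partner \<omega> b q))
       = (\<Sum>p\<in>alive b s. \<Sum>\<omega>\<in>consistent (entry b q p # s). g \<omega> p :: 'b :: comm_monoid_add)"
proof -
  have "(\<Sum>\<omega>\<in>consistent s. g \<omega> (partner \<omega> b q))
      = (\<Sum>p\<in>alive b s. \<Sum>\<omega>\<in>{\<omega> \<in> consistent s. partner \<omega> b q = p}. g \<omega> (partner \<omega> b q))"
    using partner_alive[OF _ assms] by (intro sum.group[symmetric] finite_consistent) auto
  also have "\<dots> = (\<Sum>p\<in>alive b s. \<Sum>\<omega>\<in>consistent (entry b q p # s). g \<omega> p)"
    using consistent_entry[OF assms] by (intro sum.cong) auto
  finally show ?thesis .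
qed

lemma card_consistent:
  assumes "valid s" shows "card (consistent s) = fact (h - length s)"
  using assms
proof (induction "h - length s" arbitrary: s)
  case 0
  have full: "side c ` set s = H c" for c
  proof -
    have "alive c s = {}" using card_alive[OF 0(2), of c] 0(1) finite_alive[of c s] by simp
    thus ?thesis using 0(2) by (auto simp: alive_def valid_def)
  qed
  define \<omega>0 where "\<omega>0 = (\<lambda>x. if x \<in> H True then
      side False (SOME e. e \<in> set s \<and> side True e = x) else undefined)"
  have inj: "inj_on (side c) (set s)" for c
    using 0(2) by (simp add: valid_def distinct_map)
  have \<omega>0: "\<omega>0 (side True e) = side False e" if "e \<in> set s" for e
  proof -
    have "(SOME e'. e' \<in> set s \<and> side True e' = side True e) = e"
      by (rule some_equality) (use that inj[of True] in \<open>auto simp: inj_on_def\<close>)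
    moreover have "side True e \<in> H True" using full[of True] that by auto
    ultimately show ?thesis by (simp add: \<omega>0_def)
  qed
  have img: "\<omega>0 ` H True = H False"
    using \<omega>0 by (simp flip: full add: image_image)
  have "bij_betw \<omega>0 (H True) (H False)"
    unfolding bij_betw_def using img by (simp add: eq_card_imp_inj_on finite_H card_H)
  hence "\<omega>0 \<in> consistent s"
    using \<omega>0 img by (auto simp: consistent_def bijs_def \<omega>0_def split: if_splits)
  moreover have "\<omega> = \<omega>0" if "\<omega> \<in> consistent s" for \<omega>
  proof
    fix x show "\<omega> x = \<omega>0 x"
    proof (cases "x \<in> H True")
      case True
      then obtain e where "e \<in> set s" "x = side True e" using full[of True] by (metis imageE)
      thus ?thesis using that \<omega>0 by (auto simp: consistent_def)
    next
      case False
      thus ?thesis using that PiE_arb[of \<omega> "H True" "\<lambda>_. H False" x]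
        by (simp add: consistent_def bijs_def \<omega>0_def)
    qed
  qed
  ultimately have "consistent s = {\<omega>0}" by blast
  thus ?case using 0(1) by simp
next
  case (Suc k)
  have "card (alive False s) > 0" using card_alive[OF Suc(3), of False] Suc(2) by simp
  then obtain q where q: "q \<in> alive (\<not> True) s" by (auto simp: card_gt_0_iff)
  have "card (consistent s) = (\<Sum>p\<in>alive True s. card (consistent (entry True q p # s)))"
    using sum_consistent[OF Suc(3) q, of "\<lambda>_ _. 1::nat"] by simp
  also have "\<dots> = (\<Sum>p\<in>alive True s. fact k)"
  proof (rule sum.cong[OF refl])
    fix p assume p: "p \<in> alive True s"
    have "k = h - length (entry True q p # s)" using Suc(2) by simp
    thus "card (consistent (entry True q p # s)) = fact k"
      using Suc(1)[of "entry True q p # s"] valid_entry[OF Suc(3) q p] by metis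
  qed
  also have "\<dots> = fact (h - length s)"
    using card_alive[OF Suc(3), of True] Suc(2) by (metis fact_Suc of_nat_id sum_constant)
  finally show ?case .
qed

lemma card_bijs: "card bijs = fact h"
  using card_consistent[of "[]"] by simp

definition advance :: "(history \<Rightarrow> bool \<times> half_edge) \<Rightarrow> matching \<Rightarrow> history \<Rightarrow> history" where
  "advance pick \<omega> s =
     entry (fst (pick s)) (snd (pick s)) (partner \<omega> (fst (pick s)) (snd (pick s))) # s"

text \<open>The number bounds the steps; \<open>h\<close> steps always suffice, since each one matches a new half-edge.\<close>

fun run :: "(history \<Rightarrow> bool \<times> half_edge) \<Rightarrow> (history \<Rightarrow> bool) \<Rightarrow> matching \<Rightarrow> nat \<Rightarrow> history \<Rightarrow> history"
  where
    "run pick stop \<omega> 0 s = s"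
  | "run pick stop \<omega> (Suc k) s = (if stop s then s else
       run pick stop \<omega> k (advance pick \<omega> s))"

lemma run_invariant:
  assumes "P s"
    and "\<And>s. P s \<Longrightarrow> \<not> stop s \<Longrightarrow> P (advance pick \<omega> s)"
  shows "P (run pick stop \<omega> k s)"
  using assms(1) by (induction k arbitrary: s) (auto intro: assms(2))

lemma run_stops:
  "stop (run pick stop \<omega> k s) \<or> length (run pick stop \<omega> k s) = length s + k"
  by (induction k arbitrary: s) (auto simp: advance_def, metis add_Suc_right add_Suc length_Cons)

text \<open>
  Optional stopping without filtrations: if one uniformly revealed partner raises a potential by at
  most \<open>C\<close> on average, then at the state where the run stops it has grown by at most \<open>C\<close> times the
  number of steps. The set \<open>I\<close> of states only has to contain those that the run can reach.
\<close>

lemma sum_run_potential: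
  fixes V :: "history \<Rightarrow> real"
  assumes "I s" and "length s + k = h"
    and valid: "\<And>s. I s \<Longrightarrow> valid s"
    and pick: "\<And>s. I s \<Longrightarrow> \<not> stop s \<Longrightarrow> snd (pick s) \<in> alive (\<not> fst (pick s)) s"
    and I_step: "\<And>s p. I s \<Longrightarrow> \<not> stop s \<Longrightarrow> p \<in> alive (fst (pick s)) s \<Longrightarrow>
           I (entry (fst (pick s)) (snd (pick s)) p # s)"
    and V_step: "\<And>s. I s \<Longrightarrow> \<not> stop s \<Longrightarrow>
           (\<Sum>p\<in>alive (fst (pick s)) s. V (entry (fst (pick s)) (snd (pick s)) p # s))
             \<le> real (h - length s) * (V s + C)"
    and "C \<ge> 0"
  shows "(\<Sum>\<omega>\<in>consistent s. V (run pick stop \<omega> k s)) \<le> fact k * (V s + C * real k)"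
  using assms(1,2)
proof (induction k arbitrary: s)
  case 0
  thus ?case using card_consistent[OF valid[OF 0(1)]] by simp
next
  case (Suc k)
  have v: "valid s" using Suc valid by auto
  have card: "card (consistent s) = fact (Suc k)"
  proof -
    have "h - length s = Suc k" using Suc(3) by simp
    thus ?thesis using card_consistent[OF v] by (simp only:)
  qed
  show ?case
  proof (cases "stop s")
    case True
    have "(\<Sum>\<omega>\<in>consistent s. V (run pick stop \<omega> (Suc k) s)) = fact (Suc k) * V s"
      using True by (simp add: card del: fact_Suc)
    also have "\<dots> \<le> fact (Suc k) * (V s + C * real (Suc k))"
      using \<open>C \<ge> 0\<close> by (intro mult_left_mono) auto
    finally show ?thesis .
  next
    case False
    define b q where "b = fst (pick s)" and "q = snd (pick s)"
    have q: "q \<in> alive (\<not> b) s" using pick[OF Suc(2) False] by (simp add: b_def q_def)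
    have m: "real (h - length s) = real (Suc k)" using Suc(3) by simp
    have "(\<Sum>\<omega>\<in>consistent s. V (run pick stop \<omega> (Suc k) s))
        = (\<Sum>\<omega>\<in>consistent s. V (run pick stop \<omega> k (entry b q (partner \<omega> b q) # s)))"
      using False by (simp add: advance_def b_def q_def)
    also have "\<dots> = (\<Sum>p\<in>alive b s. \<Sum>\<omega>\<in>consistent (entry b q p # s).
        V (run pick stop \<omega> k (entry b q p # s)))"
      by (rule sum_consistent[OF v q, of "\<lambda>\<omega> p. V (run pick stop \<omega> k (entry b q p # s))"])
    also have "\<dots> \<le> (\<Sum>p\<in>alive b s. fact k * (V (entry b q p # s) + C * real k))"
      using I_step[OF Suc(2) False] Suc(3) by (intro sum_mono Suc.IH) (auto simp: b_def q_def)
    also have "\<dots> = fact k * ((\<Sum>p\<in>alive b s. V (entry b q p # s)) + real (h - length s) * (C * real k))"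
      using card_alive[OF v, of b] by (simp add: sum_distrib_left sum.distrib algebra_simps)
    also have "\<dots> \<le> fact k * (real (h - length s) * (V s + C) + real (h - length s) * (C * real k))"
      using V_step[OF Suc(2) False] by (intro mult_left_mono add_right_mono) (auto simp: b_def q_def)
    also have "\<dots> = fact (Suc k) * (V s + C * real (Suc k))"
      unfolding m by (simp add: algebra_simps)
    finally show ?thesis .
  qed
qed

end

section \<open>One step of the exploration\<close>

lemma one_minus_inverse_power_le:
  fixes m :: real assumes "m \<ge> 1"
  shows "(1 - 1/m)^k \<le> 1 - k/m + (k/m)\<^sup>2"
proof (induction k)
  case (Suc k)
  have "(1 - 1/m)^Suc k \<le> (1 - 1/m) * (1 - k/m + (k/m)\<^sup>2)"
    using Suc assms by (simp add: mult_left_mono)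
  also have "\<dots> = 1 - Suc k/m + (k/m)\<^sup>2 + k/m\<^sup>2 - k\<^sup>2/m^3"
    using assms by (simp add: field_simps power2_eq_square power3_eq_cube)
  also have "\<dots> \<le> 1 - Suc k/m + (k/m)\<^sup>2 + k/m\<^sup>2"
    using assms by simp
  also have "(k/m)\<^sup>2 + k/m\<^sup>2 = (k\<^sup>2 + k)/m\<^sup>2"
    by (simp add: power_divide add_divide_distrib)
  have "(k/m)\<^sup>2 + k/m\<^sup>2 \<le> (Suc k/m)\<^sup>2"
    unfolding power_divide add_divide_distrib[symmetric]
    by (intro divide_right_mono) (auto simp: power2_eq_square algebra_simps)
  hence "1 - Suc k/m + (k/m)\<^sup>2 + k/m\<^sup>2 \<le> 1 - Suc k/m + (Suc k/m)\<^sup>2" by linarith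
  finally show ?case .
qed simp

text \<open>
  Only deviations in the direction \<open>\<sigma>\<close> are penalised. For \<open>\<sigma> = 1\<close> this makes the potential monotone in
  the number of untouched vertices, so that it survives the removal of arbitrary vertices.
\<close>

definition excess :: "real \<Rightarrow> real \<Rightarrow> real \<Rightarrow> real" where
  "excess \<sigma> x0 x = (max 0 (\<sigma> * (x - x0)))\<^sup>2"

lemma excess_nonneg [simp]: "excess \<sigma> x0 x \<ge> 0"
  by (simp add: excess_def)

lemma excess_step:
  assumes "\<bar>\<sigma>\<bar> = 1"
  shows "excess \<sigma> x0 y \<le> excess \<sigma> x0 x + 2 * max 0 (\<sigma> * (x - x0)) * (\<sigma> * (y - x)) + (y - x)\<^sup>2"
proof -
  define a d where "a = \<sigma> * (x - x0)" and "d = \<sigma> * (y - x)"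
  have s: "\<sigma> * (y - x0) = a + d" by (simp add: a_def d_def algebra_simps)
  have d2: "d\<^sup>2 = (y - x)\<^sup>2"
    using assms by (metis d_def abs_mult mult_1 power2_abs)
  have "(max 0 (a + d))\<^sup>2 \<le> (max 0 a + d)\<^sup>2"
  proof (cases "a + d \<ge> 0")
    case True
    have "a + d \<le> max 0 a + d" by simp
    thus ?thesis using True by (simp add: max.absorb2 power_mono)
  next
    case False thus ?thesis by (simp add: max.absorb1)
  qed
  also have "\<dots> = (max 0 a)\<^sup>2 + 2 * max 0 a * d + d\<^sup>2" by (simp add: power2_sum)
  finally show ?thesis unfolding excess_def s d2 by (simp add: a_def d_def)
qed

definition step_bound :: "real \<Rightarrow> nat \<Rightarrow> real" where
  "step_bound \<zeta> k = 2 * (1/\<zeta>^k + 1/\<zeta>\<^sup>2) * (k\<^sup>2 * 2^k / \<zeta>^k) + ((k + 1) * 2^k / \<zeta>^k)\<^sup>2"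

lemma step_bound_nonneg: "\<zeta> > 0 \<Longrightarrow> step_bound \<zeta> k \<ge> 0"
  by (simp add: step_bound_def)

text \<open>
  Of \<open>m\<close> unmatched half-edges, \<open>k n\<close> belong to the \<open>n\<close> untouched vertices of degree \<open>k\<close>. Revealing one
  of the \<open>m\<close> at random changes \<open>n / z^k\<close> by a bounded amount whose mean is of order \<open>1/m\<close>; as the
  deviation itself is at most of order \<open>m\<close>, its square grows by a bounded amount on average.
\<close>

lemma excess_one_step:
  fixes k n m :: nat and z \<zeta> \<sigma> x0 :: real
  assumes k: "1 \<le> k" and kn: "k * n \<le> m" and m: "2 \<le> m"
    and x0: "0 \<le> x0" "x0 \<le> m / \<zeta>\<^sup>2" and \<zeta>: "0 < \<zeta>" "\<zeta> \<le> z" "z \<le> 1" and \<sigma>: "\<bar>\<sigma>\<bar> = 1"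
  defines "z' \<equiv> z * (1 - 1 / real m)"
  shows "(real m - k * n) * excess \<sigma> x0 (n / z'^k) + k * n * excess \<sigma> x0 ((real n - 1) / z'^k)
       \<le> m * (excess \<sigma> x0 (n / z^k) + step_bound \<zeta> k)"
proof -
  define q where "q = 1 - 1 / real m"
  define a where "a = n / z^k"
  define u where "u = a / q^k"
  define w where "w = u - 1 / z'^k"
  have q: "1/2 \<le> q" "q \<le> 1" using m by (auto simp: q_def field_simps)
  have qk: "1/2^k \<le> q^k" using q(1) power_mono[of "1/2" q k] by (simp add: power_divide)
  have qk1: "q^k \<le> 1" using q by (simp add: power_le_one)
  have qpos: "q^k > 0" using q by simp
  have iq: "1/q^k \<le> 2^k" using qk qpos by (simp add: field_simps)
  have zpos: "z > 0" using \<zeta> by simp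
  have izk: "1/z^k \<le> 1/\<zeta>^k" using \<zeta> zpos by (intro divide_left_mono power_mono) auto
  have z'k: "z'^k = z^k * q^k" by (simp add: z'_def q_def power_mult_distrib)
  have u: "n / z'^k = u" and w: "(real n - 1) / z'^k = w"
    by (simp_all add: u_def w_def a_def z'k diff_divide_distrib)
  have nm: "real n \<le> m"
  proof -
    have "n \<le> k * n" using k by simp
    thus ?thesis using kn by linarith
  qed
  have a: "0 \<le> a" "a \<le> m / \<zeta>^k"
  proof -
    show "0 \<le> a" using zpos by (simp add: a_def)
    have "n * (1/z^k) \<le> m * (1/\<zeta>^k)" using izk nm zpos by (intro mult_mono) auto
    thus "a \<le> m / \<zeta>^k" by (simp add: a_def)
  qed
  define P where "P = max 0 (\<sigma> * (a - x0))"
  have P: "0 \<le> P" "P \<le> m * (1/\<zeta>^k + 1/\<zeta>\<^sup>2)"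
  proof -
    have "P \<le> \<bar>a - x0\<bar>" unfolding P_def using \<sigma> by (metis abs_ge_self abs_ge_zero abs_mult max.boundedI mult_1)
    also have "\<dots> \<le> a + x0" using a x0 by auto
    also have "\<dots> \<le> m / \<zeta>^k + m / \<zeta>\<^sup>2" using a x0 by linarith
    finally show "P \<le> m * (1/\<zeta>^k + 1/\<zeta>\<^sup>2)" by (simp add: algebra_simps)
  qed (simp add: P_def)
  \<comment> \<open>the drift: its sign is that of the Bernoulli inequality, its size that of the second-order term\<close>
  have drift: "\<sigma> * ((real m - k*n) * (u - a) + k*n*(w - a)) \<le> k\<^sup>2 * 2^k / \<zeta>^k"
  proof -
    have kn_z: "k * n / z'^k = k * u" by (simp add: u_def a_def z'k)
    have "(real m - k*n) * (u - a) + k*n*(w - a) = m * (u - a) - k * n / z'^k"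
      by (simp add: w_def algebra_simps)
    also have "\<dots> = m * (u - a) - k * u" using kn_z by simp
    also have "\<dots> = (a/q^k) * (m * (1 - k/m - q^k))"
    proof -
      have "m * (a/Q - a) - k * (a/Q) = (a/Q) * (m * (1 - k/m - Q))" if "Q \<noteq> 0" for Q :: real
        using that m by (simp add: field_simps)
      from this[of "q^k"] show ?thesis using qpos q by (simp add: u_def)
    qed
    finally have eq: "(real m - k*n) * (u - a) + k*n*(w - a) = (a/q^k) * (m * (1 - k/m - q^k))" .
    have b1: "1 - k/m - q^k \<le> 0"
      using Bernoulli_inequality[of "- 1 / real m" k] m by (simp add: q_def)
    have b2: "q^k + k/m - 1 \<le> (k/m)\<^sup>2"
      using one_minus_inverse_power_le[of "real m" k] m by (simp add: q_def)
    have "\<bar>(real m - k*n) * (u - a) + k*n*(w - a)\<bar> = (a/q^k) * (m * (q^k + k/m - 1))"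
      unfolding eq abs_mult using a qpos b1 by simp
    also have "\<dots> \<le> (a/q^k) * (m * (k/m)\<^sup>2)"
      using a qpos b2 by (intro mult_left_mono) auto
    also have "\<dots> = a * (1/q^k) * (k\<^sup>2/m)" using m by (simp add: power2_eq_square field_simps)
    also have "\<dots> \<le> (m / \<zeta>^k) * 2^k * (k\<^sup>2/m)"
      using a iq qpos \<zeta> by (intro mult_right_mono mult_mono) auto
    also have "\<dots> = k\<^sup>2 * 2^k / \<zeta>^k" using m by (simp add: field_simps)
    finally have "\<bar>\<sigma> * ((real m - k*n) * (u - a) + k*n*(w - a))\<bar> \<le> k\<^sup>2 * 2^k / \<zeta>^k"
      using \<sigma> by (simp add: abs_mult)
    thus ?thesis by linarith
  qed
  define J where "J = (k + 1) * 2^k / \<zeta>^k"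
  have ua: "0 \<le> u - a" "u - a \<le> k * 2^k / \<zeta>^k"
  proof -
    have "a/Q - a = (a/Q) * (1 - Q)" if "Q \<noteq> 0" for Q :: real
      using that by (simp add: field_simps)
    from this[of "q^k"] have "u - a = (a/q^k) * (1 - q^k)" using qpos q by (simp add: u_def)
    moreover have "1 - q^k \<le> k/m"
      using Bernoulli_inequality[of "- 1 / real m" k] m by (simp add: q_def)
    moreover have "0 \<le> a/q^k" using a qpos by simp
    ultimately have "u - a \<le> (a/q^k) * (k/m)" "0 \<le> u - a"
      using qk1 mult_left_mono[of "1 - q^k" "k/m" "a/q^k"]
        mult_nonneg_nonneg[of "a/q^k" "1 - q^k"] by auto
    moreover have "(a/q^k) * (k/m) = a * (1/q^k) * (k/m)" by simp
    moreover have "\<dots> \<le> (m / \<zeta>^k) * 2^k * (k/m)"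
      using a iq qpos \<zeta> by (intro mult_right_mono mult_mono) auto
    moreover have "\<dots> = k * 2^k / \<zeta>^k" using m by (simp add: field_simps)
    ultimately show "0 \<le> u - a" "u - a \<le> k * 2^k / \<zeta>^k" by linarith+
  qed
  have iz': "0 \<le> 1 / z'^k" "1 / z'^k \<le> 2^k / \<zeta>^k"
  proof -
    have "1/z'^k = (1/q^k) * (1/z^k)" by (simp add: z'k)
    also have "\<dots> \<le> 2^k * (1/\<zeta>^k)" using iq izk qpos zpos by (intro mult_mono) auto
    finally show "1 / z'^k \<le> 2^k / \<zeta>^k" by simp
    show "0 \<le> 1 / z'^k" using z'k qpos zpos by simp
  qed
  have Jeq: "J = k * 2^k/\<zeta>^k + 2^k/\<zeta>^k" by (simp add: J_def add_divide_distrib distrib_right)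
  have Jn: "0 \<le> k * 2^k/\<zeta>^k" "0 \<le> 2^k/\<zeta>^k" using \<zeta> by simp_all
  have J1: "(u - a)\<^sup>2 \<le> J\<^sup>2" using ua Jeq Jn by (intro power_mono) linarith+
  have J2: "(w - a)\<^sup>2 \<le> J\<^sup>2"
  proof -
    have "\<bar>w - a\<bar> \<le> J" using ua iz' Jeq Jn unfolding w_def by linarith
    thus ?thesis by (metis abs_ge_zero power2_abs power_mono)
  qed
  have knm: "0 \<le> real m - k*n" using kn by (metis diff_ge_0_iff_ge of_nat_le_iff of_nat_mult)
  have "(real m - k * n) * excess \<sigma> x0 u + k * n * excess \<sigma> x0 w
     \<le> (real m - k * n) * (excess \<sigma> x0 a + 2*P*(\<sigma>*(u - a)) + J\<^sup>2)
       + k * n * (excess \<sigma> x0 a + 2*P*(\<sigma>*(w - a)) + J\<^sup>2)"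
    using excess_step[OF \<sigma>, of x0 u a] excess_step[OF \<sigma>, of x0 w a] J1 J2 knm
    by (intro add_mono mult_left_mono) (auto simp: P_def)
  also have "\<dots> = m * excess \<sigma> x0 a
      + 2 * P * (\<sigma> * ((real m - k*n) * (u - a) + k*n*(w - a))) + m * J\<^sup>2"
    by (simp add: algebra_simps)
  also have "\<dots> \<le> m * excess \<sigma> x0 a + 2 * (m * (1/\<zeta>^k + 1/\<zeta>\<^sup>2)) * (k\<^sup>2 * 2^k / \<zeta>^k) + m * J\<^sup>2"
  proof -
    have "P * (\<sigma> * ((real m - k*n) * (u - a) + k*n*(w - a))) \<le> P * (k\<^sup>2 * 2^k / \<zeta>^k)"
      using P drift by (intro mult_left_mono) auto
    also have "\<dots> \<le> (m * (1/\<zeta>^k + 1/\<zeta>\<^sup>2)) * (k\<^sup>2 * 2^k / \<zeta>^k)"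
      using P \<zeta> by (intro mult_right_mono) auto
    finally show ?thesis by simp
  qed
  also have "\<dots> = m * (excess \<sigma> x0 a + step_bound \<zeta> k)"
    by (simp add: step_bound_def J_def algebra_simps)
  finally show ?thesis unfolding u w by (simp add: a_def)
qed


section \<open>Concentration of the numbers of untouched vertices\<close>

text \<open>
  Side \<open>c\<close> has \<open>K c\<close> vertices of degrees \<open>dg c\<close>, and \<open>W\<close> is a set of individuals that count as touched
  from the start.
\<close>

locale degree_exploration =
  fixes K :: "bool \<Rightarrow> nat" and dg :: "bool \<Rightarrow> nat \<Rightarrow> nat" and h :: nat and W :: "nat set"
  assumes dg_pos: "v \<in> {1..K c} \<Longrightarrow> 1 \<le> dg c v"
    and sum_dg: "(\<Sum>v = 1..K c. dg c v) = h"
begin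

definition H :: "bool \<Rightarrow> half_edge set" where
  "H c = (SIGMA v:{1..K c}. {1..dg c v})"

sublocale matching_exploration H h
  using sum_dg by unfold_locales (auto simp: H_def)

lemma K_le_h: "K c \<le> h"
proof -
  have "(\<Sum>v = 1..K c. 1) \<le> (\<Sum>v = 1..K c. dg c v)" using dg_pos by (intro sum_mono) auto
  thus ?thesis using sum_dg[of c] by simp
qed

definition touched :: "bool \<Rightarrow> history \<Rightarrow> nat set" where
  "touched c s = (if c then W else {}) \<union> fst ` side c ` set s"

text \<open>
  \<open>clock c\<close> is close to the probability that a given half-edge of side \<open>c\<close> has not been revealed. It
  is insensitive to half-edges of side \<open>c\<close> being picked.
\<close>

fun clock :: "bool \<Rightarrow> history \<Rightarrow> real" where
  "clock c [] = 1"
| "clock c (e # s) = (if fst e = c then clock c s * (1 - 1 / real (h - length s)) else clock c s)"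

definition untouched :: "bool \<Rightarrow> nat \<Rightarrow> history \<Rightarrow> nat set" where
  "untouched c k s = {v \<in> {1..K c}. dg c v = k \<and> v \<notin> touched c s}"

lemma finite_untouched [simp]: "finite (untouched c k s)"
  by (simp add: untouched_def)

lemma touched_entry:
  "touched c (entry b q p # s) = insert (fst (if c = b then p else q)) (touched c s)"
  by (auto simp: touched_def)

text \<open>
  Every step moves exactly one of the two clocks, by the factor by which the number of unmatched
  half-edges decreases. This is what couples the two sides.
\<close>

lemma clock_product:
  assumes "length s \<le> h" shows "real h * clock True s * clock False s = real (h - length s)"
  using assms
proof (induction s)
  case (Cons e s)
  hence "length s < h" by simp
  hence "real (h - length s) * (1 - 1 / real (h - length s)) = real (h - length (e # s))"
    by (simp add: field_simps of_nat_diff)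
  thus ?case using Cons by (cases "fst e") (simp_all add: algebra_simps)
qed simp

lemma clock_bounds:
  assumes "length s \<le> h" shows "0 \<le> clock c s \<and> clock c s \<le> 1"
  using assms
proof (induction s)
  case (Cons e s)
  have "0 \<le> 1 - 1 / real (h - length s)" "1 - 1 / real (h - length s) \<le> 1"
    using Cons(2) by (auto simp: field_simps)
  thus ?case using Cons by (auto intro: mult_le_one)
qed simp

lemma alive_ge:
  assumes "length s \<le> h" and "\<And>c. \<zeta> \<le> clock c s" and "\<zeta> > 0"
  shows "\<zeta>\<^sup>2 * h \<le> real (h - length s)"
proof -
  have "\<zeta> * \<zeta> \<le> clock True s * clock False s"
    using assms by (intro mult_mono) (auto intro: order_trans[OF less_imp_le])
  hence "\<zeta>\<^sup>2 * h \<le> (clock True s * clock False s) * h"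
    by (intro mult_right_mono) (auto simp: power2_eq_square)
  thus ?thesis using clock_product[OF assms(1)] by (simp add: algebra_simps)
qed

lemma alive_untouched:
  "{p \<in> alive c s. fst p \<in> untouched c k s} = (SIGMA v:untouched c k s. {1..k})"
proof -
  have "p \<notin> side c ` set s" if "fst p \<notin> touched c s" for p
    using that by (auto simp: touched_def)
  thus ?thesis unfolding alive_def H_def untouched_def by (auto simp del: mem_Collect_eq) auto
qed

lemma card_alive_untouched: "card {p \<in> alive c s. fst p \<in> untouched c k s} = k * card (untouched c k s)"
  unfolding alive_untouched by (simp add: mult.commute)

definition deviation :: "real \<Rightarrow> bool \<Rightarrow> nat \<Rightarrow> history \<Rightarrow> real" where
  "deviation \<sigma> c k s = excess \<sigma> (card (untouched c k [])) (card (untouched c k s) / clock c s ^ k)"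

lemma deviation_nonneg [simp]: "deviation \<sigma> c k s \<ge> 0"
  by (simp add: deviation_def)

lemma deviation_Nil [simp]: "deviation \<sigma> c k [] = 0"
  by (simp add: deviation_def excess_def)

lemma excess_mono: "x \<le> y \<Longrightarrow> excess 1 x0 x \<le> excess 1 x0 y"
  unfolding excess_def by (intro power_mono) auto

text \<open>
  Picking a half-edge leaves the clock of its own side alone. It either belongs to a touched vertex or
  touches a new one, which is harmless for the upper deviation only.
\<close>

lemma deviation_picked_side:
  assumes "length s \<le> h" "\<sigma> = 1 \<or> fst q \<in> touched (\<not> b) s"
  shows "deviation \<sigma> (\<not> b) k (entry b q p # s) \<le> deviation \<sigma> (\<not> b) k s"
proof (cases "fst q \<in> touched (\<not> b) s")
  case True
  hence "untouched (\<not> b) k (entry b q p # s) = untouched (\<not> b) k s"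
    by (auto simp: untouched_def touched_entry)
  thus ?thesis by (simp add: deviation_def)
next
  case False
  have "untouched (\<not> b) k (entry b q p # s) \<subseteq> untouched (\<not> b) k s"
    by (auto simp: untouched_def touched_entry)
  hence "card (untouched (\<not> b) k (entry b q p # s)) / clock (\<not> b) s ^ k
       \<le> card (untouched (\<not> b) k s) / clock (\<not> b) s ^ k"
    using clock_bounds[OF assms(1), of "\<not> b"] by (intro divide_right_mono) (auto intro: card_mono)
  thus ?thesis using assms(2) False by (auto simp: deviation_def intro: excess_mono)
qed

lemma deviation_revealed_side:
  assumes v: "valid s" and \<sigma>: "\<bar>\<sigma>\<bar> = 1" and k: "1 \<le> k"
    and \<zeta>: "\<zeta> > 0" "\<And>c. \<zeta> \<le> clock c s" and two: "2 \<le> h - length s"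
  shows "(\<Sum>p\<in>alive b s. deviation \<sigma> b k (entry b q p # s))
       \<le> real (h - length s) * (deviation \<sigma> b k s + step_bound \<zeta> k)"
proof -
  define m n x0 where "m = h - length s" and "n = card (untouched b k s)"
    and "x0 = real (card (untouched b k []))"
  define z' where "z' = clock b s * (1 - 1 / real m)"
  define S where "S = {p \<in> alive b s. fst p \<in> untouched b k s}"
  have le: "length s \<le> h" using two by simp
  have cS: "card S = k * n" unfolding S_def n_def by (rule card_alive_untouched)
  have cA: "card (alive b s) = m" unfolding m_def by (rule card_alive[OF v])
  have SA: "S \<subseteq> alive b s" by (auto simp: S_def)
  have hit: "deviation \<sigma> b k (entry b q p # s) = excess \<sigma> x0 ((real n - 1) / z'^k)" if "p \<in> S" for p
  proof -
    have "untouched b k (entry b q p # s) = untouched b k s - {fst p}"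
      by (auto simp: untouched_def touched_entry)
    moreover have "fst p \<in> untouched b k s" using that by (simp add: S_def)
    ultimately have "real (card (untouched b k (entry b q p # s))) = real n - 1"
      by (simp add: n_def card_gt_0_iff of_nat_diff Suc_leI)
         (metis One_nat_def Suc_leI card_gt_0_iff empty_iff finite_untouched of_nat_1 of_nat_diff)
    thus ?thesis by (simp add: deviation_def x0_def z'_def m_def)
  qed
  have miss: "deviation \<sigma> b k (entry b q p # s) = excess \<sigma> x0 (n / z'^k)" if "p \<in> alive b s - S" for p
  proof -
    have "untouched b k (entry b q p # s) = untouched b k s"
      using that by (auto simp: untouched_def touched_entry S_def)
    thus ?thesis by (simp add: deviation_def x0_def z'_def m_def n_def)
  qed
  have knm: "k * n \<le> m" using card_mono[OF _ SA] cS cA by simp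
  have "(\<Sum>p\<in>alive b s. deviation \<sigma> b k (entry b q p # s))
      = (\<Sum>p\<in>alive b s - S. excess \<sigma> x0 (n / z'^k)) + (\<Sum>p\<in>S. excess \<sigma> x0 ((real n - 1) / z'^k))"
    using sum.subset_diff[OF SA finite_alive, of "\<lambda>p. deviation \<sigma> b k (entry b q p # s)"] hit miss
    by simp
  also have "\<dots> = (real m - k * n) * excess \<sigma> x0 (n / z'^k) + k * n * excess \<sigma> x0 ((real n - 1) / z'^k)"
    using card_Diff_subset[OF finite_subset[OF SA finite_alive] SA] cS cA knm
    by (simp add: of_nat_diff)
  also have "\<dots> \<le> m * (excess \<sigma> x0 (n / clock b s^k) + step_bound \<zeta> k)"
    unfolding z'_def
  proof (rule excess_one_step[OF k knm])
    show "2 \<le> m" using two by (simp add: m_def)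
    have "card (untouched b k []) \<le> K b"
      using card_mono[of "{1..K b}" "untouched b k []"] by (simp add: untouched_def subset_eq)
    hence "x0 \<le> h" using K_le_h[of b] by (simp add: x0_def)
    also have "h \<le> m / \<zeta>\<^sup>2" using alive_ge[OF le \<zeta>(2,1)] \<zeta>(1) by (simp add: field_simps m_def)
    finally show "x0 \<le> m / \<zeta>\<^sup>2" .
  qed (use \<sigma> \<zeta> clock_bounds[OF le] in \<open>auto simp: x0_def\<close>)
  finally show ?thesis by (simp add: deviation_def n_def m_def x0_def)
qed

definition potential :: "real \<Rightarrow> nat \<Rightarrow> history \<Rightarrow> real" where
  "potential \<sigma> B s = (\<Sum>k = 1..B. \<Sum>c\<in>UNIV. deviation \<sigma> c k s)"

definition run_bound :: "real \<Rightarrow> nat \<Rightarrow> real" where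
  "run_bound \<zeta> B = (\<Sum>k = 1..B. step_bound \<zeta> k)"

lemma potential_step:
  assumes v: "valid s" and \<sigma>: "\<bar>\<sigma>\<bar> = 1"
    and \<zeta>: "\<zeta> > 0" "\<And>c. \<zeta> \<le> clock c s" and two: "2 \<le> h - length s"
    and wake: "\<sigma> = 1 \<or> fst q \<in> touched (\<not> b) s"
  shows "(\<Sum>p\<in>alive b s. potential \<sigma> B (entry b q p # s))
       \<le> real (h - length s) * (potential \<sigma> B s + run_bound \<zeta> B)"
proof -
  have le: "length s \<le> h" using two by simp
  have UN: "(\<Sum>c\<in>UNIV. f c) = f b + f (\<not> b)" for f :: "bool \<Rightarrow> real"
    by (cases b) (simp_all add: UNIV_bool)
  have "(\<Sum>p\<in>alive b s. potential \<sigma> B (entry b q p # s))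
      = (\<Sum>k = 1..B. (\<Sum>p\<in>alive b s. deviation \<sigma> b k (entry b q p # s))
           + (\<Sum>p\<in>alive b s. deviation \<sigma> (\<not> b) k (entry b q p # s)))"
    unfolding potential_def UN by (subst sum.swap) (simp add: sum.distrib)
  also have "\<dots> \<le> (\<Sum>k = 1..B. real (h - length s) * (deviation \<sigma> b k s + step_bound \<zeta> k)
           + (\<Sum>p\<in>alive b s. deviation \<sigma> (\<not> b) k s))"
    using deviation_revealed_side[OF v \<sigma> _ \<zeta> two] deviation_picked_side[OF le wake]
    by (intro sum_mono add_mono) auto
  also have "\<dots> = (\<Sum>k = 1..B. real (h - length s) * (deviation \<sigma> b k s + deviation \<sigma> (\<not> b) k s + step_bound \<zeta> k))"
    by (simp add: card_alive[OF v] algebra_simps)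
  also have "\<dots> = real (h - length s) * (potential \<sigma> B s + run_bound \<zeta> B)"
    unfolding potential_def UN run_bound_def by (simp add: sum_distrib_left sum.distrib algebra_simps)
  finally show ?thesis .
qed

text \<open>
  The potential grows by a constant per step, hence is at most of order \<open>h\<close> at the end of the run,
  while a deviation of order \<open>h\<close> would make it of order \<open>h^2\<close>. Nothing is assumed about the strategy
  except that the clocks stay above \<open>\<zeta>\<close> until the run stops.
\<close>

lemma run_concentration:
  fixes \<theta> :: real
  assumes \<sigma>: "\<bar>\<sigma>\<bar> = 1" and \<zeta>: "\<zeta> > 0" and I0: "I []" and h: "h > 0" and \<theta>: "\<theta> > 0"
    and valid: "\<And>s. I s \<Longrightarrow> valid s"
    and clocks: "\<And>s c. I s \<Longrightarrow> \<not> stop s \<Longrightarrow> \<zeta> \<le> clock c s"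
    and two: "\<And>s. I s \<Longrightarrow> \<not> stop s \<Longrightarrow> 2 \<le> h - length s"
    and pick: "\<And>s. I s \<Longrightarrow> \<not> stop s \<Longrightarrow> snd (pick s) \<in> alive (\<not> fst (pick s)) s"
    and wake: "\<And>s. I s \<Longrightarrow> \<not> stop s \<Longrightarrow> \<sigma> = 1 \<or> fst (snd (pick s)) \<in> touched (\<not> fst (pick s)) s"
    and I_step: "\<And>s p. I s \<Longrightarrow> \<not> stop s \<Longrightarrow> p \<in> alive (fst (pick s)) s \<Longrightarrow>
           I (entry (fst (pick s)) (snd (pick s)) p # s)"
  shows "card {\<omega> \<in> bijs. potential \<sigma> B (run pick stop \<omega> h []) > (\<theta> * h)\<^sup>2}
           \<le> run_bound \<zeta> B / (\<theta>\<^sup>2 * h) * card bijs"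
proof -
  let ?V = "\<lambda>\<omega>. potential \<sigma> B (run pick stop \<omega> h [])"
  let ?S = "{\<omega> \<in> bijs. ?V \<omega> > (\<theta> * h)\<^sup>2}"
  have nn: "0 \<le> potential \<sigma> B s" for s by (auto simp: potential_def intro!: sum_nonneg)
  have "real (card ?S) * (\<theta> * h)\<^sup>2 = (\<Sum>\<omega>\<in>?S. (\<theta> * h)\<^sup>2)" by simp
  also have "\<dots> \<le> (\<Sum>\<omega>\<in>?S. ?V \<omega>)" by (intro sum_mono) auto
  also have "\<dots> \<le> (\<Sum>\<omega>\<in>bijs. ?V \<omega>)" using nn finite_bijs by (intro sum_mono2) auto
  also have "\<dots> = (\<Sum>\<omega>\<in>consistent []. ?V \<omega>)" by simp
  also have "\<dots> \<le> fact h * (potential \<sigma> B [] + run_bound \<zeta> B * real h)"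
  proof (rule sum_run_potential[where I = I])
    show "run_bound \<zeta> B \<ge> 0"
      using step_bound_nonneg[OF \<zeta>] by (auto intro: sum_nonneg simp: run_bound_def)
    show "(\<Sum>p\<in>alive (fst (pick s)) s. potential \<sigma> B (entry (fst (pick s)) (snd (pick s)) p # s))
        \<le> real (h - length s) * (potential \<sigma> B s + run_bound \<zeta> B)" if "I s" "\<not> stop s" for s
      using that by (intro potential_step[OF _ \<sigma> \<zeta>] valid clocks two wake)
  qed (use I0 valid pick I_step in auto)
  also have "\<dots> = card bijs * (run_bound \<zeta> B * h)" by (simp add: card_bijs potential_def algebra_simps)
  finally have "real (card ?S) \<le> card bijs * (run_bound \<zeta> B * h) / (\<theta> * h)\<^sup>2"
    using h \<theta> by (subst pos_le_divide_eq) auto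
  also have "\<dots> = run_bound \<zeta> B / (\<theta>\<^sup>2 * h) * card bijs"
    using h \<theta> by (simp add: power2_eq_square field_simps)
  finally show ?thesis .
qed

lemma untouched_near_fluid:
  fixes \<theta> \<sigma> :: real
  assumes "potential \<sigma> B s \<le> (\<theta> * h)\<^sup>2" "k \<in> {1..B}" "length s \<le> h" "0 < clock c s" "\<theta> \<ge> 0"
  shows "\<sigma> * (card (untouched c k s) - card (untouched c k []) * clock c s ^ k) \<le> \<theta> * h"
proof -
  define x x0 where "x = card (untouched c k s) / clock c s ^ k" and "x0 = real (card (untouched c k []))"
  have "deviation \<sigma> c k s \<le> (\<Sum>c\<in>UNIV. deviation \<sigma> c k s)" by (rule member_le_sum) auto
  also have "\<dots> \<le> potential \<sigma> B s" unfolding potential_def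
    using assms by (intro member_le_sum) (auto intro!: sum_nonneg)
  finally have "deviation \<sigma> c k s \<le> (\<theta> * h)\<^sup>2" using assms(1) by linarith
  hence "(max 0 (\<sigma> * (x - x0)))\<^sup>2 \<le> (\<theta> * h)\<^sup>2"
    by (simp only: deviation_def excess_def x_def x0_def)
  hence "max 0 (\<sigma> * (x - x0)) \<le> \<theta> * h" by (rule power2_le_imp_le) (use assms(5) in simp)
  hence "\<sigma> * (x - x0) \<le> \<theta> * h" by simp
  hence "\<sigma> * (x - x0) * clock c s ^ k \<le> \<theta> * h * clock c s ^ k"
    using assms(4) by (intro mult_right_mono) auto
  also have "\<dots> \<le> \<theta> * h * 1"
    using clock_bounds[OF assms(3), of c] assms(5) by (intro mult_left_mono) (auto simp: power_le_one)
  finally show ?thesis using assms(4) by (simp add: x_def x0_def algebra_simps)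
qed

end

section \<open>Generating functions and the fixed point equation\<close>

lemma integrable_pgf: "z \<in> {0..1} \<Longrightarrow> integrable (measure_pmf X) (\<lambda>k. z ^ k :: real)"
  by (rule measure_pmf.integrable_const_bound[where B = 1]) (auto simp: power_le_one)

lemma pgf_1 [simp]: "pgf X 1 = 1"
  by (simp add: pgf_def)

lemma pgf_mono: "x \<in> {0..1} \<Longrightarrow> y \<in> {0..1} \<Longrightarrow> x \<le> y \<Longrightarrow> pgf X x \<le> pgf X y"
  unfolding pgf_def by (intro integral_mono integrable_pgf power_mono) auto

lemma pgf_range: "z \<in> {0..1} \<Longrightarrow> pgf X z \<in> {0..1}"
  using pgf_mono[of z 1 X] by (auto simp: pgf_def intro!: integral_nonneg_AE)

lemma continuous_on_pgf: "continuous_on {0..1} (pgf X)"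
  unfolding continuous_on_sequentially
proof (intro allI impI ballI, elim conjE)
  fix x :: "nat \<Rightarrow> real" and a :: real
  assume a: "a \<in> {0..1}" and x: "\<forall>n. x n \<in> {0..1}" and lim: "x \<longlonglongrightarrow> a"
  have "(\<lambda>n. measure_pmf.expectation X (\<lambda>k. x n ^ k)) \<longlonglongrightarrow> measure_pmf.expectation X (\<lambda>k. a ^ k)"
    by (rule integral_dominated_convergence[where w = "\<lambda>_. 1"])
       (use x lim in \<open>auto simp: power_le_one intro!: tendsto_power\<close>)
  thus "(pgf X \<circ> x) \<longlonglongrightarrow> pgf X a" by (simp add: pgf_def comp_def)
qed

lemma pgf_convex:
  assumes "x \<in> {0..1}" "y \<in> {0..1}" "t \<in> {0..1}"
  shows "pgf X ((1 - t) * x + t * y) \<le> (1 - t) * pgf X x + t * pgf X y"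
proof -
  have xy: "(1 - t) * x + t * y \<in> {0..1}"
    using assms by (auto intro!: convex_bound_le)
  have pw: "((1 - t) * x + t * y)^k \<le> (1 - t) * x^k + t * y^k" for k
  proof -
    have "convex_on {0..} (\<lambda>x. x^k :: real)" 
      using convex_on_subset[OF convex_power_even, of k "{0..}"] convex_power_odd[of k] by (cases "even k") auto
    from convex_onD[OF this, of t x y] show ?thesis using assms by simp
  qed
  have "pgf X ((1 - t) * x + t * y) \<le> measure_pmf.expectation X (\<lambda>k. (1 - t) * x^k + t * y^k)"
    unfolding pgf_def using assms xy pw
    by (intro integral_mono Bochner_Integration.integrable_add integrable_mult_right integrable_pgf) auto
  also have "\<dots> = (1 - t) * pgf X x + t * pgf X y"
    unfolding pgf_def using assms integrable_pgf by simp
  finally show ?thesis .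
qed

text \<open>
  The slope of the chord of the generating function from \<open>x\<close> to \<open>1\<close>. It increases to the mean, which
  may be infinite, as \<open>x\<close> tends to \<open>1\<close>; this replaces derivatives at \<open>1\<close>.
\<close>

definition slope :: "nat pmf \<Rightarrow> real \<Rightarrow> real" where
  "slope X x = measure_pmf.expectation X (\<lambda>k. \<Sum>i<k. x ^ i)"

lemma geometric_le: "x \<in> {0..<1} \<Longrightarrow> (\<Sum>i<k. x ^ i) \<le> 1 / (1 - x :: real)"
  by (auto simp: sum_gp_strict intro!: divide_right_mono)

lemma integrable_geometric: "x \<in> {0..<1} \<Longrightarrow> integrable (measure_pmf X) (\<lambda>k. \<Sum>i<k. x ^ i :: real)"
  using geometric_le[of x]
  by (intro measure_pmf.integrable_const_bound[where B = "1 / (1 - x)"]) (auto simp: sum_nonneg)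

lemma one_minus_pgf:
  assumes "x \<in> {0..<1}" shows "1 - pgf X x = slope X x * (1 - x)"
proof -
  have "slope X x * (1 - x) = measure_pmf.expectation X (\<lambda>k. (\<Sum>i<k. x ^ i) * (1 - x))"
    by (simp add: slope_def)
  also have "\<dots> = measure_pmf.expectation X (\<lambda>k. 1 - x ^ k)"
    by (simp only: one_diff_power_eq mult.commute)
  also have "\<dots> = 1 - pgf X x"
    using assms integrable_pgf[of x X] by (simp add: pgf_def)
  finally show ?thesis by simp
qed

lemma ennreal_slope:
  assumes "x \<in> {0..<1}" shows "ennreal (slope X x) = (\<integral>\<^sup>+k. ennreal (\<Sum>i<k. x ^ i) \<partial>measure_pmf X)"
  unfolding slope_def using assms
  by (intro nn_integral_eq_integral[symmetric] integrable_geometric) (auto simp: sum_nonneg)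

lemma slope_nonneg: "x \<in> {0..<1} \<Longrightarrow> slope X x \<ge> 0"
  unfolding slope_def by (intro integral_nonneg_AE) (auto simp: sum_nonneg)

lemma slope_mono: "x \<in> {0..<1} \<Longrightarrow> y \<in> {0..<1} \<Longrightarrow> x \<le> y \<Longrightarrow> slope X x \<le> slope X y"
  unfolding slope_def
  by (intro integral_mono integrable_geometric sum_mono power_mono) auto

lemma slope_le_ext_mean:
  assumes "x \<in> {0..<1}" shows "ennreal (slope X x) \<le> ext_mean X"
  unfolding ennreal_slope[OF assms] ext_mean_def
proof (rule nn_integral_mono)
  fix k :: nat
  have "(\<Sum>i<k. x ^ i) \<le> (\<Sum>i<k. 1)" using assms by (intro sum_mono) (auto simp: power_le_one)
  thus "ennreal (\<Sum>i<k. x ^ i) \<le> of_nat k" by (simp add: ennreal_of_nat_eq_real_of_nat ennreal_leI)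
qed

lemma SUP_slope: "(SUP j. ennreal (slope X (1 - 1 / real (j + 2)))) = ext_mean X"
proof -
  define x where "x j = 1 - 1 / real (j + 2)" for j :: nat
  have x01: "x j \<in> {0..<1}" for j by (auto simp: x_def field_simps)
  have inc: "x i \<le> x j" if "i \<le> j" for i j using that by (auto simp: x_def field_simps)
  have lim: "x \<longlonglongrightarrow> 1"
  proof -
    have "(\<lambda>j. 1 / real (j + 2)) \<longlonglongrightarrow> 0"
      by (rule LIMSEQ_ignore_initial_segment[OF lim_1_over_n])
    thus ?thesis unfolding x_def using tendsto_diff[OF tendsto_const[of "1::real"]] by fastforce
  qed
  have "(SUP j. ennreal (slope X (x j))) = (SUP j. \<integral>\<^sup>+k. ennreal (\<Sum>i<k. x j ^ i) \<partial>measure_pmf X)"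
    using x01 by (simp add: ennreal_slope)
  also have "\<dots> = (\<integral>\<^sup>+k. (SUP j. ennreal (\<Sum>i<k. x j ^ i)) \<partial>measure_pmf X)"
  proof (rule nn_integral_monotone_convergence_SUP[symmetric])
    show "incseq (\<lambda>j k. ennreal (\<Sum>i<k. x j ^ i))"
      using inc x01 by (auto simp: incseq_def le_fun_def intro!: ennreal_leI sum_mono power_mono)
  qed simp
  also have "\<dots> = (\<integral>\<^sup>+k. of_nat k \<partial>measure_pmf X)"
  proof (rule nn_integral_cong)
    fix k :: nat
    have "(\<lambda>j. ennreal (\<Sum>i<k. x j ^ i)) \<longlonglongrightarrow> ennreal (\<Sum>i<k. 1 ^ i)"
      by (intro tendsto_ennrealI tendsto_sum tendsto_power lim)
    moreover have "incseq (\<lambda>j. ennreal (\<Sum>i<k. x j ^ i))"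
      using inc x01 by (auto simp: incseq_def intro!: ennreal_leI sum_mono power_mono)
    ultimately have "(SUP j. ennreal (\<Sum>i<k. x j ^ i)) = ennreal (\<Sum>i<k. 1 ^ i)"
      using LIMSEQ_SUP LIMSEQ_unique by blast
    thus "(SUP j. ennreal (\<Sum>i<k. x j ^ i)) = of_nat k"
      by (simp add: ennreal_of_nat_eq_real_of_nat)
  qed
  finally show ?thesis by (simp add: x_def ext_mean_def)
qed

text \<open>
  If the product of the means exceeds \<open>1\<close>, so does the product of two chord slopes, and that product
  bounds the ratio of \<open>1 - f(x)\<close> to \<open>1 - x\<close> from below for all larger \<open>x\<close>.
\<close>

lemma supercritical_near_1:
  assumes "ext_mean X * ext_mean Y > 1"
  shows "\<exists>x0<1. \<forall>x\<in>{x0<..<1}. pgf Y (pgf X x) < x"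
proof -
  define u where "u j = 1 - 1 / real (j + 2)" for j :: nat
  have u01: "u j \<in> {0..<1}" for j by (auto simp: u_def field_simps)
  have "1 < (SUP i. ennreal (slope X (u i))) * ext_mean Y"
    using assms SUP_slope[of X] by (simp add: u_def)
  also have "\<dots> = (SUP i. ennreal (slope X (u i)) * ext_mean Y)"
    by (rule SUP_mult_right_ennreal)
  finally obtain i where "1 < ennreal (slope X (u i)) * ext_mean Y" by (auto simp: less_SUP_iff)
  also have "\<dots> = (SUP j. ennreal (slope X (u i)) * ennreal (slope Y (u j)))"
    using SUP_slope[of Y] by (simp add: SUP_mult_left_ennreal[symmetric] u_def)
  finally obtain j where ij: "1 < ennreal (slope X (u i)) * ennreal (slope Y (u j))"
    by (auto simp: less_SUP_iff)
  hence ij: "1 < slope X (u i) * slope Y (u j)"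
    using slope_nonneg[OF u01] by (metis ennreal_1 ennreal_less_iff ennreal_mult zero_le_one)
  have "continuous (at 1 within {0..1}) (pgf X)"
    using continuous_on_pgf by (simp add: continuous_on_eq_continuous_within)
  hence "(pgf X \<longlongrightarrow> 1) (at 1 within {0..1})" by (simp add: continuous_within)
  hence "eventually (\<lambda>x. pgf X x > u j) (at 1 within {0..1})"
    using u01[of j] by (intro order_tendstoD) auto
  then obtain d where d: "d > 0" "\<And>x. x \<in> {0..1} \<Longrightarrow> x \<noteq> 1 \<Longrightarrow> dist x 1 < d \<Longrightarrow> pgf X x > u j"
    unfolding eventually_at by blast
  show ?thesis
  proof (intro exI[of _ "max (u i) (1 - d)"] conjI ballI)
    show "max (u i) (1 - d) < 1" using u01[of i] d by auto
    fix x assume x: "x \<in> {max (u i) (1 - d)<..<1}"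
    hence x01: "x \<in> {0..<1}" "u i \<le> x" using u01[of i] by auto
    have y: "u j < pgf X x" "pgf X x \<le> 1"
      using d(2)[of x] x x01 pgf_range[of x X] by (auto simp: dist_real_def)
    show "pgf Y (pgf X x) < x"
    proof (cases "pgf X x = 1")
      case True
      have "slope X x * (1 - x) = 0" using one_minus_pgf[OF x01(1), of X] True by simp
      hence "slope X x = 0" using x by auto
      hence "slope X (u i) \<le> 0" using slope_mono[OF u01 x01(1,2), of X] by simp
      hence "slope X (u i) * slope Y (u j) \<le> 0" using slope_nonneg[OF u01[of j], of Y]
        by (simp add: mult_nonpos_nonneg)
      thus ?thesis using ij by simp
    next
      case False
      hence y01: "pgf X x \<in> {0..<1}" using y u01[of j] by auto
      have "1 - pgf Y (pgf X x) = slope Y (pgf X x) * slope X x * (1 - x)"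
        using one_minus_pgf[OF y01, of Y] one_minus_pgf[OF x01(1), of X] by simp
      moreover have "slope Y (pgf X x) * slope X x \<ge> slope Y (u j) * slope X (u i)"
        using slope_mono[OF u01 y01] slope_mono[OF u01 x01(1,2)] y slope_nonneg[OF u01] slope_nonneg[OF y01]
        by (intro mult_mono) auto
      ultimately have "1 - pgf Y (pgf X x) > 1 * (1 - x)"
        using ij x mult_strict_right_mono[of 1 "slope Y (pgf X x) * slope X x" "1 - x"]
        by (simp add: mult.commute)
      thus ?thesis by simp
    qed
  qed
qed

text \<open>A chord slope attains the mean only if the generating function is affine.\<close>

lemma slope_eq_mean_imp:
  assumes x: "x \<in> {0..<1}" and eq: "ennreal (slope X x) = ext_mean X"
  shows "ext_mean X = ennreal (pmf X 1)"
proof -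
  have fin: "(\<integral>\<^sup>+k. ennreal (\<Sum>i<k. x ^ i) \<partial>measure_pmf X) \<noteq> \<infinity>"
    using ennreal_slope[OF x, of X] by (metis ennreal_neq_top infinity_ennreal_def)
  have le: "ennreal (\<Sum>i<k. x ^ i) \<le> of_nat k" for k
  proof -
    have "(\<Sum>i<k. x ^ i) \<le> (\<Sum>i<k. 1)" using x by (intro sum_mono) (auto simp: power_le_one)
    thus ?thesis by (simp add: ennreal_of_nat_eq_real_of_nat ennreal_leI)
  qed
  have "(\<integral>\<^sup>+k. of_nat k - ennreal (\<Sum>i<k. x ^ i) \<partial>measure_pmf X)
      = ext_mean X - ennreal (slope X x)"
    unfolding ennreal_slope[OF x] ext_mean_def using fin le by (intro nn_integral_diff) auto
  also have "\<dots> = 0" using eq by (metis ennreal_diff_self ennreal_neq_top)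
  finally have "AE k in measure_pmf X. of_nat k - ennreal (\<Sum>i<k. x ^ i) = 0"
    by (simp add: nn_integral_0_iff_AE)
  hence z: "of_nat k - ennreal (\<Sum>i<k. x ^ i) = 0" if "k \<in> set_pmf X" for k
    using that by (simp add: AE_measure_pmf_iff)
  have supp: "k \<le> 1" if "k \<in> set_pmf X" for k
  proof (rule ccontr)
    assume "\<not> k \<le> 1"
    hence "(\<Sum>i<k. x ^ i) < (\<Sum>i<k. 1)"
      using x by (intro sum_strict_mono_ex1) (auto simp: power_le_one intro!: bexI[of _ "1::nat"])
    hence "ennreal (\<Sum>i<k. x ^ i) < ennreal (real k)" using x \<open>\<not> k \<le> 1\<close> by (intro ennreal_lessI) auto
    thus False using z[OF that]
      by (simp add: ennreal_of_nat_eq_real_of_nat diff_eq_0_iff_ennreal)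
  qed
  have "ext_mean X = (\<integral>\<^sup>+k. indicator {1} k \<partial>measure_pmf X)"
    unfolding ext_mean_def using supp
    by (intro nn_integral_cong_AE) (auto simp: AE_measure_pmf_iff indicator_def le_Suc_eq)
  also have "\<dots> = ennreal (pmf X 1)" by (simp add: emeasure_pmf_single)
  finally show ?thesis .
qed

text \<open>
  Chord slopes are at most the means, so \<open>f(x) \<ge> x\<close> when the product of the means is at most \<open>1\<close>.
  Equality would force both generating functions to be affine with slopes of product \<open>1\<close>; as an affine
  generating function has slope at most \<open>1\<close>, both would be the identity.
\<close>

lemma subcritical_above:
  assumes "ext_mean X * ext_mean Y \<le> 1" and nd: "\<not> (pmf X 1 = 1 \<and> pmf Y 1 = 1)" and x: "x \<in> {0..<1}"
  shows "x < pgf Y (pgf X x)"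
proof (cases "pgf X x = 1")
  case True thus ?thesis using x by simp
next
  case False
  hence y: "pgf X x \<in> {0..<1}" using pgf_range[of x X] x by auto
  define a b where "a = slope X x" and "b = slope Y (pgf X x)"
  have ab: "0 \<le> a" "0 \<le> b" using slope_nonneg x y by (auto simp: a_def b_def)
  have am: "ennreal a \<le> ext_mean X" and bm: "ennreal b \<le> ext_mean Y"
    using slope_le_ext_mean x y by (auto simp: a_def b_def)
  have "ennreal (a * b) \<le> ext_mean X * ext_mean Y"
    using ab am bm by (simp add: ennreal_mult mult_mono)
  hence "a * b \<le> 1" using assms(1) by (metis ab(1) ennreal_1 ennreal_le_iff order_trans zero_le_one)
  moreover have "a * b \<noteq> 1"
  proof
    assume ab1: "a * b = 1"
    hence pos: "a > 0" "b > 0" using ab by (metis less_eq_real_def mult_zero_left mult_zero_right zero_neq_one)+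
    have "ext_mean X \<noteq> \<infinity>" "ext_mean Y \<noteq> \<infinity>"
      using assms(1) am bm pos by (auto simp: ennreal_mult_top ennreal_top_mult top_unique split: if_splits)
    then obtain mx my where m: "ext_mean X = ennreal mx" "ext_mean Y = ennreal my" "0 \<le> mx" "0 \<le> my"
      by (metis ennreal_cases infinity_ennreal_def)
    have le: "a \<le> mx" "b \<le> my" "mx * my \<le> 1"
      using am bm assms(1) m ab by (auto simp flip: ennreal_mult simp: ennreal_le_1)
    have "mx = a" "my = b"
    proof -
      have "a * b \<le> mx * b" "mx * b \<le> mx * my" using le pos m by (auto intro: mult_mono)
      hence "mx * b = a * b" "mx * my = mx * b" using le ab1 by linarith+
      thus "mx = a" using pos by simp
      thus "my = b" using \<open>mx * my = mx * b\<close> pos by simp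
    qed
    hence "ext_mean X = ennreal (pmf X 1)" "ext_mean Y = ennreal (pmf Y 1)"
      using slope_eq_mean_imp[OF x, of X] slope_eq_mean_imp[OF y, of Y] m by (simp_all add: a_def b_def)
    hence "mx = pmf X 1" "my = pmf Y 1" using m by simp_all
    hence "pmf X 1 * pmf Y 1 = 1" using ab1 \<open>mx = a\<close> \<open>my = b\<close> by simp
    moreover have "pmf X 1 * pmf Y 1 \<le> pmf X 1 * 1" "pmf X 1 * pmf Y 1 \<le> 1 * pmf Y 1"
      by (intro mult_mono; simp add: pmf_le_1)+
    ultimately show False using nd pmf_le_1[of X 1] pmf_le_1[of Y 1] by simp
  qed
  ultimately have "a * b * (1 - x) < 1 - x" using x by auto
  moreover have "1 - pgf Y (pgf X x) = b * a * (1 - x)"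
    using one_minus_pgf[OF y, of Y] one_minus_pgf[OF x, of X] by (simp add: a_def b_def)
  ultimately show ?thesis by (simp add: mult.commute)
qed

lemma smallest_fixed_point:
  fixes f :: "real \<Rightarrow> real"
  assumes cont: "continuous_on {0..1} f" and range: "\<And>x. x \<in> {0..1} \<Longrightarrow> f x \<in> {0..1}" and f1: "f 1 = 1"
  obtains \<eta> where "\<eta> \<in> {0..1}" "f \<eta> = \<eta>" "\<And>x. x \<in> {0..1} \<Longrightarrow> f x = x \<Longrightarrow> \<eta> \<le> x"
    and "\<And>x. x \<in> {0..<\<eta>} \<Longrightarrow> x < f x"
proof -
  define S where "S = {x \<in> {0..1}. f x - x = 0}"
  have "closed S" unfolding S_def
    by (intro continuous_closed_preimage_constant continuous_intros cont)
  moreover have "bounded S" by (rule bounded_subset[of "{0..1}"]) (auto simp: S_def)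
  ultimately have "compact S" by (simp add: compact_eq_bounded_closed)
  moreover have "1 \<in> S" using f1 by (simp add: S_def)
  ultimately obtain \<eta> where \<eta>: "\<eta> \<in> S" "\<And>x. x \<in> S \<Longrightarrow> \<eta> \<le> x"
    using compact_attains_inf[of S] by blast
  show ?thesis
  proof (rule that[of \<eta>])
    fix x assume x: "x \<in> {0..<\<eta>}"
    show "x < f x"
    proof (rule ccontr)
      assume "\<not> x < f x"
      moreover have "0 \<le> f 0" using range[of 0] by simp
      moreover have "continuous_on {0..x} (\<lambda>x. f x - x)"
        using x \<eta>(1) by (intro continuous_intros continuous_on_subset[OF cont]) (auto simp: S_def)
      ultimately obtain y where "0 \<le> y" "y \<le> x" "f y - y = 0"
        using IVT2'[of "\<lambda>x. f x - x" x 0 0] x by auto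
      hence "y \<in> S" using x \<eta>(1) by (auto simp: S_def)
      thus False using \<eta>(2)[of y] x \<open>y \<le> x\<close> by auto
    qed
  qed (use \<eta> in \<open>auto simp: S_def\<close>)
qed

text \<open>
  \<open>f\<close> is convex. Since \<open>f(y) < y\<close> at some \<open>y\<close> between \<open>x\<close> and \<open>1\<close>, the chord from the fixed point \<open>\<eta>\<close>
  to \<open>y\<close> lies below the diagonal at \<open>x\<close>.
\<close>

lemma supercritical_below:
  assumes "ext_mean X * ext_mean Y > 1" and \<eta>: "\<eta> \<in> {0..1}" "pgf Y (pgf X \<eta>) = \<eta>" and x: "\<eta> < x" "x < 1"
  shows "pgf Y (pgf X x) < x"
proof -
  obtain x0 where x0: "x0 < 1" "\<And>y. y \<in> {x0<..<1} \<Longrightarrow> pgf Y (pgf X y) < y"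
    using supercritical_near_1[OF assms(1)] by blast
  obtain y where y: "max x x0 < y" "y < 1" using dense[of "max x x0" 1] x x0(1) by auto
  define t where "t = (x - \<eta>) / (y - \<eta>)"
  have t: "t \<in> {0..1}" "t > 0" using x y by (auto simp: t_def field_simps)
  have xt: "x = (1 - t) * \<eta> + t * y"
  proof -
    have "t * (y - \<eta>) = x - \<eta>" using x y by (simp add: t_def)
    thus ?thesis by (simp add: algebra_simps)
  qed
  have y01: "y \<in> {0..1}" and x01: "x \<in> {0..1}" using x y \<eta> by auto
  have "pgf X x \<le> (1 - t) * pgf X \<eta> + t * pgf X y" unfolding xt by (rule pgf_convex[OF \<eta>(1) y01 t(1)])
  moreover have c01: "(1 - t) * pgf X \<eta> + t * pgf X y \<in> {0..1}"
    using pgf_range[OF \<eta>(1), of X] pgf_range[OF y01, of X] t by (auto intro!: convex_bound_le)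
  ultimately have "pgf Y (pgf X x) \<le> pgf Y ((1 - t) * pgf X \<eta> + t * pgf X y)"
    using pgf_range[OF x01] by (intro pgf_mono) auto
  also have "\<dots> \<le> (1 - t) * pgf Y (pgf X \<eta>) + t * pgf Y (pgf X y)"
    by (rule pgf_convex[OF pgf_range[OF \<eta>(1)] pgf_range[OF y01] t(1)])
  also have "\<dots> < (1 - t) * \<eta> + t * y"
    using x0(2)[of y] y \<eta> t by simp
  finally show ?thesis using xt by simp
qed

lemma pmf_tilde:
  assumes "integrable (measure_pmf D) real" "0 \<notin> set_pmf D"
  shows "mean D > 0" and "pmf (tilde D) k = real (k + 1) * pmf D (k + 1) / mean D"
proof -
  have "mean D \<ge> measure_pmf.expectation D (\<lambda>_. 1)"
    unfolding mean_def using assms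
    by (intro integral_mono_AE) (auto simp: AE_measure_pmf_iff Suc_le_eq intro: gr0I)
  thus pos: "mean D > 0" by simp
  have sb0: "pmf (size_biased D) 0 = 0" by (simp add: pmf_size_biased[OF assms(1) pos])
  have "pmf (tilde D) k = measure_pmf.prob (size_biased D) ((\<lambda>k. k - 1) -` {k})"
    by (simp add: tilde_def pmf_map)
  also have "\<dots> = measure_pmf.prob (size_biased D) {k + 1}"
  proof (rule measure_pmf.finite_measure_eq_AE)
    have "0 \<notin> set_pmf (size_biased D)" using sb0 by (simp add: set_pmf_iff)
    thus "AE x in size_biased D. x \<in> (\<lambda>k. k - 1) -` {k} \<longleftrightarrow> x \<in> {k + 1}"
      unfolding AE_measure_pmf_iff by (metis One_nat_def Suc_eq_plus1 Suc_pred diff_Suc_1 gr0I singleton_iff vimage_eq)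
  qed auto
  finally show "pmf (tilde D) k = real (k + 1) * pmf D (k + 1) / mean D"
    by (simp add: measure_pmf_single pmf_size_biased[OF assms(1) pos])
qed

lemma tilde_eq_1_imp:
  assumes "integrable (measure_pmf D) real" "0 \<notin> set_pmf D" "pmf (tilde D) 1 = 1"
  shows "pmf D 2 = 1"
proof -
  have "set_pmf D \<subseteq> {2}"
  proof
    fix k assume k: "k \<in> set_pmf D"
    hence "k \<noteq> 0" using assms by metis
    then obtain j where j: "k = j + 1" by (metis Suc_eq_plus1 not0_implies_Suc)
    have "pmf D k > 0" using k by (simp add: pmf_positive)
    hence "pmf (tilde D) j > 0" using pmf_tilde[OF assms(1,2)] j by simp
    moreover have "pmf (tilde D) 1 + pmf (tilde D) j \<le> 1" if "j \<noteq> 1"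
      using that measure_pmf.prob_le_1[of "tilde D" "{1, j}"] by (simp add: measure_measure_pmf_finite)
    ultimately have "j = 1" using assms(3) by fastforce
    thus "k \<in> {2}" using j by simp
  qed
  hence "D = return_pmf 2" by (metis set_pmf_subset_singleton)
  thus ?thesis by simp
qed

section \<open>Fluid limits of degree sequences\<close>

lemma pmf_expectation_sums:
  fixes f :: "nat \<Rightarrow> real"
  assumes "integrable (measure_pmf X) f"
  shows "(\<lambda>k. pmf X k * f k) sums measure_pmf.expectation X f"
proof -
  have "integrable (count_space UNIV) (\<lambda>k. pmf X k * f k)"
    using assms unfolding measure_pmf_eq_density by (subst (asm) integrable_real_density) auto
  moreover have "measure_pmf.expectation X f = (\<integral>k. pmf X k * f k \<partial>count_space UNIV)"
    unfolding measure_pmf_eq_density by (subst integral_real_density) auto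
  ultimately show ?thesis using sums_integral_count_space_nat by metis
qed

lemma pgf_partial_sum:
  assumes "z \<in> {0..1}"
  shows "(\<Sum>k<B. pmf X k * z^k) \<le> pgf X z"
    and "pgf X z \<le> (\<Sum>k<B. pmf X k * z^k) + (1 - (\<Sum>k<B. pmf X k))"
proof -
  have s: "(\<lambda>k. pmf X k * z^k) sums pgf X z"
    unfolding pgf_def by (rule pmf_expectation_sums[OF integrable_pgf[OF assms]])
  show "(\<Sum>k<B. pmf X k * z^k) \<le> pgf X z"
    using sum_le_suminf[of "\<lambda>k. pmf X k * z^k" "{..<B}"] s assms by (simp add: sums_iff)
  have "(\<lambda>k. pmf X k * 1) sums 1"
    using pmf_expectation_sums[of X "\<lambda>_. 1"] by simp
  from sums_diff[OF this s] have t: "(\<lambda>k. pmf X k * (1 - z^k)) sums (1 - pgf X z)"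
    by (simp add: algebra_simps)
  have "(\<Sum>k<B. pmf X k * (1 - z^k)) \<le> 1 - pgf X z"
    using sum_le_suminf[of "\<lambda>k. pmf X k * (1 - z^k)" "{..<B}"] t assms
    by (simp add: sums_iff power_le_one)
  thus "pgf X z \<le> (\<Sum>k<B. pmf X k * z^k) + (1 - (\<Sum>k<B. pmf X k))"
    by (simp add: algebra_simps sum_subtractf)
qed

lemma sum_pmf_lim: "(\<lambda>B. \<Sum>k<B. pmf X k) \<longlonglongrightarrow> (1 :: real)"
  using pmf_expectation_sums[of X "\<lambda>_. 1 :: real"] by (simp add: sums_def)

text \<open>
  Sums over vertices are split into the finitely many degrees up to \<open>B\<close>, whose counts are controlled
  one by one, and a tail that is controlled by the convergence of the means alone.
\<close>

lemma sum_by_degree: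
  fixes g :: "nat \<Rightarrow> real" and dg :: "'v \<Rightarrow> nat"
  assumes "finite A" "\<And>v. v \<in> A \<Longrightarrow> 1 \<le> dg v"
  shows "(\<Sum>v\<in>A. g (dg v)) = (\<Sum>k = 1..B. g k * card {v \<in> A. dg v = k}) + (\<Sum>v\<in>{v \<in> A. dg v > B}. g (dg v))"
proof -
  define A' where "A' = {v \<in> A. dg v \<le> B}"
  have "(\<Sum>v\<in>A'. g (dg v)) = (\<Sum>k = 1..B. \<Sum>v\<in>{v \<in> A'. dg v = k}. g (dg v))"
    using assms by (intro sum.group[symmetric]) (auto simp: A'_def)
  also have "\<dots> = (\<Sum>k = 1..B. g k * card {v \<in> A. dg v = k})"
  proof (rule sum.cong[OF refl])
    fix k assume "k \<in> {1..B}"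
    hence "{v \<in> A'. dg v = k} = {v \<in> A. dg v = k}" by (auto simp: A'_def)
    moreover have "(\<Sum>v\<in>{v \<in> A. dg v = k}. g (dg v)) = (\<Sum>v\<in>{v \<in> A. dg v = k}. g k)"
      by (rule sum.cong) auto
    ultimately show "(\<Sum>v\<in>{v \<in> A'. dg v = k}. g (dg v)) = g k * card {v \<in> A. dg v = k}" by simp
  qed
  finally have 1: "(\<Sum>v\<in>A'. g (dg v)) = (\<Sum>k = 1..B. g k * card {v \<in> A. dg v = k})" .
  have "A = A' \<union> {v \<in> A. dg v > B}" "A' \<inter> {v \<in> A. dg v > B} = {}" by (auto simp: A'_def)
  hence "(\<Sum>v\<in>A. g (dg v)) = (\<Sum>v\<in>A'. g (dg v)) + (\<Sum>v\<in>{v \<in> A. dg v > B}. g (dg v))"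
    using assms by (metis finite_Un sum.union_disjoint)
  thus ?thesis using 1 by simp
qed

lemma signed_error:
  fixes \<sigma> x y s w e :: real
  assumes "\<sigma> \<in> {1, -1}" "\<sigma> * (x - y) \<le> w" "\<bar>y - u\<bar> \<le> 3 * w" "0 \<le> s" "s \<le> 2 * w" "0 \<le> w" "8 * w \<le> e"
  shows "\<sigma> * ((x + s) - u) \<le> e"
proof (cases "\<sigma> = 1")
  case True thus ?thesis using assms by auto
next
  case False
  hence "\<sigma> = -1" using assms(1) by simp
  thus ?thesis using assms by auto
qed

definition degree_count :: "nat \<Rightarrow> (nat \<Rightarrow> nat) \<Rightarrow> nat set \<Rightarrow> nat \<Rightarrow> nat" where
  "degree_count K dg T k = card {v \<in> {1..K}. dg v = k \<and> v \<notin> T}"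

text \<open>
  If the untouched vertices of each degree \<open>k \<le> B\<close> number about \<open>z^k\<close> times their total, up to an
  error in the direction \<open>\<sigma>\<close>, then the half-edges and the vertices outside the touched set \<open>T\<close> number
  about \<open>h z G(z)\<close> and \<open>K G_D(z)\<close>, up to an error in the same direction.
\<close>

definition fluid_bounds ::
  "nat \<Rightarrow> (nat \<Rightarrow> nat) \<Rightarrow> nat \<Rightarrow> nat pmf \<Rightarrow> nat \<Rightarrow> real \<Rightarrow> real \<Rightarrow> bool" where
  "fluid_bounds K dg h D B \<theta> \<epsilon> \<longleftrightarrow> (\<forall>T. \<forall>\<sigma>\<in>{1, -1}. \<forall>z\<in>{0..1::real}.
     (\<forall>k\<in>{1..B}. \<sigma> * (degree_count K dg T k - degree_count K dg {} k * z^k) \<le> \<theta> * h) \<longrightarrow>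
       \<sigma> * (real (\<Sum>v\<in>{1..K} - T. dg v) - h * (z * pgf (tilde D) z)) \<le> h * \<epsilon> \<and>
       \<sigma> * (real (card ({1..K} - T)) - K * pgf D z) \<le> K * \<epsilon>)"

lemma fluid_bounds_mono:
  assumes "fluid_bounds K dg h D B \<theta> \<epsilon>" "B \<le> B'" "\<theta>' \<le> \<theta>"
  shows "fluid_bounds K dg h D B' \<theta>' \<epsilon>"
proof -
  have \<theta>: "\<theta>' * h \<le> \<theta> * h" using assms(3) by (intro mult_right_mono) auto
  have sub: "{1..B} \<subseteq> {1..B'}" using assms(2) by auto
  show ?thesis
    unfolding fluid_bounds_def
  proof (intro allI ballI impI)
    fix T and \<sigma> z :: real
    assume *: "\<sigma> \<in> {1, -1}" "z \<in> {0..1}"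
      and "\<forall>k\<in>{1..B'}. \<sigma> * (degree_count K dg T k - degree_count K dg {} k * z^k) \<le> \<theta>' * h"
    hence "\<forall>k\<in>{1..B}. \<sigma> * (degree_count K dg T k - degree_count K dg {} k * z^k) \<le> \<theta> * h"
      using sub \<theta> by (meson order_trans subsetD)
    thus "\<sigma> * (real (\<Sum>v\<in>{1..K} - T. dg v) - h * (z * pgf (tilde D) z)) \<le> h * \<epsilon> \<and>
       \<sigma> * (real (card ({1..K} - T)) - K * pgf D z) \<le> K * \<epsilon>"
      using assms(1) * unfolding fluid_bounds_def by blast
  qed
qed

text \<open>
  Convergence of the degree distribution together with its mean makes the half-edges at vertices of
  degree above \<open>B\<close> a small fraction of all half-edges, uniformly in \<open>n\<close>. Below \<open>B\<close> the counts converge,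
  and \<open>\<Sum>k. k p_k z^k\<close> is the mean of \<open>D\<close> times \<open>z G(z)\<close>.
\<close>

lemma fluid_limit:
  fixes K h :: "nat \<Rightarrow> nat" and dg :: "nat \<Rightarrow> nat \<Rightarrow> nat" and D :: "nat pmf" and \<epsilon> :: real
  assumes K: "\<And>n. K n > 0" and dg: "\<And>n v. v \<in> {1..K n} \<Longrightarrow> 1 \<le> dg n v"
    and D: "integrable (measure_pmf D) real" "0 \<notin> set_pmf D"
    and h: "\<And>n. (\<Sum>v = 1..K n. dg n v) = h n"
    and mean_lim: "(\<lambda>n. real (h n) / real (K n)) \<longlonglongrightarrow> mean D"
    and count_lim: "\<And>k. (\<lambda>n. real (degree_count (K n) (dg n) {} k) / real (K n)) \<longlonglongrightarrow> pmf D k"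
    and \<epsilon>: "\<epsilon> > 0"
  obtains B :: nat and \<theta> :: real where "\<theta> > 0"
    and "eventually (\<lambda>n. fluid_bounds (K n) (dg n) (h n) D B \<theta> \<epsilon>) sequentially"
proof -
  define \<kappa> where "\<kappa> = mean D"
  have \<kappa>: "\<kappa> > 0" using pmf_tilde(1)[OF D] by (simp add: \<kappa>_def)
  define \<delta> where "\<delta> = min 1 (\<epsilon> / 8)"
  have \<delta>: "\<delta> > 0" "\<delta> \<le> 1" "8 * \<delta> \<le> \<epsilon>" using \<epsilon> by (auto simp: \<delta>_def)
  have "eventually (\<lambda>B. (\<Sum>k<B. pmf (tilde D) k) > 1 - \<delta> / (\<kappa> + 1)) sequentially"
    using \<delta> \<kappa> by (intro order_tendstoD(1)[OF sum_pmf_lim]) (simp add: divide_pos_pos)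
  moreover have "eventually (\<lambda>B. (\<Sum>k<Suc B. pmf D k) > 1 - \<delta>) sequentially"
    using \<delta> by (intro order_tendstoD(1)[OF LIMSEQ_Suc[OF sum_pmf_lim]]) simp
  ultimately have "eventually (\<lambda>B. (\<Sum>k<B. pmf (tilde D) k) > 1 - \<delta> / (\<kappa> + 1) \<and> (\<Sum>k<Suc B. pmf D k) > 1 - \<delta>) sequentially"
    by (rule eventually_conj)
  then obtain B where B: "(\<Sum>k<B. pmf (tilde D) k) > 1 - \<delta> / (\<kappa> + 1)" "(\<Sum>k<Suc B. pmf D k) > 1 - \<delta>"
    by (auto simp: eventually_sequentially)
  (* so small that the errors \<theta> h of all degrees up to B add up to at most \<delta> K *)
  define \<theta> where "\<theta> = \<delta> / ((B + 1)\<^sup>2 * (\<kappa> + 1))"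
  have \<theta>: "\<theta> > 0" using \<delta> \<kappa> by (simp add: \<theta>_def)
  have tl: "real k * pmf D k = \<kappa> * pmf (tilde D) (k - 1)" if "1 \<le> k" for k :: nat
    using pmf_tilde(1)[OF D] pmf_tilde(2)[OF D, of "k - 1"] that by (simp add: \<kappa>_def)
  have D0: "pmf D 0 = 0" using D by (simp add: set_pmf_iff)
  have shift: "(\<Sum>k = 1..B. f k) = (\<Sum>k<B. f (Suc k))" for f :: "nat \<Rightarrow> real"
    by (simp add: sum.atLeast1_atMost_eq)
  have Sz: "(\<Sum>k = 1..B. k * pmf D k * z^k) = \<kappa> * z * (\<Sum>k<B. pmf (tilde D) k * z^k)" for z
    unfolding shift sum_distrib_left using tl by (intro sum.cong) (auto simp del: of_nat_Suc)
  have Pz: "(\<Sum>k = 1..B. pmf D k * z^k) = (\<Sum>k<Suc B. pmf D k * z^k)" for z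
    unfolding shift sum.lessThan_Suc_shift by (simp add: D0)
  define c where "c n k = real (degree_count (K n) (dg n) {} k) / real (K n)" for n k
  define Hn where "Hn n = real (h n) / real (K n)" for n
  have clim: "(\<lambda>n. \<Sum>k = 1..B. k * \<bar>c n k - pmf D k\<bar>) \<longlonglongrightarrow> (\<Sum>k = 1..B. k * \<bar>pmf D k - pmf D k\<bar>)"
    unfolding c_def by (intro tendsto_intros count_lim)
  have tlim: "(\<lambda>n. Hn n - (\<Sum>k = 1..B. k * c n k)) \<longlonglongrightarrow> \<kappa> - (\<Sum>k = 1..B. k * pmf D k)"
    unfolding c_def Hn_def \<kappa>_def by (intro tendsto_intros count_lim mean_lim)
  have ttail: "\<kappa> - (\<Sum>k = 1..B. k * pmf D k) < 2 * \<delta>"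
  proof -
    have "(\<Sum>k = 1..B. k * pmf D k) = \<kappa> * (\<Sum>k<B. pmf (tilde D) k)" using Sz[of 1] by simp
    hence "\<kappa> - (\<Sum>k = 1..B. k * pmf D k) = \<kappa> * (1 - (\<Sum>k<B. pmf (tilde D) k))" by (simp add: algebra_simps)
    also have "\<dots> \<le> \<kappa> * (\<delta> / (\<kappa> + 1))" using B(1) \<kappa> by (intro mult_left_mono) auto
    also have "\<dots> \<le> \<delta>" using \<kappa> \<delta> by (simp add: field_simps)
    finally show ?thesis using \<delta> by linarith
  qed
  have ev1: "eventually (\<lambda>n. (\<Sum>k = 1..B. k * \<bar>c n k - pmf D k\<bar>) < \<delta>) sequentially"
    using \<delta> by (intro order_tendstoD(2)[OF clim]) simp
  have ev2: "eventually (\<lambda>n. Hn n - (\<Sum>k = 1..B. k * c n k) < 2 * \<delta>) sequentially"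
    by (rule order_tendstoD(2)[OF tlim ttail])
  have ev3: "eventually (\<lambda>n. \<bar>Hn n - \<kappa>\<bar> < \<delta>) sequentially"
    using tendstoD[OF mean_lim \<delta>(1)] by (simp add: Hn_def \<kappa>_def dist_real_def)
  show thesis
  proof (rule that[of \<theta> B], fact \<theta>)
    from ev1 ev2 ev3 show "eventually (\<lambda>n. fluid_bounds (K n) (dg n) (h n) D B \<theta> \<epsilon>) sequentially"
    proof eventually_elim
      case (elim n)
      have Kn: "real (K n) > 0" using K by simp
      have hK: "h n = Hn n * K n" using Kn by (simp add: Hn_def)
      have H1: "1 \<le> Hn n"
      proof -
        have "(\<Sum>v = 1..K n. 1) \<le> (\<Sum>v = 1..K n. dg n v)" using dg by (intro sum_mono) auto
        thus ?thesis using h[of n] Kn by (simp add: Hn_def)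
      qed
      have H2: "Hn n \<le> \<kappa> + 1" using elim(3) \<delta> by linarith
      have \<theta>H: "\<theta> * Hn n * (\<Sum>k = 1..B. real k) \<le> \<delta>" "\<theta> * Hn n * B \<le> \<delta>"
      proof -
        have "\<theta> * Hn n * (B + 1)\<^sup>2 \<le> \<theta> * (\<kappa> + 1) * (B + 1)\<^sup>2"
          using \<theta> H2 by (intro mult_right_mono mult_left_mono) auto
        also have "\<dots> = \<delta>" using \<kappa> by (simp add: \<theta>_def)
        finally have b: "\<theta> * Hn n * (B + 1)\<^sup>2 \<le> \<delta>" .
        have "(\<Sum>k = 1..B. real k) \<le> (\<Sum>k = 1..B. real B)" by (intro sum_mono) auto
        also have "\<dots> \<le> (B + 1)\<^sup>2" by (simp add: power2_eq_square algebra_simps)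
        finally show "\<theta> * Hn n * (\<Sum>k = 1..B. real k) \<le> \<delta>"
          using b mult_nonneg_nonneg[OF less_imp_le[OF \<theta>] order_trans[OF zero_le_one H1]] mult_left_mono[of "\<Sum>k = 1..B. real k" "real ((B + 1)\<^sup>2)" "\<theta> * Hn n"] by simp
        have "real B \<le> (B + 1)\<^sup>2" by (simp add: power2_eq_square algebra_simps)
        thus "\<theta> * Hn n * B \<le> \<delta>"
          using b mult_nonneg_nonneg[OF less_imp_le[OF \<theta>] order_trans[OF zero_le_one H1]] mult_left_mono[of "real B" "real ((B + 1)\<^sup>2)" "\<theta> * Hn n"] by simp
      qed
      have tail_all: "(\<Sum>v\<in>{v \<in> {1..K n}. dg n v > B}. real (dg n v)) \<le> 2 * \<delta> * K n"
      proof -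
        have "real (h n) = (\<Sum>v\<in>{1..K n}. real (dg n v))" using h[of n] by (metis of_nat_sum)
        also have "\<dots> = (\<Sum>k = 1..B. k * degree_count (K n) (dg n) {} k)
            + (\<Sum>v\<in>{v \<in> {1..K n}. dg n v > B}. real (dg n v))"
          using sum_by_degree[of "{1..K n}" "dg n" real B] dg by (simp add: degree_count_def)
        also have "(\<Sum>k = 1..B. k * degree_count (K n) (dg n) {} k) = K n * (\<Sum>k = 1..B. k * c n k)"
          using Kn by (simp add: c_def sum_distrib_left)
        finally have "(\<Sum>v\<in>{v \<in> {1..K n}. dg n v > B}. real (dg n v)) = K n * (Hn n - (\<Sum>k = 1..B. k * c n k))"
          by (simp add: hK algebra_simps)
        also have "\<dots> \<le> K n * (2 * \<delta>)" using elim(2) Kn by (intro mult_left_mono) auto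
        finally show ?thesis by (simp add: algebra_simps)
      qed
      show ?case
        unfolding fluid_bounds_def
      proof (intro allI ballI impI)
        fix T :: "nat set" and \<sigma> z :: real
        assume \<sigma>: "\<sigma> \<in> {1, -1}" and z: "z \<in> {0..1}"
          and dev: "\<forall>k\<in>{1..B}. \<sigma> * (degree_count (K n) (dg n) T k - degree_count (K n) (dg n) {} k * z^k) \<le> \<theta> * h n"
        define t where "t k = real (degree_count (K n) (dg n) T k)" for k
        define S where "S = (\<Sum>v\<in>{v \<in> {1..K n} - T. dg n v > B}. real (dg n v))"
        define C where "C = real (card {v \<in> {1..K n} - T. dg n v > B})"
        have set_eq: "{v \<in> {1..K n} - T. dg n v = k} = {v \<in> {1..K n}. dg n v = k \<and> v \<notin> T}" for k by blast
        have dec1: "real (\<Sum>v\<in>{1..K n} - T. dg n v) = (\<Sum>k = 1..B. k * t k) + S"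
          using sum_by_degree[of "{1..K n} - T" "dg n" real B] dg
          unfolding t_def S_def degree_count_def set_eq by simp
        have dec2: "real (card ({1..K n} - T)) = (\<Sum>k = 1..B. t k) + C"
          using sum_by_degree[of "{1..K n} - T" "dg n" "\<lambda>_. 1" B] dg
          unfolding t_def C_def degree_count_def set_eq by simp
        have C0: "0 \<le> C" by (simp add: C_def)
        have CS: "C \<le> S" unfolding C_def S_def real_of_card
          using dg by (intro sum_mono) auto
        have S2: "S \<le> 2 * \<delta> * K n" unfolding S_def
          by (rule order_trans[OF sum_mono2 tail_all]) auto
        have zk: "0 \<le> z^k" "z^k \<le> 1" for k using z by (auto simp: power_le_one)
        have cp: "\<bar>(\<Sum>k = 1..B. k * (c n k * z^k)) - (\<Sum>k = 1..B. k * pmf D k * z^k)\<bar> \<le> \<delta>"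
        proof -
          have "\<bar>(\<Sum>k = 1..B. k * (c n k * z^k)) - (\<Sum>k = 1..B. k * pmf D k * z^k)\<bar>
              = \<bar>\<Sum>k = 1..B. (k * (c n k - pmf D k)) * z^k\<bar>"
            by (simp add: sum_subtractf[symmetric] algebra_simps)
          also have "\<dots> \<le> (\<Sum>k = 1..B. \<bar>(k * (c n k - pmf D k)) * z^k\<bar>)" by (rule sum_abs)
          also have "\<dots> \<le> (\<Sum>k = 1..B. k * \<bar>c n k - pmf D k\<bar>)"
            using zk by (intro sum_mono) (auto simp: abs_mult intro: mult_left_le)
          finally show ?thesis using elim(1) by linarith
        qed
        have cp2: "\<bar>(\<Sum>k = 1..B. c n k * z^k) - (\<Sum>k = 1..B. pmf D k * z^k)\<bar> \<le> \<delta>"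
        proof -
          have "\<bar>(\<Sum>k = 1..B. c n k * z^k) - (\<Sum>k = 1..B. pmf D k * z^k)\<bar>
              = \<bar>\<Sum>k = 1..B. (c n k - pmf D k) * z^k\<bar>"
            by (simp add: sum_subtractf[symmetric] algebra_simps)
          also have "\<dots> \<le> (\<Sum>k = 1..B. \<bar>(c n k - pmf D k) * z^k\<bar>)" by (rule sum_abs)
          also have "\<dots> \<le> (\<Sum>k = 1..B. k * \<bar>c n k - pmf D k\<bar>)"
          proof (rule sum_mono)
            fix k assume "k \<in> {1..B}"
            hence "\<bar>c n k - pmf D k\<bar> * z^k \<le> \<bar>c n k - pmf D k\<bar> * k"
              using zk[of k] by (intro mult_left_mono) auto
            thus "\<bar>(c n k - pmf D k) * z^k\<bar> \<le> k * \<bar>c n k - pmf D k\<bar>"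
              using zk[of k] by (simp add: abs_mult mult.commute)
          qed
          finally show ?thesis using elim(1) by linarith
        qed
        define G where "G = z * pgf (tilde D) z"
        have G: "0 \<le> G" "G \<le> 1"
          using z pgf_range[OF z, of "tilde D"] by (auto simp: G_def intro: mult_le_one)
        have HG: "\<bar>\<kappa> * G - Hn n * G\<bar> \<le> \<delta>"
        proof -
          have "\<bar>\<kappa> * G - Hn n * G\<bar> = \<bar>\<kappa> - Hn n\<bar> * G" using G by (simp add: abs_mult flip: left_diff_distrib)
          also have "\<dots> \<le> \<bar>\<kappa> - Hn n\<bar> * 1" using G by (intro mult_left_mono) auto
          finally show ?thesis using elim(3) by (simp add: abs_minus_commute)
        qed
        have gs: "(\<Sum>k = 1..B. k * pmf D k * z^k) \<le> \<kappa> * G" "\<kappa> * G \<le> (\<Sum>k = 1..B. k * pmf D k * z^k) + \<delta>"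
        proof -
          note pp = pgf_partial_sum[OF z, of "tilde D" B]
          show "(\<Sum>k = 1..B. k * pmf D k * z^k) \<le> \<kappa> * G"
            unfolding Sz G_def using pp(1) \<kappa> z by (simp add: mult.assoc mult_left_mono)
          have "\<kappa> * G \<le> \<kappa> * (z * ((\<Sum>k<B. pmf (tilde D) k * z^k) + (1 - (\<Sum>k<B. pmf (tilde D) k))))"
            unfolding G_def using pp(2) \<kappa> z by (intro mult_left_mono) auto
          also have "\<dots> = (\<Sum>k = 1..B. k * pmf D k * z^k) + \<kappa> * z * (1 - (\<Sum>k<B. pmf (tilde D) k))"
            unfolding Sz by (simp add: algebra_simps)
          also have "\<kappa> * z * (1 - (\<Sum>k<B. pmf (tilde D) k)) \<le> \<kappa> * 1 * (\<delta> / (\<kappa> + 1))"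
            using B(1) \<kappa> z \<delta> sum_pmf_lim
            by (intro mult_mono) (auto intro!: measure_pmf.prob_le_1 simp flip: measure_measure_pmf_finite)
          also have "\<dots> \<le> \<delta>" using \<kappa> \<delta> by (simp add: field_simps)
          finally show "\<kappa> * G \<le> (\<Sum>k = 1..B. k * pmf D k * z^k) + \<delta>" by simp
        qed
        have gp: "(\<Sum>k = 1..B. pmf D k * z^k) \<le> pgf D z" "pgf D z \<le> (\<Sum>k = 1..B. pmf D k * z^k) + \<delta>"
          using pgf_partial_sum[OF z, of D "Suc B"] B(2) unfolding Pz by linarith+
        have S2': "S \<le> 2 * (K n * \<delta>)" and w0: "0 \<le> K n * \<delta>" using S2 \<delta> by (simp_all add: mult_ac)
        have Heps: "8 * \<delta> \<le> Hn n * \<epsilon>"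
          using \<delta> mult_right_mono[OF H1, of \<epsilon>] \<epsilon> by linarith
        have mul: "h n * x = K n * (Hn n * x)" for x :: real by (simp add: hK)
        have "\<sigma> * ((\<Sum>k = 1..B. k * t k) - K n * (\<Sum>k = 1..B. k * (c n k * z^k)))
            = (\<Sum>k = 1..B. k * (\<sigma> * (t k - degree_count (K n) (dg n) {} k * z^k)))"
          using Kn by (simp add: c_def sum_distrib_left sum_subtractf[symmetric] algebra_simps)
        also have "\<dots> \<le> (\<Sum>k = 1..B. k * (\<theta> * h n))"
          using dev by (intro sum_mono mult_left_mono) (auto simp: t_def)
        also have "\<dots> = K n * (\<theta> * Hn n * (\<Sum>k = 1..B. real k))"
          by (simp add: hK sum_distrib_left algebra_simps)
        also have "\<dots> \<le> K n * \<delta>" using \<theta>H(1) by (intro mult_left_mono) auto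
        finally have 1: "\<sigma> * ((\<Sum>k = 1..B. k * t k) - K n * (\<Sum>k = 1..B. k * (c n k * z^k))) \<le> K n * \<delta>" .
        have "\<bar>(\<Sum>k = 1..B. k * (c n k * z^k)) - Hn n * G\<bar> \<le> 3 * \<delta>" using cp gs HG by linarith
        hence "K n * \<bar>(\<Sum>k = 1..B. k * (c n k * z^k)) - Hn n * G\<bar> \<le> K n * (3 * \<delta>)"
          by (intro mult_left_mono) auto
        hence 2: "\<bar>K n * (\<Sum>k = 1..B. k * (c n k * z^k)) - h n * G\<bar> \<le> K n * (3 * \<delta>)"
          unfolding mul by (simp add: abs_mult flip: right_diff_distrib)
        have "K n * (8 * \<delta>) \<le> K n * (Hn n * \<epsilon>)" using Heps by (intro mult_left_mono) auto
        hence 3: "8 * (K n * \<delta>) \<le> h n * \<epsilon>" unfolding mul by simp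
        have sum_bound: "\<sigma> * (((\<Sum>k = 1..B. k * t k) + S) - h n * G) \<le> h n * \<epsilon>"
          by (rule signed_error[OF \<sigma> 1]) (use 2 3 S2' w0 C0 CS in auto)
        have "\<sigma> * ((\<Sum>k = 1..B. t k) - K n * (\<Sum>k = 1..B. c n k * z^k))
            = (\<Sum>k = 1..B. \<sigma> * (t k - degree_count (K n) (dg n) {} k * z^k))"
          using Kn by (simp add: c_def sum_distrib_left sum_subtractf[symmetric] algebra_simps)
        also have "\<dots> \<le> (\<Sum>k = 1..B. \<theta> * h n)"
          using dev by (intro sum_mono) (auto simp: t_def)
        also have "\<dots> = K n * (\<theta> * Hn n * B)" by (simp add: hK algebra_simps)
        also have "\<dots> \<le> K n * \<delta>" using \<theta>H(2) by (intro mult_left_mono) auto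
        finally have 4: "\<sigma> * ((\<Sum>k = 1..B. t k) - K n * (\<Sum>k = 1..B. c n k * z^k)) \<le> K n * \<delta>" .
        have "\<bar>(\<Sum>k = 1..B. c n k * z^k) - pgf D z\<bar> \<le> 2 * \<delta>" using cp2 gp by linarith
        hence "K n * \<bar>(\<Sum>k = 1..B. c n k * z^k) - pgf D z\<bar> \<le> K n * (2 * \<delta>)"
          by (intro mult_left_mono) auto
        hence 5: "\<bar>K n * (\<Sum>k = 1..B. c n k * z^k) - K n * pgf D z\<bar> \<le> K n * (2 * \<delta>)"
          by (simp add: abs_mult flip: right_diff_distrib)
        have 6: "8 * (K n * \<delta>) \<le> K n * \<epsilon>" using mult_left_mono[OF \<delta>(3), of "real (K n)"] by simp
        have card_bound: "\<sigma> * (((\<Sum>k = 1..B. t k) + C) - K n * pgf D z) \<le> K n * \<epsilon>"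
          by (rule signed_error[OF \<sigma> 4]) (use 5 6 S2' w0 C0 CS in auto)
        show "\<sigma> * (real (\<Sum>v\<in>{1..K n} - T. dg n v) - h n * (z * pgf (tilde D) z)) \<le> h n * \<epsilon> \<and>
            \<sigma> * (real (card ({1..K n} - T)) - K n * pgf D z) \<le> K n * \<epsilon>"
          using sum_bound card_bound unfolding dec1 dec2 G_def by blast
      qed
    qed
  qed
qed

text \<open>For integer-valued variables half-integers are continuity points of the distribution function.\<close>

lemma conv_in_distribution_pmf:
  assumes "conv_in_distribution X Y"
  shows "(\<lambda>n. pmf (X n) k) \<longlonglongrightarrow> pmf Y k"
proof -
  (* real j - 1/2 separates the integers below j from the others *)
  have cdf_half: "cdf (distr (measure_pmf Z) borel real) (real j - 1/2) = measure_pmf.prob Z {..<j}"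
    for Z :: "nat pmf" and j :: nat
  proof -
    have "real -` {..real j - 1/2} = {..<j}" by (auto simp: field_simps)
    thus ?thesis by (simp add: cdf_def measure_distr)
  qed
  have lim: "(\<lambda>n. measure_pmf.prob (X n) {..<j}) \<longlonglongrightarrow> measure_pmf.prob Y {..<j}" for j :: nat
  proof -
    interpret real_distribution "distr (measure_pmf Y) borel real"
      by (intro prob_space.real_distribution_distr measure_pmf.prob_space_axioms) simp
    have "2 * x + 1 \<noteq> 2 * j" for x :: nat by presburger
    hence "real (2 * x + 1) \<noteq> real (2 * j)" for x :: nat by (simp only: of_nat_eq_iff not_False_eq_True)
    hence "real -` {real j - 1/2} = {}" by (auto simp: field_simps)
    hence "measure (distr (measure_pmf Y) borel real) {real j - 1/2} = 0" by (simp add: measure_distr)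
    hence "isCont (cdf (distr (measure_pmf Y) borel real)) (real j - 1/2)" by (simp add: isCont_cdf)
    hence "(\<lambda>n. cdf (distr (measure_pmf (X n)) borel real) (real j - 1/2))
        \<longlonglongrightarrow> cdf (distr (measure_pmf Y) borel real) (real j - 1/2)"
      using assms by (auto simp: conv_in_distribution_def weak_conv_m_def weak_conv_def)
    thus ?thesis by (simp add: cdf_half)
  qed
  have diff: "pmf Z k = measure_pmf.prob Z {..<Suc k} - measure_pmf.prob Z {..<k}" for Z :: "nat pmf"
    by (simp add: measure_measure_pmf_finite lessThan_Suc)
  show ?thesis unfolding diff by (intro tendsto_diff lim)
qed

lemma pmf_empirical_law:
  assumes "K > 0" shows "pmf (empirical_law K x) y = card {v \<in> {1..K}. x v = y} / K"
proof -
  have "{1..K} \<inter> x -` {y} = {v \<in> {1..K}. x v = y}" by auto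
  thus ?thesis using assms
    by (simp add: empirical_law_def pmf_map measure_pmf_of_set)
qed

lemma mean_empirical_law:
  assumes "K > 0" shows "mean (empirical_law K x) = (\<Sum>v = 1..K. x v) / K"
  using assms by (simp add: mean_def empirical_law_def integral_pmf_of_set)

lemma finite_connected_simple_graphs: "finite {H. connected_simple_graph H \<and> order H = k}"
proof (rule finite_subset)
  show "{H. connected_simple_graph H \<and> order H = k} \<subseteq> Graph k ` Pow (Pow {1..k})"
  proof
    fix H assume "H \<in> {H. connected_simple_graph H \<and> order H = k}"
    hence "edges H \<subseteq> Pow {1..k}" "order H = k" by (auto simp: connected_simple_graph_def)
    thus "H \<in> Graph k ` Pow (Pow {1..k})" by (cases H) auto
  qed
qed simp

text \<open>There are only finitely many graphs of a given order, so limits may be summed over them.\<close>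

lemma order_count_lim:
  fixes M :: "nat \<Rightarrow> nat" and Com :: "nat \<Rightarrow> nat \<Rightarrow> graph" and \<mu> :: "graph pmf"
  assumes conn: "\<And>H. H \<in> \<H> \<Longrightarrow> connected_simple_graph H"
    and Com: "\<And>n a. a \<in> {1..M n} \<Longrightarrow> Com n a \<in> \<H>"
    and \<mu>: "set_pmf \<mu> \<subseteq> \<H>"
    and lim: "\<And>H. H \<in> \<H> \<Longrightarrow> (\<lambda>n. real (card {a \<in> {1..M n}. Com n a = H}) / real (M n)) \<longlonglongrightarrow> pmf \<mu> H"
  shows "(\<lambda>n. real (degree_count (M n) (\<lambda>a. order (Com n a)) {} k) / real (M n)) \<longlonglongrightarrow> pmf (map_pmf order \<mu>) k"
proof -
  define S where "S = {H \<in> \<H>. order H = k}"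
  have fin: "finite S" unfolding S_def
    by (rule finite_subset[OF _ finite_connected_simple_graphs[of k]]) (use conn in auto)
  have "degree_count (M n) (\<lambda>a. order (Com n a)) {} k = (\<Sum>H\<in>S. card {a \<in> {1..M n}. Com n a = H})" for n
  proof -
    have "{v \<in> {1..M n}. order (Com n v) = k \<and> v \<notin> {}} = (\<Union>H\<in>S. {a \<in> {1..M n}. Com n a = H})"
      using Com by (auto simp: S_def)
    thus ?thesis unfolding degree_count_def
      using fin by (simp only:) (subst card_UN_disjoint, auto)
  qed
  hence eq: "real (degree_count (M n) (\<lambda>a. order (Com n a)) {} k) / real (M n)
      = (\<Sum>H\<in>S. real (card {a \<in> {1..M n}. Com n a = H}) / real (M n))" for n
    by (simp add: sum_divide_distrib)
  have "pmf (map_pmf order \<mu>) k = measure_pmf.prob \<mu> (order -` {k})" by (rule pmf_map)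
  also have "\<dots> = measure_pmf.prob \<mu> S"
    using \<mu> by (intro measure_pmf.finite_measure_eq_AE) (auto simp: AE_measure_pmf_iff S_def)
  also have "\<dots> = (\<Sum>H\<in>S. pmf \<mu> H)" by (rule measure_measure_pmf_finite[OF fin])
  finally show ?thesis unfolding eq
    using lim by (auto intro!: tendsto_sum simp: S_def)
qed

section \<open>Components of the RIGC and communities\<close>

definition joined :: "nat \<Rightarrow> nat \<Rightarrow> (nat \<Rightarrow> nat) \<Rightarrow> (nat \<Rightarrow> graph) \<Rightarrow> matching \<Rightarrow> nat rel" where
  "joined N M d Com \<omega> = connectivity {1..N} (\<lambda>v w. mult (RIGC N M d Com \<omega>) v w > 0)"

lemma components_joined: "components (RIGC N M d Com \<omega>) = {1..N} // joined N M d Com \<omega>"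
  by (simp add: components_def joined_def RIGC_def)

lemma equiv_connectivity:
  assumes "\<And>v w. adj v w \<Longrightarrow> adj w v"
  shows "equiv V (connectivity V adj)"
proof (rule equivI)
  let ?R = "\<lambda>x y. x \<in> V \<and> y \<in> V \<and> adj x y"
  have "symp ?R" using assms by (auto intro: sympI)
  hence "symp ?R\<^sup>*\<^sup>*" by (rule symp_rtranclp)
  thus "sym (connectivity V adj)" by (auto simp: connectivity_def sym_def dest: sympD)
  show "refl_on V (connectivity V adj)" by (auto simp: connectivity_def refl_on_def)
  show "trans (connectivity V adj)" by (auto simp: connectivity_def trans_def)
qed (auto simp: connectivity_def)

lemma finite_com_edges:
  assumes "\<And>a. a \<in> {1..M} \<Longrightarrow> connected_simple_graph (Com a)"
  shows "finite (com_edges M Com)"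
proof -
  have "finite (edges (Com a))" if "a \<in> {1..M}" for a
    using assms[OF that] finite_subset[of "edges (Com a)" "Pow {1..order (Com a)}"]
    by (auto simp: connected_simple_graph_def)
  thus ?thesis by (auto simp: com_edges_def)
qed

lemma mult_RIGC_pos_iff:
  assumes "\<And>a. a \<in> {1..M} \<Longrightarrow> connected_simple_graph (Com a)"
  shows "mult (RIGC N M d Com \<omega>) v w > 0 \<longleftrightarrow>
    (\<exists>j\<^sub>1 j\<^sub>2. {j\<^sub>1, j\<^sub>2} \<in> com_edges M Com \<and> takes_role d \<omega> v j\<^sub>1 \<and> takes_role d \<omega> w j\<^sub>2)"
proof -
  have "mult (RIGC N M d Com \<omega>) v w > 0 \<longleftrightarrow> (\<exists>e\<in>com_edges M Com. \<exists>j\<^sub>1 j\<^sub>2. e = {j\<^sub>1, j\<^sub>2} \<and>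
         (takes_role d \<omega> v j\<^sub>1 \<and> takes_role d \<omega> w j\<^sub>2 \<or> takes_role d \<omega> v j\<^sub>2 \<and> takes_role d \<omega> w j\<^sub>1))"
    using finite_com_edges[of M Com, OF assms]
    by (simp only: RIGC_def multigraph.sel neq0_conv[symmetric] sum_eq_0_iff of_bool_eq_0_iff) blast
  also have "\<dots> \<longleftrightarrow> (\<exists>j\<^sub>1 j\<^sub>2. {j\<^sub>1, j\<^sub>2} \<in> com_edges M Com \<and> takes_role d \<omega> v j\<^sub>1 \<and> takes_role d \<omega> w j\<^sub>2)"
  proof (intro iffI; elim bexE exE conjE disjE)
    fix e j1 j2 assume "e \<in> com_edges M Com" "e = {j1, j2}" "takes_role d \<omega> v j2" "takes_role d \<omega> w j1"
    thus "\<exists>j\<^sub>1 j\<^sub>2. {j\<^sub>1, j\<^sub>2} \<in> com_edges M Com \<and> takes_role d \<omega> v j\<^sub>1 \<and> takes_role d \<omega> w j\<^sub>2"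
      by (intro exI[of _ j2] exI[of _ j1]) (simp add: insert_commute)
  qed blast+
  finally show ?thesis .
qed

locale community_graph =
  fixes N M :: nat and d :: "nat \<Rightarrow> nat" and Com :: "nat \<Rightarrow> graph"
  assumes connected_Com: "a \<in> {1..M} \<Longrightarrow> connected_simple_graph (Com a)"
begin

lemma mult_pos_iff:
  "mult (RIGC N M d Com \<omega>) v w > 0 \<longleftrightarrow>
    (\<exists>j\<^sub>1 j\<^sub>2. {j\<^sub>1, j\<^sub>2} \<in> com_edges M Com \<and> takes_role d \<omega> v j\<^sub>1 \<and> takes_role d \<omega> w j\<^sub>2)"
  by (rule mult_RIGC_pos_iff) (rule connected_Com)

lemma equiv_joined: "equiv {1..N} (joined N M d Com \<omega>)"
  unfolding joined_def
  by (rule equiv_connectivity) (unfold mult_pos_iff, metis insert_commute)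

text \<open>
  A path between two labels of a community turns into a path of individuals: every label is taken by
  some individual because the matching is onto, and only by one because it is injective.
\<close>

lemma joined_if_same_community:
  assumes \<omega>: "\<omega> \<in> matchings N M d Com" and x: "x \<in> half_edges N d" "y \<in> half_edges N d"
    and same: "fst (\<omega> x) = fst (\<omega> y)"
  shows "(fst x, fst y) \<in> joined N M d Com \<omega>"
proof -
  have bij: "bij_betw \<omega> (half_edges N d) (com_vertices M Com)" using \<omega> by (simp add: matchings_def)
  define a where "a = fst (\<omega> x)"
  have ax: "\<omega> x \<in> com_vertices M Com" "\<omega> y \<in> com_vertices M Com"
    using bij x by (auto simp: bij_betw_def)
  have a: "a \<in> {1..M}" using ax by (auto simp: a_def com_vertices_def)
  define V where "V = {1..order (Com a)}"
  have l: "snd (\<omega> x) \<in> V" "snd (\<omega> y) \<in> V"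
    using ax same by (auto simp: a_def V_def com_vertices_def)
  have conn: "(\<lambda>u v. u \<in> V \<and> v \<in> V \<and> {u, v} \<in> edges (Com a))\<^sup>*\<^sup>* (snd (\<omega> x)) (snd (\<omega> y))"
    using connected_Com[OF a] l unfolding connected_simple_graph_def connectivity_def V_def by blast
  have ex: "\<exists>u\<in>half_edges N d. \<omega> u = (a, k)" if "k \<in> V" for k
  proof -
    have "(a, k) \<in> com_vertices M Com" using a that by (simp add: com_vertices_def V_def)
    hence "(a, k) \<in> \<omega> ` half_edges N d" using bij by (simp add: bij_betw_def)
    thus ?thesis by (metis imageE)
  qed
  have step: "\<forall>u\<in>half_edges N d. \<omega> u = (a, k) \<longrightarrow> (fst x, fst u) \<in> joined N M d Com \<omega>"
    if "(\<lambda>u v. u \<in> V \<and> v \<in> V \<and> {u, v} \<in> edges (Com a))\<^sup>*\<^sup>* (snd (\<omega> x)) k" for k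
    using that
  proof (induction rule: rtranclp_induct)
    case base
    show ?case
    proof (intro ballI impI)
      fix u assume u: "u \<in> half_edges N d" "\<omega> u = (a, snd (\<omega> x))"
      hence "u = x" using bij x(1) by (auto simp: bij_betw_def inj_on_def a_def)
      moreover have "fst x \<in> {1..N}" using x(1) by (auto simp: half_edges_def)
      ultimately show "(fst x, fst u) \<in> joined N M d Com \<omega>"
        using equivE[OF equiv_joined[of \<omega>]] by (metis refl_onD)
    qed
  next
    case (step k k')
    show ?case
    proof (intro ballI impI)
      fix u' assume u': "u' \<in> half_edges N d" "\<omega> u' = (a, k')"
      obtain u where u: "u \<in> half_edges N d" "\<omega> u = (a, k)" using ex[of k] step(2) by auto
      have r: "takes_role d \<omega> (fst u) (a, k)" "takes_role d \<omega> (fst u') (a, k')"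
        using u u' by (auto simp: takes_role_def half_edges_def)
      have "{(a, k), (a, k')} \<in> com_edges M Com"
        using step(2) a by (auto simp: com_edges_def intro!: bexI[of _ a] image_eqI[of _ _ "{k, k'}"])
      hence "mult (RIGC N M d Com \<omega>) (fst u) (fst u') > 0"
        unfolding mult_pos_iff using r by blast
      moreover have "fst u \<in> {1..N}" "fst u' \<in> {1..N}" using u u' by (auto simp: half_edges_def)
      ultimately have "(fst u, fst u') \<in> joined N M d Com \<omega>"
        by (auto simp: joined_def connectivity_def)
      moreover have "(fst x, fst u) \<in> joined N M d Com \<omega>" using step(3) u by blast
      ultimately show "(fst x, fst u') \<in> joined N M d Com \<omega>"
        using equivE[OF equiv_joined[of \<omega>]] by (metis transD)
    qed
  qed
  have "\<omega> y = (a, snd (\<omega> y))" using same by (simp add: a_def prod_eq_iff)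
  thus ?thesis using step[OF conn] x(2) by blast
qed

lemma joined_closed:
  assumes closed: "\<And>x y. x \<in> half_edges N d \<Longrightarrow> y \<in> half_edges N d \<Longrightarrow> fst (\<omega> x) = fst (\<omega> y) \<Longrightarrow>
      fst x \<in> S \<Longrightarrow> fst y \<in> S"
    and v: "v \<in> S"
  shows "joined N M d Com \<omega> `` {v} \<subseteq> S"
proof -
  have "w \<in> S" if "(\<lambda>v w. v \<in> {1..N} \<and> w \<in> {1..N} \<and> mult (RIGC N M d Com \<omega>) v w > 0)\<^sup>*\<^sup>* v w" for w
    using that
  proof (induction rule: rtranclp_induct)
    case (step u w)
    then obtain j1 j2 where j: "{j1, j2} \<in> com_edges M Com" "takes_role d \<omega> u j1" "takes_role d \<omega> w j2"
      unfolding mult_pos_iff by blast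
    obtain i1 i2 where i: "i1 \<in> {1..d u}" "i2 \<in> {1..d w}" "\<omega> (u, i1) = j1" "\<omega> (w, i2) = j2"
      using j by (auto simp: takes_role_def)
    obtain a e where a: "{j1, j2} = Pair a ` e" using j(1) by (auto simp: com_edges_def)
    hence "fst j1 = a" "fst j2 = a" by auto (metis fst_conv imageE insertI1, metis fst_conv imageE insert_iff)
    thus "w \<in> S" using closed[of "(u, i1)" "(w, i2)"] i step by (auto simp: half_edges_def)
  qed (rule v)
  thus ?thesis by (auto simp: joined_def connectivity_def)
qed

end

section \<open>Exploring components\<close>

context degree_exploration
begin

definition active :: "bool \<Rightarrow> history \<Rightarrow> half_edge set" where
  "active c s = {p \<in> alive c s. fst p \<in> touched c s}"

definition asleep :: "bool \<Rightarrow> history \<Rightarrow> nat" where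
  "asleep c s = (\<Sum>v\<in>{1..K c} - touched c s. dg c v)"

text \<open>
  Groups are completed first, then individuals, and a new individual is woken only when nothing is
  active. So the group clock moves only while no half-edge of a touched group is unmatched.
\<close>

definition pick :: "history \<Rightarrow> bool \<times> half_edge" where
  "pick s = (if active False s \<noteq> {} then (True, SOME q. q \<in> active False s)
     else if active True s \<noteq> {} then (False, SOME q. q \<in> active True s)
     else (False, SOME q. q \<in> alive True s))"

lemma card_active:
  assumes "valid s" shows "card (active c s) + asleep c s = h - length s"
proof -
  define Z where "Z = {p \<in> alive c s. fst p \<notin> touched c s}"
  have "p \<notin> side c ` set s" if "fst p \<notin> touched c s" for p
    using that by (auto simp: touched_def)
  hence "Z = {p \<in> H c. fst p \<notin> touched c s}" unfolding Z_def alive_def by blast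
  also have "\<dots> = (SIGMA v:{1..K c} - touched c s. {1..dg c v})" by (auto simp: H_def)
  finally have "Z = (SIGMA v:{1..K c} - touched c s. {1..dg c v})" .
  hence "card Z = asleep c s" by (simp add: asleep_def)
  moreover have "alive c s = active c s \<union> Z" "active c s \<inter> Z = {}" by (auto simp: active_def Z_def)
  hence "card (alive c s) = card (active c s) + card Z"
    by (metis card_Un_disjoint finite_Un finite_alive)
  ultimately show ?thesis using card_alive[OF assms, of c] by simp
qed

lemma asleep_le:
  assumes "valid s" shows "asleep c s \<le> h * (clock True s * clock False s)"
    and "active c s = {} \<Longrightarrow> asleep c s = h * (clock True s * clock False s)"
proof -
  have "real (card (active c s) + asleep c s) = h * (clock True s * clock False s)"
    unfolding card_active[OF assms] using clock_product[OF length_valid[OF assms]] by (simp add: mult.assoc)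
  thus "asleep c s \<le> h * (clock True s * clock False s)"
    "active c s = {} \<Longrightarrow> asleep c s = h * (clock True s * clock False s)" by auto
qed

lemma pick_cases:
  assumes "valid s" "length s < h"
  obtains (group) q where "pick s = (True, q)" "q \<in> active False s"
  | (individual) q where "pick s = (False, q)" "q \<in> active True s" "active False s = {}"
  | (wake) q where "pick s = (False, q)" "q \<in> alive True s" "fst q \<notin> touched True s"
      "active True s = {}" "active False s = {}"
proof -
  have "card (alive True s) > 0" using card_alive[OF assms(1), of True] assms(2) by simp
  hence ne: "alive True s \<noteq> {}" by auto
  consider "active False s \<noteq> {}" | "active False s = {}" "active True s \<noteq> {}"
    | "active False s = {}" "active True s = {}" by blast
  thus thesis
  proof cases
    case 1
    thus ?thesis by (intro group[of "SOME q. q \<in> active False s"]) (auto simp: pick_def some_in_eq)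
  next
    case 2
    thus ?thesis by (intro individual[of "SOME q. q \<in> active True s"]) (auto simp: pick_def some_in_eq)
  next
    case 3
    have al: "(SOME q. q \<in> alive True s) \<in> alive True s" using ne by (simp add: some_in_eq)
    moreover have "fst (SOME q. q \<in> alive True s) \<notin> touched True s"
      using 3(2) al unfolding active_def by blast
    moreover have "pick s = (False, SOME q. q \<in> alive True s)" using 3 by (simp add: pick_def)
    ultimately show ?thesis using 3 by (intro wake)
  qed
qed

lemma pick_alive:
  assumes "valid s" "length s < h"
  shows "snd (pick s) \<in> alive (\<not> fst (pick s)) s"
  using assms by (cases rule: pick_cases) (auto simp: active_def)

lemma pick_touched:
  assumes "valid s" "length s < h" "active True s \<noteq> {} \<or> active False s \<noteq> {}"
  shows "fst (snd (pick s)) \<in> touched (\<not> fst (pick s)) s"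
  using assms(1,2) by (cases rule: pick_cases) (use assms(3) in \<open>auto simp: active_def\<close>)

text \<open>
  If nothing is active, all half-edges of touched vertices are matched among themselves, so the touched
  individuals form a union of components.
\<close>

lemma closed_when_inactive:
  assumes v: "valid s" and \<omega>: "\<omega> \<in> consistent s" and ina: "active True s = {}" "active False s = {}"
    and x: "x \<in> H True" "y \<in> H True" "fst (\<omega> x) = fst (\<omega> y)" and t: "fst x \<in> touched True s"
  shows "fst y \<in> touched True s"
proof -
  have bij: "bij_betw \<omega> (H True) (H False)" using \<omega> by (simp add: consistent_def bijs_def)
  have "x \<in> side True ` set s" using ina(1) x(1) t unfolding active_def alive_def by blast
  then obtain e where e: "e \<in> set s" "x = side True e" by auto
  hence "\<omega> x = side False e" using \<omega> by (simp add: consistent_def)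
  hence "fst (\<omega> x) \<in> touched False s" using e by (auto simp: touched_def)
  moreover have "\<omega> y \<in> H False" using bij x(2) by (auto simp: bij_betw_def)
  ultimately have "\<omega> y \<notin> side False ` set s \<Longrightarrow> \<omega> y \<in> active False s"
    using x(3) by (simp add: active_def alive_def)
  hence "\<omega> y \<in> side False ` set s" using ina(2) by blast
  then obtain e' where e': "e' \<in> set s" "\<omega> y = side False e'" by auto
  have "\<omega> (side True e') = \<omega> y" using \<omega> e' by (simp add: consistent_def)
  moreover have "side True e' \<in> H True" using v e' by (auto simp: valid_def)
  ultimately have "y = side True e'" using bij x(2) by (auto simp: bij_betw_def inj_on_def)
  thus ?thesis using e' by (auto simp: touched_def)
qed

text \<open>The individuals touched before the component under exploration was entered.\<close>

fun before_wake :: "history \<Rightarrow> nat set" where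
  "before_wake [] = W"
| "before_wake (e # s) = (if \<not> fst e \<and> fst (side True e) \<notin> touched True s then touched True s else before_wake s)"

lemma before_wake_subset: "before_wake s \<subseteq> touched True s"
  by (induction s) (auto simp: touched_def)

text \<open>
  The invariant behind the exploration by components, for a relation \<open>R\<close> that holds between members of
  a common group: the individuals touched since the last waking are all related to one of them, and
  every active half-edge is attached to these individuals or to a group of one of them.
\<close>

definition single_component :: "nat rel \<Rightarrow> matching \<Rightarrow> history \<Rightarrow> bool" where
  "single_component R \<omega> s \<longleftrightarrow>
     (\<exists>v0. \<forall>v \<in> touched True s - before_wake s. (v0, v) \<in> R) \<and>
     (\<forall>x \<in> active True s. fst x \<notin> before_wake s) \<and>
     (\<forall>r \<in> active False s. \<exists>x \<in> H True. fst (\<omega> x) = fst r \<and> fst x \<in> touched True s - before_wake s)"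

lemma single_component_step:
  assumes R: "trans R" "refl_on {1..K True} R"
    and same: "\<And>x y. x \<in> H True \<Longrightarrow> y \<in> H True \<Longrightarrow> fst (\<omega> x) = fst (\<omega> y) \<Longrightarrow> (fst x, fst y) \<in> R"
    and v: "valid s" "length s < h" and \<omega>: "\<omega> \<in> consistent s" and inv: "single_component R \<omega> s"
  shows "single_component R \<omega> (advance pick \<omega> s)"
  using v
proof (cases rule: pick_cases)
  case (group q)
  have q: "q \<in> alive (\<not> True) s" using group by (simp add: active_def)
  define p where "p = partner \<omega> True q"
  have p: "p \<in> alive True s" unfolding p_def by (rule partner_alive[OF \<omega> v(1) q])
  have \<omega>p: "\<omega> p = q"
    using partner_props(2)[OF consistent_bijs[OF \<omega>], of q True] q by (simp add: p_def alive_def)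
  let ?s = "entry True q p # s"
  have tT: "touched True ?s = insert (fst p) (touched True s)" by (simp add: touched_entry)
  have tF: "touched False ?s = touched False s" using group by (auto simp: touched_entry active_def)
  have bw: "before_wake ?s = before_wake s" by simp
  have al: "alive c ?s \<subseteq> alive c s" for c by (auto simp: alive_def)
  obtain x0 where x0: "x0 \<in> H True" "fst (\<omega> x0) = fst q" "fst x0 \<in> touched True s - before_wake s"
    using inv group by (auto simp: single_component_def)
  obtain v0 where v0: "\<And>v. v \<in> touched True s - before_wake s \<Longrightarrow> (v0, v) \<in> R"
    using inv by (auto simp: single_component_def)
  have "(fst x0, fst p) \<in> R" using x0 \<omega>p p by (intro same) (auto simp: alive_def)
  hence "(v0, fst p) \<in> R" using v0[OF x0(3)] R(1) by (meson transD)
  hence 1: "\<forall>v \<in> touched True ?s - before_wake ?s. (v0, v) \<in> R" unfolding tT bw using v0 by auto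
  have 2: "\<forall>x \<in> active True ?s. fst x \<notin> before_wake ?s"
  proof
    fix x assume x: "x \<in> active True ?s"
    hence "x \<in> alive True s" using al[of True] by (auto simp: active_def)
    hence "fst x \<in> touched True s \<Longrightarrow> x \<in> active True s" by (simp add: active_def)
    thus "fst x \<notin> before_wake ?s"
      using inv before_wake_subset[of s] unfolding bw single_component_def by blast
  qed
  have 3: "\<forall>r \<in> active False ?s. \<exists>x \<in> H True. fst (\<omega> x) = fst r \<and> fst x \<in> touched True ?s - before_wake ?s"
  proof
    fix r assume "r \<in> active False ?s"
    hence "r \<in> active False s" using al[of False] unfolding active_def tF by auto
    thus "\<exists>x \<in> H True. fst (\<omega> x) = fst r \<and> fst x \<in> touched True ?s - before_wake ?s"
      using inv unfolding single_component_def tT bw by blast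
  qed
  have "single_component R \<omega> ?s" unfolding single_component_def using 1 2 3 by blast
  thus ?thesis using group(1) by (simp add: advance_def p_def)
next
  case (individual q)
  define p where "p = partner \<omega> False q"
  have \<omega>q: "\<omega> q = p" by (simp add: p_def partner_def)
  let ?s = "entry False q p # s"
  have q: "q \<in> H True" "fst q \<in> touched True s" using individual by (auto simp: active_def alive_def)
  have tT: "touched True ?s = touched True s" using q by (auto simp: touched_entry)
  have tF: "touched False ?s = insert (fst p) (touched False s)" by (simp add: touched_entry)
  have bw: "before_wake ?s = before_wake s" using q by simp
  have al: "alive c ?s \<subseteq> alive c s" for c by (auto simp: alive_def)
  have 1: "\<exists>v0. \<forall>v \<in> touched True ?s - before_wake ?s. (v0, v) \<in> R"
    using inv unfolding tT bw single_component_def by blast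
  have 2: "\<forall>x \<in> active True ?s. fst x \<notin> before_wake ?s"
    using inv al[of True] unfolding bw single_component_def active_def tT by blast
  have qn: "fst q \<notin> before_wake s" using inv individual by (auto simp: single_component_def)
  have 3: "\<forall>r \<in> active False ?s. \<exists>x \<in> H True. fst (\<omega> x) = fst r \<and> fst x \<in> touched True ?s - before_wake ?s"
  proof
    fix r assume r: "r \<in> active False ?s"
    show "\<exists>x \<in> H True. fst (\<omega> x) = fst r \<and> fst x \<in> touched True ?s - before_wake ?s"
    proof (cases "fst r = fst p")
      case True thus ?thesis unfolding tT bw using q qn \<omega>q by (intro bexI[of _ q]) auto
    next
      case False
      hence "r \<in> active False s" using r al[of False] unfolding active_def tF by auto
      thus ?thesis using inv unfolding single_component_def tT bw by blast
    qed
  qed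
  have "single_component R \<omega> ?s" unfolding single_component_def using 1 2 3 by blast
  thus ?thesis using individual(1) by (simp add: advance_def p_def)
next
  case (wake q)
  define p where "p = partner \<omega> False q"
  have \<omega>q: "\<omega> q = p" by (simp add: p_def partner_def)
  let ?s = "entry False q p # s"
  have q: "q \<in> H True" "fst q \<in> {1..K True}" using wake by (auto simp: alive_def H_def)
  have tT: "touched True ?s = insert (fst q) (touched True s)" by (simp add: touched_entry)
  have tF: "touched False ?s = insert (fst p) (touched False s)" by (simp add: touched_entry)
  have bw: "before_wake ?s = touched True s" using wake by simp
  have al: "alive c ?s \<subseteq> alive c s" for c by (auto simp: alive_def)
  have 1: "\<forall>v \<in> touched True ?s - before_wake ?s. (fst q, v) \<in> R"
    unfolding tT bw using R(2) q by (auto dest: refl_onD)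
  have 2: "\<forall>x \<in> active True ?s. fst x \<notin> before_wake ?s"
    using wake(4) al[of True] unfolding bw active_def by blast
  have 3: "\<forall>r \<in> active False ?s. \<exists>x \<in> H True. fst (\<omega> x) = fst r \<and> fst x \<in> touched True ?s - before_wake ?s"
  proof
    fix r assume r: "r \<in> active False ?s"
    have "fst r = fst p" using r wake(5) al[of False] unfolding active_def tF by blast
    thus "\<exists>x \<in> H True. fst (\<omega> x) = fst r \<and> fst x \<in> touched True ?s - before_wake ?s"
      unfolding tT bw using q wake(3) \<omega>q by (intro bexI[of _ q]) auto
  qed
  have "single_component R \<omega> ?s" unfolding single_component_def using 1 2 3 by blast
  thus ?thesis using wake(1) by (simp add: advance_def p_def)
qed

lemma consistent_step:
  assumes "valid s" "length s < h" "\<omega> \<in> consistent s"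
  shows "\<omega> \<in> consistent (advance pick \<omega> s)"
proof -
  have "snd (pick s) \<in> H (\<not> fst (pick s))" using pick_alive[OF assms(1,2)] by (simp add: alive_def)
  from partner_props(2)[OF consistent_bijs[OF assms(3)] this] show ?thesis
    using assms(3) by (simp only: consistent_Cons_iff advance_def)
qed

end

section \<open>Exploring from a given set and exploring all components\<close>

context degree_exploration
begin

lemma touched_subset:
  assumes "valid s" "W \<subseteq> {1..K True}" shows "touched True s \<subseteq> {1..K True}"
proof -
  have "fst ` H True \<subseteq> {1..K True}" by (auto simp: H_def)
  moreover have "fst ` side True ` set s \<subseteq> fst ` H True"
    using assms(1) unfolding valid_def by (intro image_mono) blast
  ultimately show ?thesis using assms(2) unfolding touched_def by auto
qed

lemma clock_halves:
  assumes "2 \<le> h - length s" "x \<le> clock c s" "0 \<le> x"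
  shows "x / 2 \<le> clock c (entry b q p # s)"
proof -
  have "1/2 \<le> 1 - 1 / real (h - length s)" using assms(1) by (simp add: field_simps)
  hence "x * (1/2) \<le> clock c s * (1 - 1 / real (h - length s))" using assms by (intro mult_mono) auto
  thus ?thesis using assms by auto
qed

lemma two_alive:
  fixes a b :: real
  assumes "valid s" "a \<le> clock True s" "b \<le> clock False s" "0 \<le> a" "0 \<le> b" "2 \<le> h * (a * b)"
  shows "2 \<le> h - length s"
proof -
  have "h * (a * b) \<le> h * (clock True s * clock False s)"
    using assms by (intro mult_left_mono mult_mono) auto
  hence "2 \<le> real (h - length s)"
    using clock_product[OF length_valid[OF assms(1)]] assms(6) by (simp add: mult.assoc)
  thus ?thesis by linarith
qed

lemma not_exhausted:
  assumes "valid s" "0 < clock True s" "0 < clock False s" "h > 0" shows "length s \<noteq> h"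
proof
  assume "length s = h"
  hence "real h * clock True s * clock False s = 0"
    using clock_product[OF length_valid[OF assms(1)]] by simp
  thus False using assms by simp
qed

definition union_of_components :: "matching \<Rightarrow> nat set \<Rightarrow> bool" where
  "union_of_components \<omega> T \<longleftrightarrow> T \<subseteq> {1..K True} \<and>
     (\<forall>x\<in>H True. \<forall>y\<in>H True. fst (\<omega> x) = fst (\<omega> y) \<longrightarrow> fst x \<in> T \<longrightarrow> fst y \<in> T)"

definition joins_communities :: "matching \<Rightarrow> nat rel \<Rightarrow> bool" where
  "joins_communities \<omega> R \<longleftrightarrow> trans R \<and> refl_on {1..K True} R \<and>
     (\<forall>x\<in>H True. \<forall>y\<in>H True. fst (\<omega> x) = fst (\<omega> y) \<longrightarrow> (fst x, fst y) \<in> R)"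

text \<open>
  The run stops when nothing is active or when a clock gets too small. The number of active half-edges
  is never negative, so \<open>z y\<close> is at least \<open>z G(z)\<close> and \<open>y G(y)\<close> up to \<open>\<epsilon>\<close> at the final state. By
  \<open>crossing\<close> and \<open>low\<close> this fails where a clock has got too small; hence the run has ended because
  nothing is active. The bound \<open>z1/2\<close> covers the overshoot of the last step, which at most halves a clock.
\<close>

lemma exploration_from_set:
  fixes z1 y1 \<epsilon> \<theta> :: real and G :: "bool \<Rightarrow> real \<Rightarrow> real" and g :: "real \<Rightarrow> real"
  assumes W: "W \<subseteq> {1..K True}"
    and z1: "0 < z1" "z1 < 1" and y1: "0 < y1" "y1 < 1" and h: "2 \<le> h * (z1 * y1)" and \<theta>: "\<theta> > 0"
    and g: "\<And>z. z \<in> {z1..1} \<Longrightarrow> g z1 \<le> g z"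
    and fluid: "\<And>s. valid s \<Longrightarrow>
         (\<And>c k. k \<in> {1..B} \<Longrightarrow> card (untouched c k []) * clock c s ^ k - \<theta> * h \<le> card (untouched c k s)) \<Longrightarrow>
         (\<forall>c. h * (clock c s * G c (clock c s) - \<epsilon>) \<le> asleep c s) \<and>
         K True * (g (clock True s) - \<epsilon>) \<le> card ({1..K True} - touched True s)"
    and crossing: "\<And>z y. z \<in> {z1/2..z1} \<Longrightarrow> y \<in> {0..1} \<Longrightarrow>
         z * y < z * G True z - \<epsilon> \<or> z * y < y * G False y - \<epsilon>"
    and low: "\<And>z y. z \<in> {z1..1} \<Longrightarrow> y \<in> {0..y1} \<Longrightarrow> z * y < z * G True z - \<epsilon>"
  shows "card {\<omega> \<in> bijs. \<not> (\<exists>T. W \<subseteq> T \<and> union_of_components \<omega> T \<and>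
            K True * (g z1 - \<epsilon>) \<le> card ({1..K True} - T))}
         \<le> run_bound (min z1 y1) B / (\<theta>\<^sup>2 * h) * card bijs"
proof -
  define stop where "stop s \<longleftrightarrow> (active True s = {} \<and> active False s = {}) \<or>
      clock True s \<le> z1 \<or> clock False s \<le> y1" for s
  define I where "I s \<longleftrightarrow> valid s \<and> z1/2 \<le> clock True s \<and> y1/2 \<le> clock False s" for s
  have hpos: "h > 0" using h by (cases h) auto
  have two: "2 \<le> h - length s" if "I s" "\<not> stop s" for s
    using that z1 y1 h by (intro two_alive[of s z1 y1]) (auto simp: I_def stop_def)
  have I_step: "I (entry (fst (pick s)) (snd (pick s)) p # s)"
    if "I s" "\<not> stop s" "p \<in> alive (fst (pick s)) s" for s p
  proof -
    have v: "valid s" "length s < h" using that two[OF that(1,2)] by (auto simp: I_def)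
    show ?thesis using valid_entry[OF v(1) pick_alive[OF v] that(3)] that(2)
      clock_halves[OF two[OF that(1,2)]] z1 y1 unfolding I_def stop_def
      by (metis less_eq_real_def linorder_not_less)
  qed
  define F where "F \<omega> = run pick stop \<omega> h []" for \<omega>
  have conc: "card {\<omega> \<in> bijs. potential (-1) B (F \<omega>) > (\<theta> * h)\<^sup>2}
      \<le> run_bound (min z1 y1) B / (\<theta>\<^sup>2 * h) * card bijs"
    unfolding F_def
  proof (rule run_concentration[where I = I])
    show "I []" using z1 y1 by (simp add: I_def)
    fix s assume s: "I s" "\<not> stop s"
    have v: "valid s" "length s < h" using s two[OF s] by (auto simp: I_def)
    show "snd (pick s) \<in> alive (\<not> fst (pick s)) s" by (rule pick_alive[OF v])
    show "(-1::real) = 1 \<or> fst (snd (pick s)) \<in> touched (\<not> fst (pick s)) s"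
      using pick_touched[OF v] s(2) by (auto simp: stop_def)
    show "min z1 y1 \<le> clock c s" for c using s(2) by (cases c) (auto simp: stop_def)
  qed (use z1 y1 hpos \<theta> two I_step in \<open>auto simp: I_def\<close>)
  have good: "\<exists>T. W \<subseteq> T \<and> union_of_components \<omega> T \<and>
            K True * (g z1 - \<epsilon>) \<le> card ({1..K True} - T)"
    if \<omega>: "\<omega> \<in> bijs" and pot: "potential (-1) B (F \<omega>) \<le> (\<theta> * h)\<^sup>2" for \<omega>
  proof -
    let ?s = "F \<omega>"
    have "I ?s \<and> \<omega> \<in> consistent ?s" unfolding F_def
    proof (rule run_invariant)
      show "I [] \<and> \<omega> \<in> consistent []" using z1 y1 \<omega> by (simp add: I_def)
      fix s assume s: "I s \<and> \<omega> \<in> consistent s" "\<not> stop s"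
      have v: "valid s" "length s < h" using s two[of s] by (auto simp: I_def)
      have "partner \<omega> (fst (pick s)) (snd (pick s)) \<in> alive (fst (pick s)) s"
        using partner_alive[OF _ v(1) pick_alive[OF v]] s by blast
      hence "I (advance pick \<omega> s)" using I_step s by (simp add: advance_def)
      thus "I (advance pick \<omega> s) \<and> \<omega> \<in> consistent (advance pick \<omega> s)"
        using s consistent_step[OF v] by blast
    qed
    hence I: "I ?s" and cons: "\<omega> \<in> consistent ?s" by auto
    hence v: "valid ?s" and le: "length ?s \<le> h" using length_valid by (auto simp: I_def)
    define z y where "z = clock True ?s" and "y = clock False ?s"
    have zy: "z1/2 \<le> z" "y1/2 \<le> y" "z \<le> 1" "y \<le> 1" "0 \<le> z" "0 \<le> y"
      using I clock_bounds[OF le] by (auto simp: I_def z_def y_def)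
    have cpos: "0 < clock c ?s" for c using zy z1 y1 by (cases c) (auto simp: z_def y_def)
    have st: "stop ?s"
      using run_stops[of stop pick \<omega> h "[]"] not_exhausted[OF v cpos cpos hpos] by (auto simp: F_def)
    have fl: "(\<forall>c. h * (clock c ?s * G c (clock c ?s) - \<epsilon>) \<le> asleep c ?s) \<and>
         K True * (g (clock True ?s) - \<epsilon>) \<le> card ({1..K True} - touched True ?s)"
    proof (rule fluid[OF v])
      fix c k assume k: "k \<in> {1..B}"
      show "card (untouched c k []) * clock c ?s ^ k - \<theta> * h \<le> card (untouched c k ?s)"
        using untouched_near_fluid[OF pot k le cpos, of c] \<theta> by simp
    qed
    have A: "h * (clock c ?s * G c (clock c ?s) - \<epsilon>) \<le> h * (z * y)" for c
      using fl asleep_le(1)[OF v, of c] unfolding z_def y_def by (meson order_trans)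
    have A: "clock c ?s * G c (clock c ?s) - \<epsilon> \<le> z * y" for c
      using A[of c] hpos by simp
    have AT: "z * G True z - \<epsilon> \<le> z * y" and AF: "y * G False y - \<epsilon> \<le> z * y"
      using A[of True] A[of False] by (simp_all add: z_def y_def)
    have zgt: "z > z1"
      using crossing[of z y] zy AT AF by (cases "z > z1") auto
    have ygt: "y > y1"
      using low[of z y] zgt zy AT by (cases "y > y1") auto
    have ina: "active True ?s = {}" "active False ?s = {}"
      using st zgt ygt by (auto simp: stop_def z_def y_def)
    show ?thesis
      unfolding union_of_components_def
    proof (intro exI[of _ "touched True ?s"] conjI ballI impI)
      show "W \<subseteq> touched True ?s" by (auto simp: touched_def)
      show "touched True ?s \<subseteq> {1..K True}" by (rule touched_subset[OF v W])
      show "fst y \<in> touched True ?s" if "x \<in> H True" "y \<in> H True" "fst (\<omega> x) = fst (\<omega> y)" "fst x \<in> touched True ?s" for x y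
        by (rule closed_when_inactive[OF v cons ina that])
      have "K True * (g z1 - \<epsilon>) \<le> K True * (g z - \<epsilon>)"
        using g[of z] zgt zy by (intro mult_left_mono) auto
      thus "K True * (g z1 - \<epsilon>) \<le> card ({1..K True} - touched True ?s)" using fl unfolding z_def by linarith
    qed
  qed
  let ?good = "\<lambda>\<omega>. \<exists>T. W \<subseteq> T \<and> union_of_components \<omega> T \<and> K True * (g z1 - \<epsilon>) \<le> card ({1..K True} - T)"
  have "{\<omega> \<in> bijs. \<not> ?good \<omega>} \<subseteq> {\<omega> \<in> bijs. potential (-1) B (F \<omega>) > (\<theta> * h)\<^sup>2}"
  proof (intro subsetI CollectI conjI; elim CollectE conjE)
    fix \<omega> assume \<omega>: "\<omega> \<in> bijs" "\<not> ?good \<omega>"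
    thus "(\<theta> * h)\<^sup>2 < potential (-1) B (F \<omega>)" using good[OF \<omega>(1)] by (meson not_less)
  qed
  hence "card {\<omega> \<in> bijs. \<not> ?good \<omega>} \<le> card {\<omega> \<in> bijs. potential (-1) B (F \<omega>) > (\<theta> * h)\<^sup>2}"
    using finite_bijs by (intro card_mono) auto
  thus ?thesis using conc by linarith
qed

text \<open>
  The run stops when \<open>z\<close> reaches \<open>z2\<close>, or when a component has been completed although a clock is below
  \<open>1 - \<rho>\<close>. By \<open>alive_region\<close> the second event is excluded as long as \<open>z > z2\<close>, so it is \<open>z\<close> that stops
  the run, and no component has been completed since the clocks left the corner near \<open>(1, 1)\<close>. Up to
  the last waking at most \<open>2 \<rho> h\<close> steps had been made, and everything touched later lies in one
  component. A third way to stop keeps the group clock above \<open>y0/2\<close>: that clock moves only while no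
  group is active, and the run also stops if it is then at most \<open>y0\<close>, which \<open>low\<close> excludes.
\<close>

lemma exploration_by_components:
  fixes z2 y0 \<epsilon> \<theta> \<rho> :: real and G :: "bool \<Rightarrow> real \<Rightarrow> real" and g :: "real \<Rightarrow> real"
  assumes W: "W = {}"
    and z2: "0 < z2" "z2 < 1" and y0: "0 < y0" "y0 < 1" and h: "2 \<le> h * (z2 * (y0/2))" and \<theta>: "\<theta> > 0"
    and \<rho>: "0 < \<rho>" "\<rho> < 1"
    and g: "\<And>z. z \<in> {0..z2} \<Longrightarrow> g z \<le> g z2"
    and fluid: "\<And>s. valid s \<Longrightarrow>
         (\<And>c k. k \<in> {1..B} \<Longrightarrow> card (untouched c k s) \<le> card (untouched c k []) * clock c s ^ k + \<theta> * h) \<Longrightarrow>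
         (\<forall>c. asleep c s \<le> h * (clock c s * G c (clock c s) + \<epsilon>)) \<and>
         card ({1..K True} - touched True s) \<le> K True * (g (clock True s) + \<epsilon>)"
    and low: "\<And>z y. z \<in> {z2..1} \<Longrightarrow> y \<in> {y0/2..y0} \<Longrightarrow> z * y > y * G False y + \<epsilon>"
    and alive_region: "\<And>z y. z \<in> {z2..1} \<Longrightarrow> y \<in> {y0/2..1} \<Longrightarrow> \<not> (y > 1 - \<rho> \<and> z > 1 - \<rho>) \<Longrightarrow>
         z * y > z * G True z + \<epsilon> \<or> z * y > y * G False y + \<epsilon>"
  shows "card {\<omega> \<in> bijs. \<not> (\<forall>R. joins_communities \<omega> R \<longrightarrow> (\<exists>v0 S. S \<subseteq> {1..K True} \<and> (\<forall>v\<in>S. (v0, v) \<in> R) \<and>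
               K True * (1 - g z2 - \<epsilon>) - 2 * \<rho> * h \<le> card S))}
         \<le> run_bound (min z2 (y0/2)) B / (\<theta>\<^sup>2 * h) * card bijs"
proof -
  define stop where "stop s \<longleftrightarrow> clock True s \<le> z2 \<or> (active False s = {} \<and> clock False s \<le> y0) \<or>
      (active True s = {} \<and> active False s = {} \<and> \<not> (clock False s > 1 - \<rho> \<and> clock True s > 1 - \<rho>))" for s
  define I where "I s \<longleftrightarrow> valid s \<and> z2/2 \<le> clock True s \<and> y0/2 \<le> clock False s" for s
  have hpos: "h > 0" using h by (cases h) auto
  have two: "2 \<le> h - length s" if "I s" "\<not> stop s" for s
    using that z2 y0 h by (intro two_alive[of s z2 "y0/2"]) (auto simp: I_def stop_def)
  have I_step: "I (entry (fst (pick s)) (snd (pick s)) p # s)"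
    if "I s" "\<not> stop s" "p \<in> alive (fst (pick s)) s" for s p
  proof -
    have v: "valid s" "length s < h" using that two[OF that(1,2)] by (auto simp: I_def)
    have z: "z2/2 \<le> clock True (entry (fst (pick s)) (snd (pick s)) p # s)"
      using that z2 by (intro clock_halves two) (auto simp: stop_def)
    have y: "y0/2 \<le> clock False (entry (fst (pick s)) (snd (pick s)) p # s)"
    proof (cases "active False s = {}")
      case True
      thus ?thesis using that y0 by (intro clock_halves two) (auto simp: stop_def)
    next
      case False
      hence "fst (pick s) = True" by (simp add: pick_def)
      thus ?thesis using that(1) by (simp add: I_def)
    qed
    show ?thesis using valid_entry[OF v(1) pick_alive[OF v] that(3)] z y unfolding I_def by blast
  qed
  define F where "F \<omega> = run pick stop \<omega> h []" for \<omega>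
  have conc: "card {\<omega> \<in> bijs. potential 1 B (F \<omega>) > (\<theta> * h)\<^sup>2}
      \<le> run_bound (min z2 (y0/2)) B / (\<theta>\<^sup>2 * h) * card bijs"
    unfolding F_def
  proof (rule run_concentration[where I = I])
    show "I []" using z2 y0 by (simp add: I_def)
    fix s assume s: "I s" "\<not> stop s"
    have v: "valid s" "length s < h" using s two[OF s] by (auto simp: I_def)
    show "snd (pick s) \<in> alive (\<not> fst (pick s)) s" by (rule pick_alive[OF v])
    show "min z2 (y0/2) \<le> clock c s" for c using s by (cases c) (auto simp: stop_def I_def)
  qed (use z2 y0 hpos \<theta> two I_step in \<open>auto simp: I_def\<close>)
  have good: "\<exists>v0 S. S \<subseteq> {1..K True} \<and> (\<forall>v\<in>S. (v0, v) \<in> R) \<and>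
               K True * (1 - g z2 - \<epsilon>) - 2 * \<rho> * h \<le> card S"
    if \<omega>: "\<omega> \<in> bijs" and pot: "potential 1 B (F \<omega>) \<le> (\<theta> * h)\<^sup>2"
      and R: "joins_communities \<omega> R" for \<omega> R
  proof -
    let ?s = "F \<omega>"
    have tw: "touched True s = fst ` side True ` set s" for s
      unfolding touched_def using W by simp
    have bw0: "before_wake [] = {}" using before_wake.simps(1) W by (rule trans)
    have tl: "card (touched True s) \<le> length s" for s
    proof -
      have "card (touched True s) = card (fst ` side True ` set s)" by (simp only: tw)
      also have "\<dots> \<le> card (set s)" by (metis card_image_le finite_imageI List.finite_set order_trans)
      also have "\<dots> \<le> length s" by (rule card_length)
      finally show ?thesis .
    qed
    have "I ?s \<and> \<omega> \<in> consistent ?s \<and> single_component R \<omega> ?s \<and> real (card (before_wake ?s)) \<le> 2 * \<rho> * h"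
      unfolding F_def
    proof (rule run_invariant)
      show "I [] \<and> \<omega> \<in> consistent [] \<and> single_component R \<omega> [] \<and> real (card (before_wake [])) \<le> 2 * \<rho> * h"
        unfolding bw0 single_component_def active_def tw touched_def[of False]
        using z2 y0 \<omega> \<rho> by (simp add: I_def)
      fix s assume s: "I s \<and> \<omega> \<in> consistent s \<and> single_component R \<omega> s \<and> real (card (before_wake s)) \<le> 2 * \<rho> * h"
        and ns: "\<not> stop s"
      have v: "valid s" "length s < h" using s ns two[of s] by (auto simp: I_def)
      define e where "e = entry (fst (pick s)) (snd (pick s)) (partner \<omega> (fst (pick s)) (snd (pick s)))"
      have adv: "advance pick \<omega> s = e # s" by (simp add: advance_def e_def)
      have "partner \<omega> (fst (pick s)) (snd (pick s)) \<in> alive (fst (pick s)) s"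
        using partner_alive[OF _ v(1) pick_alive[OF v]] s by blast
      hence 1: "I (e # s)" using I_step s ns by (auto simp: e_def)
      have 2: "\<omega> \<in> consistent (e # s)" using consistent_step[OF v] s unfolding adv[symmetric] by blast
      have 3: "single_component R \<omega> (e # s)"
        unfolding adv[symmetric] using R s v by (intro single_component_step) (auto simp: joins_communities_def)
      have 4: "real (card (before_wake (e # s))) \<le> 2 * \<rho> * h"
      proof (cases "\<not> fst e \<and> fst (side True e) \<notin> touched True s")
        case True
        have "active True s = {} \<and> active False s = {}"
          using v by (cases rule: pick_cases) (use True in \<open>auto simp: e_def active_def\<close>)
        hence c: "1 - \<rho> \<le> clock True s" "1 - \<rho> \<le> clock False s" using ns by (auto simp: stop_def)
        have "(1 - \<rho>) * (1 - \<rho>) \<le> clock True s * clock False s" using c \<rho> by (intro mult_mono) auto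
        moreover have "1 - 2 * \<rho> \<le> (1 - \<rho>) * (1 - \<rho>)" by (simp add: algebra_simps)
        ultimately have "1 - 2 * \<rho> \<le> clock True s * clock False s" by linarith
        hence "h * (1 - 2 * \<rho>) \<le> h * (clock True s * clock False s)" by (intro mult_left_mono) auto
        hence "h * (1 - 2 * \<rho>) \<le> real h - real (length s)"
          using clock_product[OF length_valid[OF v(1)]] v(2) by (simp only: mult.assoc of_nat_diff less_imp_le)
        hence "real (length s) \<le> 2 * \<rho> * h" by (simp add: algebra_simps)
        thus ?thesis using True tl[of s] by simp
      next
        case False thus ?thesis using s by auto
      qed
      show "I (advance pick \<omega> s) \<and> \<omega> \<in> consistent (advance pick \<omega> s) \<and>
          single_component R \<omega> (advance pick \<omega> s) \<and> real (card (before_wake (advance pick \<omega> s))) \<le> 2 * \<rho> * h"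
        using 1 2 3 4 unfolding adv by blast
    qed
    hence I: "I ?s" and sc: "single_component R \<omega> ?s" and bw: "real (card (before_wake ?s)) \<le> 2 * \<rho> * h" by auto
    hence v: "valid ?s" and le: "length ?s \<le> h" using length_valid by (auto simp: I_def)
    define z y where "z = clock True ?s" and "y = clock False ?s"
    have zy: "z2/2 \<le> z" "y0/2 \<le> y" "z \<le> 1" "y \<le> 1" "0 \<le> z" "0 \<le> y"
      using I clock_bounds[OF le] by (auto simp: I_def z_def y_def)
    have cpos: "0 < clock c ?s" for c using zy z2 y0 by (cases c) (auto simp: z_def y_def)
    have st: "stop ?s"
      using run_stops[of stop pick \<omega> h "[]"] not_exhausted[OF v cpos cpos hpos] by (auto simp: F_def)
    have fl: "(\<forall>c. asleep c ?s \<le> h * (clock c ?s * G c (clock c ?s) + \<epsilon>)) \<and>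
         card ({1..K True} - touched True ?s) \<le> K True * (g (clock True ?s) + \<epsilon>)"
    proof (rule fluid[OF v])
      fix c k assume k: "k \<in> {1..B}"
      show "card (untouched c k ?s) \<le> card (untouched c k []) * clock c ?s ^ k + \<theta> * h"
        using untouched_near_fluid[OF pot k le cpos, of c] \<theta> by simp
    qed
    have A: "z * y \<le> clock c ?s * G c (clock c ?s) + \<epsilon>" if "active c ?s = {}" for c
    proof -
      have "h * (z * y) \<le> h * (clock c ?s * G c (clock c ?s) + \<epsilon>)"
        using fl asleep_le(2)[OF v that] unfolding z_def y_def by metis
      thus ?thesis using hpos by simp
    qed
    have AT: "active True ?s = {} \<Longrightarrow> z * y \<le> z * G True z + \<epsilon>"
      and AF: "active False ?s = {} \<Longrightarrow> z * y \<le> y * G False y + \<epsilon>"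
      using A[of True] A[of False] by (simp_all add: z_def y_def)
    have zle: "z \<le> z2"
    proof (rule ccontr)
      assume "\<not> z \<le> z2"
      hence zr: "z \<in> {z2..1}" using zy by simp
      from st \<open>\<not> z \<le> z2\<close> consider "active False ?s = {}" "y \<le> y0"
        | "active True ?s = {}" "active False ?s = {}" "\<not> (y > 1 - \<rho> \<and> z > 1 - \<rho>)"
        by (auto simp: stop_def z_def y_def)
      thus False
      proof cases
        case 1 thus False using low[OF zr, of y] AF zy by auto
      next
        case 2 thus False using alive_region[OF zr, of y] AT AF zy by auto
      qed
    qed
    have tsub: "touched True ?s \<subseteq> {1..K True}" by (rule touched_subset[OF v]) (simp add: W)
    define S where "S = touched True ?s - before_wake ?s"
    have fin: "finite (touched True ?s)" using tsub finite_subset by blast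
    have cS: "real (card S) \<ge> real (card (touched True ?s)) - card (before_wake ?s)"
      unfolding S_def using before_wake_subset[of ?s] fin
      by (simp add: card_Diff_subset finite_subset card_mono of_nat_diff)
    have "card ({1..K True} - touched True ?s) = K True - card (touched True ?s)"
      using tsub fin by (simp add: card_Diff_subset)
    moreover have "card (touched True ?s) \<le> K True" using card_mono[OF _ tsub] by simp
    ultimately have cT: "real (card (touched True ?s)) = K True - real (card ({1..K True} - touched True ?s))"
      by (simp add: of_nat_diff)
    have "K True * (g z + \<epsilon>) \<le> K True * (g z2 + \<epsilon>)" using g[of z] zle zy by (intro mult_left_mono) auto
    hence "card ({1..K True} - touched True ?s) \<le> K True * (g z2 + \<epsilon>)" using fl unfolding z_def by linarith
    hence "K True * (1 - g z2 - \<epsilon>) - 2 * \<rho> * h \<le> card S"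
      using cS cT bw by (simp add: algebra_simps)
    moreover obtain v0 where "\<forall>v\<in>S. (v0, v) \<in> R" using sc by (auto simp: single_component_def S_def)
    moreover have "S \<subseteq> {1..K True}" using tsub by (auto simp: S_def)
    ultimately show ?thesis by blast
  qed
  let ?good = "\<lambda>\<omega>. \<forall>R. joins_communities \<omega> R \<longrightarrow> (\<exists>v0 S. S \<subseteq> {1..K True} \<and> (\<forall>v\<in>S. (v0, v) \<in> R) \<and>
               K True * (1 - g z2 - \<epsilon>) - 2 * \<rho> * h \<le> card S)"
  have "{\<omega> \<in> bijs. \<not> ?good \<omega>} \<subseteq> {\<omega> \<in> bijs. potential 1 B (F \<omega>) > (\<theta> * h)\<^sup>2}"
  proof (intro subsetI CollectI conjI; elim CollectE conjE)
    fix \<omega> assume \<omega>: "\<omega> \<in> bijs" "\<not> ?good \<omega>"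
    thus "(\<theta> * h)\<^sup>2 < potential 1 B (F \<omega>)" using good[OF \<omega>(1)] by (meson not_less)
  qed
  hence "card {\<omega> \<in> bijs. \<not> ?good \<omega>} \<le> card {\<omega> \<in> bijs. potential 1 B (F \<omega>) > (\<theta> * h)\<^sup>2}"
    using finite_bijs by (intro card_mono) auto
  thus ?thesis using conc by linarith
qed

end

section \<open>Gaps between the two sides of the fixed point equation\<close>

lemma pgf_pos:
  assumes "z \<in> {0<..1}" shows "0 < pgf X z"
proof -
  obtain k where "k \<in> set_pmf X" using set_pmf_not_empty[of X] by blast
  hence "0 < pmf X k * z ^ k" using assms by (simp add: pmf_positive)
  also have "\<dots> \<le> (\<Sum>i<Suc k. pmf X i * z ^ i)"
    using assms by (intro member_le_sum) auto
  also have "\<dots> \<le> pgf X z" using assms by (intro pgf_partial_sum) auto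
  finally show ?thesis .
qed

lemma pgf_eq_1_imp:
  assumes y: "y \<in> {0..<1}" "pgf Y y = 1" and x: "x \<in> {0..1}"
  shows "pgf Y x = 1"
proof (cases "y \<le> x")
  case True
  thus ?thesis using pgf_mono[of y x Y] pgf_range[OF x, of Y] y x by auto
next
  case False
  define t where "t = (y - x) / (1 - x)"
  have t: "t \<in> {0..1}" "t < 1" using False x y by (auto simp: t_def field_simps)
  have "t * (1 - x) = y - x" using False y by (simp add: t_def)
  hence "y = (1 - t) * x + t * 1" by (simp add: algebra_simps)
  hence "1 \<le> (1 - t) * pgf Y x + t * 1" using pgf_convex[OF x _ t(1), of 1 Y] y(2) by simp
  hence "(1 - t) * 1 \<le> (1 - t) * pgf Y x" by (simp add: algebra_simps)
  hence "1 \<le> pgf Y x" using t by simp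
  thus ?thesis using pgf_range[OF x, of Y] by simp
qed

lemma positive_on_compact:
  fixes \<phi> :: "'a :: topological_space \<Rightarrow> real"
  assumes "compact S" "continuous_on S \<phi>" "\<And>x. x \<in> S \<Longrightarrow> 0 < \<phi> x"
  obtains c where "c > 0" "\<And>x. x \<in> S \<Longrightarrow> c \<le> \<phi> x"
proof (cases "S = {}")
  case True thus ?thesis using that[of 1] by simp
next
  case False
  then obtain x where "x \<in> S" "\<forall>y\<in>S. \<phi> x \<le> \<phi> y" using continuous_attains_inf assms by blast
  thus ?thesis using that[of "\<phi> x"] assms(3) by blast
qed

text \<open>
  Both differences are nonpositive only if \<open>y \<ge> G_l(z)\<close> and \<open>z \<ge> G_r(y) \<ge> f(z)\<close>, which contradicts
  \<open>f(z) > z\<close>. Compactness turns this into a uniform gap.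
\<close>

lemma crossing_gap:
  assumes z1: "0 < z1" "z1 < 1" and above: "\<And>z. z \<in> {0..z1} \<Longrightarrow> z < pgf Y (pgf X z)"
  obtains c where "c > 0"
    and "\<And>z y. z \<in> {z1/2..z1} \<Longrightarrow> y \<in> {0..1} \<Longrightarrow> c \<le> z * pgf X z - z * y \<or> c \<le> y * pgf Y y - z * y"
proof -
  define \<phi> where "\<phi> p = max (fst p * pgf X (fst p) - fst p * snd p) (snd p * pgf Y (snd p) - fst p * snd p)" for p
  define S where "S = {z1/2..z1} \<times> {0..1::real}"
  have cont: "continuous_on S \<phi>"
    unfolding \<phi>_def S_def using z1
    by (intro continuous_intros continuous_on_compose2[OF continuous_on_pgf]) auto
  have pos: "0 < \<phi> p" if "p \<in> S" for p
  proof -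
    obtain z y where p: "p = (z, y)" by (cases p)
    have z: "z \<in> {z1/2..z1}" and y: "y \<in> {0..1}" using that by (auto simp: S_def p)
    have z': "z \<in> {0<..1}" "z \<in> {0..1}" "z \<in> {0..z1}" using z z1 by auto
    show ?thesis
    proof (cases "y < pgf X z")
      case True
      hence "0 < z * (pgf X z - y)" using z' by simp
      thus ?thesis by (simp add: \<phi>_def p algebra_simps less_max_iff_disj)
    next
      case False
      hence ypos: "y > 0" using pgf_pos[OF z'(1), of X] by linarith
      have "z < pgf Y (pgf X z)" by (rule above[OF z'(3)])
      also have "\<dots> \<le> pgf Y y" using False y pgf_range[OF z'(2), of X] by (intro pgf_mono) auto
      finally have "0 < y * (pgf Y y - z)" using ypos by simp
      thus ?thesis by (simp add: \<phi>_def p algebra_simps less_max_iff_disj)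
    qed
  qed
  have "compact S" unfolding S_def by (intro compact_Times compact_Icc)
  then obtain c where "c > 0" "\<And>p. p \<in> S \<Longrightarrow> c \<le> \<phi> p" using positive_on_compact[OF _ cont pos] by blast
  thus thesis using that[of c] by (auto simp: S_def \<phi>_def le_max_iff_disj)
qed

text \<open>
  Both differences are nonpositive only if \<open>y \<le> G_l(z)\<close> and \<open>z \<le> G_r(y) \<le> f(z)\<close>, hence only for \<open>z = 1\<close>
  and \<open>G_r(y) = 1\<close>. As \<open>G_r\<close> is not constant, this leaves the corner \<open>y = z = 1\<close>, which is cut off.
\<close>

lemma survival_gap:
  assumes z2: "0 < z2" "z2 < 1" and y2: "0 < y2" and \<rho>: "\<rho> > 0"
    and below: "\<And>z. z \<in> {z2..<1} \<Longrightarrow> pgf Y (pgf X z) < z"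
  obtains c where "c > 0"
    and "\<And>z y. z \<in> {z2..1} \<Longrightarrow> y \<in> {y2..1} \<Longrightarrow> \<not> (y > 1 - \<rho> \<and> z > 1 - \<rho>) \<Longrightarrow>
           c \<le> z * y - z * pgf X z \<or> c \<le> z * y - y * pgf Y y"
proof -
  define \<phi> where "\<phi> p = max (fst p * snd p - fst p * pgf X (fst p)) (fst p * snd p - snd p * pgf Y (snd p))" for p
  define S where "S = ({z2..1} \<times> {y2..1}) \<inter> ({p. snd p \<le> 1 - \<rho>} \<union> {p. fst p \<le> 1 - \<rho>})"
  have cont: "continuous_on S \<phi>"
    unfolding \<phi>_def S_def using z2 y2
    by (intro continuous_intros continuous_on_compose2[OF continuous_on_pgf]) auto
  have pos: "0 < \<phi> p" if "p \<in> S" for p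
  proof -
    obtain z y where p: "p = (z, y)" by (cases p)
    have z: "z \<in> {z2..1}" and y: "y \<in> {y2..1}" and zy: "y \<le> 1 - \<rho> \<or> z \<le> 1 - \<rho>"
      using that by (auto simp: S_def p)
    have z01: "z \<in> {0..1}" and y01: "y \<in> {0..1}" using z y z2 y2 by auto
    consider "pgf X z < y" | "pgf Y y < z" | "y \<le> pgf X z" "z \<le> pgf Y y" by linarith
    thus ?thesis
    proof cases
      case 1
      hence "0 < z * (y - pgf X z)" using z z2 by simp
      thus ?thesis by (simp add: \<phi>_def p algebra_simps less_max_iff_disj)
    next
      case 2
      hence "0 < y * (z - pgf Y y)" using y y2 by simp
      thus ?thesis by (simp add: \<phi>_def p algebra_simps less_max_iff_disj)
    next
      case 3
      have "z \<le> pgf Y (pgf X z)"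
        using 3 pgf_mono[of y "pgf X z" Y] pgf_range[OF z01, of X] y01 by auto
      hence z1: "z = 1" using below[of z] z by fastforce
      hence "pgf Y y = 1" "y \<in> {0..<1}" using 3 pgf_range[OF y01, of Y] zy \<rho> y01 by auto
      hence "pgf Y (pgf X z2) = 1" using pgf_eq_1_imp pgf_range[of z2 X] z2 by auto
      thus ?thesis using below[of z2] z2 by auto
    qed
  qed
  have "closed {p :: real \<times> real. snd p \<le> 1 - \<rho>}" "closed {p :: real \<times> real. fst p \<le> 1 - \<rho>}"
    by (intro closed_Collect_le continuous_intros)+
  hence "compact S" unfolding S_def by (intro compact_Int_closed compact_Times compact_Icc closed_Un)
  then obtain c where "c > 0" "\<And>p. p \<in> S \<Longrightarrow> c \<le> \<phi> p" using positive_on_compact[OF _ cont pos] by blast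
  thus thesis using that[of c] by (auto simp: S_def \<phi>_def le_max_iff_disj not_less)
qed

section \<open>Estimates for the sequence of random graphs\<close>

locale rigc_sequence =
  fixes N M :: "nat \<Rightarrow> nat" and d :: "nat \<Rightarrow> nat \<Rightarrow> nat" and Com :: "nat \<Rightarrow> nat \<Rightarrow> graph"
    and Dl Dr :: "nat pmf"
  assumes N_pos: "\<And>n. N n > 0" and M_pos: "\<And>n. M n > 0"
    and N_lim: "filterlim N at_top sequentially"
    and d_pos: "\<And>n v. v \<in> {1..N n} \<Longrightarrow> 1 \<le> d n v"
    and connected_Com: "\<And>n a. a \<in> {1..M n} \<Longrightarrow> connected_simple_graph (Com n a)"
    and degree_sums: "\<And>n. (\<Sum>v = 1..N n. d n v) = (\<Sum>a = 1..M n. order (Com n a))"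
    and Dl: "integrable (measure_pmf Dl) real" "0 \<notin> set_pmf Dl"
    and Dr: "integrable (measure_pmf Dr) real" "0 \<notin> set_pmf Dr"
    and mean_l: "(\<lambda>n. real (\<Sum>v = 1..N n. d n v) / real (N n)) \<longlonglongrightarrow> mean Dl"
    and mean_r: "(\<lambda>n. real (\<Sum>a = 1..M n. order (Com n a)) / real (M n)) \<longlonglongrightarrow> mean Dr"
    and count_l: "\<And>k. (\<lambda>n. real (degree_count (N n) (d n) {} k) / real (N n)) \<longlonglongrightarrow> pmf Dl k"
    and count_r: "\<And>k. (\<lambda>n. real (degree_count (M n) (\<lambda>a. order (Com n a)) {} k) / real (M n)) \<longlonglongrightarrow> pmf Dr k"
begin

definition h :: "nat \<Rightarrow> nat" where "h n = (\<Sum>v = 1..N n. d n v)"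
definition K :: "nat \<Rightarrow> bool \<Rightarrow> nat" where "K n c = (if c then N n else M n)"
definition dg :: "nat \<Rightarrow> bool \<Rightarrow> nat \<Rightarrow> nat" where "dg n c = (if c then d n else (\<lambda>a. order (Com n a)))"
definition G :: "bool \<Rightarrow> real \<Rightarrow> real" where "G c = pgf (tilde (if c then Dl else Dr))"
definition \<Omega> :: "nat \<Rightarrow> matching set" where "\<Omega> n = matchings (N n) (M n) (d n) (Com n)"
definition conn :: "nat \<Rightarrow> matching \<Rightarrow> nat rel" where "conn n \<omega> = joined (N n) (M n) (d n) (Com n) \<omega>"

lemma community_graph: "community_graph (M n) (Com n)"
  by unfold_locales (use connected_Com in auto)

lemma degree_exploration: "degree_exploration (K n) (dg n) (h n)"
proof
  show "1 \<le> dg n c v" if "v \<in> {1..K n c}" for v c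
    using that d_pos connected_Com by (cases c) (auto simp: dg_def K_def connected_simple_graph_def)
  show "(\<Sum>v = 1..K n c. dg n c v) = h n" for c
    using degree_sums[of n] by (cases c) (simp_all add: dg_def K_def h_def)
qed

lemma half_edges_eq: "degree_exploration.H (K n) (dg n) True = half_edges (N n) (d n)"
  "degree_exploration.H (K n) (dg n) False = com_vertices (M n) (Com n)"
  unfolding degree_exploration.H_def[OF degree_exploration]
  by (simp_all add: half_edges_def com_vertices_def K_def dg_def)

lemma matching_exploration: "matching_exploration (degree_exploration.H (K n) (dg n)) (h n)"
proof -
  interpret degree_exploration "K n" "dg n" "h n" "{}" by (rule degree_exploration)
  show ?thesis by (rule matching_exploration_axioms)
qed

lemma bijs_eq: "matching_exploration.bijs (degree_exploration.H (K n) (dg n)) = \<Omega> n"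
  unfolding matching_exploration.bijs_def[OF matching_exploration] half_edges_eq
  by (simp add: \<Omega>_def matchings_def)

lemma finite_\<Omega>: "finite (\<Omega> n)" and card_\<Omega>: "card (\<Omega> n) = fact (h n)"
  using matching_exploration.finite_bijs[OF matching_exploration] matching_exploration.card_bijs[OF matching_exploration]
  unfolding bijs_eq by auto

lemma card_\<Omega>_pos: "0 < real (card (\<Omega> n))" by (simp add: card_\<Omega>)

lemma N_le_h: "N n \<le> h n"
  using degree_exploration.K_le_h[OF degree_exploration, of n True] by (simp add: K_def)

lemma h_lim: "filterlim (\<lambda>n. real (h n)) at_top sequentially"
proof -
  have "filterlim (\<lambda>n. real (N n)) at_top sequentially"
    using N_lim filterlim_real_sequentially filterlim_compose by blast
  thus ?thesis by (rule filterlim_at_top_mono) (use N_le_h in auto)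
qed

lemma eventually_h_ge: "eventually (\<lambda>n. x \<le> real (h n)) sequentially"
  using h_lim by (simp add: filterlim_at_top)

lemma eventually_bound_le:
  fixes C \<delta> :: real assumes "\<delta> > 0" shows "eventually (\<lambda>n. C / h n \<le> \<delta>) sequentially"
  using eventually_h_ge[of "max 1 (C / \<delta>)"]
proof eventually_elim
  case (elim n)
  hence "h n > 0" "C / \<delta> \<le> h n" by (auto simp: max_def split: if_splits)
  thus ?case using assms by (simp add: field_simps)
qed

lemma fluid_sides:
  fixes \<epsilon> :: real assumes "\<epsilon> > 0"
  obtains B :: nat and \<theta> :: real where "\<theta> > 0"
    and "eventually (\<lambda>n. \<forall>c. fluid_bounds (K n c) (dg n c) (h n) (if c then Dl else Dr) B \<theta> \<epsilon>) sequentially"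
proof -
  obtain B1 \<theta>1 where 1: "(\<theta>1::real) > 0" "eventually (\<lambda>n. fluid_bounds (N n) (d n) (h n) Dl B1 \<theta>1 \<epsilon>) sequentially"
    by (rule fluid_limit[of N d Dl h \<epsilon>]) (use N_pos d_pos Dl mean_l count_l assms in \<open>auto simp: h_def\<close>)
  have ord: "1 \<le> order (Com n v)" if "v \<in> {1..M n}" for n v
    using connected_Com[OF that] by (simp add: connected_simple_graph_def)
  obtain B2 \<theta>2 where 2: "(\<theta>2::real) > 0"
      "eventually (\<lambda>n. fluid_bounds (M n) (\<lambda>a. order (Com n a)) (h n) Dr B2 \<theta>2 \<epsilon>) sequentially"
    by (rule fluid_limit[of M "\<lambda>n a. order (Com n a)" Dr h \<epsilon>])
       (use M_pos ord Dr mean_r count_r assms degree_sums in \<open>auto simp: h_def\<close>)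
  define B \<theta> where "B = max B1 B2" and "\<theta> = min \<theta>1 \<theta>2"
  have "eventually (\<lambda>n. \<forall>c. fluid_bounds (K n c) (dg n c) (h n) (if c then Dl else Dr) B \<theta> \<epsilon>) sequentially"
    using 1(2) 2(2)
  proof eventually_elim
    case (elim n)
    thus ?case using fluid_bounds_mono[of _ _ _ _ _ _ _ B \<theta>] by (auto simp: K_def dg_def B_def \<theta>_def)
  qed
  thus thesis using that[of \<theta> B] 1(1) 2(1) by (auto simp: \<theta>_def)
qed

text \<open>
  The exploration from \<open>v\<close> and \<open>w\<close> leaves almost all of the \<open>N G_D(z1)\<close> individuals expected at clock \<open>z1\<close>
  untouched, uniformly in the two starting points, for every \<open>z1\<close> below the smallest fixed point.
\<close>

lemma reach_from_two:
  fixes z1 \<epsilon> \<delta> :: real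
  assumes z1: "0 < z1" "z1 < 1" and above: "\<And>z. z \<in> {0..z1} \<Longrightarrow> z < G False (G True z)"
    and \<epsilon>: "\<epsilon> > 0" and \<delta>: "\<delta> > 0"
  shows "eventually (\<lambda>n. \<forall>v\<in>{1..N n}. \<forall>w\<in>{1..N n}.
    card {\<omega> \<in> \<Omega> n. card (conn n \<omega> `` {v, w}) > N n * (1 - pgf Dl z1 + \<epsilon>)} \<le> \<delta> * card (\<Omega> n)) sequentially"
proof -
  obtain c where c: "c > 0"
    "\<And>z y. z \<in> {z1/2..z1} \<Longrightarrow> y \<in> {0..1} \<Longrightarrow> c \<le> z * G True z - z * y \<or> c \<le> y * G False y - z * y"
    using crossing_gap[OF z1, of "tilde Dr" "tilde Dl"] above unfolding G_def by auto
  define a where "a = G True z1"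
  have a: "0 < a" "a \<le> 1" using pgf_pos[of z1 "tilde Dl"] pgf_range[of z1 "tilde Dl"] z1 by (auto simp: a_def G_def)
  (* no active individuals means y \<ge> G_l(z) up to a small error, so y cannot fall to half of G_l(z1) *)
  define y1 where "y1 = a / 2"
  define \<epsilon>0 where "\<epsilon>0 = min \<epsilon> (min c (z1 * (a / 2))) / 2"
  have za: "z1 * (a / 2) > 0" using z1 a by simp
  define m where "m = min \<epsilon> (min c (z1 * (a / 2)))"
  have "0 < m" "m \<le> \<epsilon>" "m \<le> c" "m \<le> z1 * (a / 2)" using \<epsilon> c za by (simp_all add: m_def)
  moreover have "\<epsilon>0 = m / 2" by (simp add: \<epsilon>0_def m_def)
  ultimately have \<epsilon>0: "\<epsilon>0 > 0" "\<epsilon>0 < \<epsilon>" "\<epsilon>0 < c" "\<epsilon>0 < z1 * (a/2)" by linarith+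
  obtain B \<theta> where \<theta>: "(\<theta>::real) > 0"
    "eventually (\<lambda>n. \<forall>c. fluid_bounds (K n c) (dg n c) (h n) (if c then Dl else Dr) B \<theta> \<epsilon>0) sequentially"
    using fluid_sides[OF \<epsilon>0(1)] by blast
  have e1: "eventually (\<lambda>n. 2 / (z1 * y1) \<le> real (h n)) sequentially" by (rule eventually_h_ge)
  (* half of the error \<theta> h then absorbs the two individuals missing from the initial counts *)
  have e2: "eventually (\<lambda>n. 4 / \<theta> \<le> real (h n)) sequentially" by (rule eventually_h_ge)
  have e3: "eventually (\<lambda>n. (run_bound0 / (\<theta>/2)\<^sup>2) / h n \<le> \<delta>) sequentially"
    for run_bound0 by (rule eventually_bound_le[OF \<delta>])
  from e1 e2 e3[of "degree_exploration.run_bound (min z1 y1) B"] \<theta>(2) show ?thesis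
  proof eventually_elim
    case (elim n)
    show ?case
    proof (intro ballI)
      fix v w assume vw: "v \<in> {1..N n}" "w \<in> {1..N n}"
      interpret degree_exploration "K n" "dg n" "h n" "{v, w}" by (rule degree_exploration)
      interpret community_graph "N n" "M n" "d n" "Com n" by (rule community_graph)
      have unt: "card (untouched c k s) = degree_count (K n c) (dg n c) (touched c s) k" for c k s
        by (simp add: untouched_def degree_count_def)
      have initial: "degree_count (K n c) (dg n c) {} k \<le> card (untouched c k []) + 2" for c k
      proof -
        have "{u \<in> {1..K n c}. dg n c u = k \<and> u \<notin> {}} \<subseteq> untouched c k [] \<union> {v, w}"
          by (auto simp: untouched_def touched_def)
        hence "degree_count (K n c) (dg n c) {} k \<le> card (untouched c k [] \<union> {v, w})"
          unfolding degree_count_def by (intro card_mono) auto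
        also have "\<dots> \<le> card (untouched c k []) + card {v, w}" by (rule card_Un_le)
        also have "card {v, w} \<le> 2" by (simp add: card_insert_if)
        finally show ?thesis by simp
      qed
      let ?bad = "{\<omega> \<in> bijs. \<not> (\<exists>T. {v, w} \<subseteq> T \<and> union_of_components \<omega> T \<and>
            K n True * (pgf Dl z1 - \<epsilon>0) \<le> card ({1..K n True} - T))}"
      have "card ?bad \<le> run_bound (min z1 y1) B / ((\<theta>/2)\<^sup>2 * h n) * card bijs"
      proof (rule exploration_from_set[where G = G])
        show "{v, w} \<subseteq> {1..K n True}" using vw by (simp add: K_def)
        show "0 < z1" "z1 < 1" "0 < y1" "y1 < 1" "0 < \<theta>/2" using z1 a \<theta> by (auto simp: y1_def)
        show "2 \<le> h n * (z1 * y1)" using elim(1) z1 a by (simp add: y1_def field_simps)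
        show "pgf Dl z1 \<le> pgf Dl z" if "z \<in> {z1..1}" for z using that z1 by (intro pgf_mono) auto
      next
        fix z y :: real assume "z \<in> {z1/2..z1}" "y \<in> {0..1}"
        from c(2)[OF this] show "z * y < z * G True z - \<epsilon>0 \<or> z * y < y * G False y - \<epsilon>0"
          using \<epsilon>0 by auto
      next
        fix z y :: real assume zy: "z \<in> {z1..1}" "y \<in> {0..y1}"
        have "a \<le> G True z" unfolding a_def G_def using zy z1 by (intro pgf_mono) auto
        hence "a / 2 \<le> G True z - y" using zy by (simp add: y1_def)
        hence "z1 * (a / 2) \<le> z * (G True z - y)" using zy z1 a by (intro mult_mono) auto
        thus "z * y < z * G True z - \<epsilon>0" using \<epsilon>0 by (simp add: algebra_simps)
      next
        fix s assume s: "valid s" and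
          lo: "\<And>c k. k \<in> {1..B} \<Longrightarrow> card (untouched c k []) * clock c s ^ k - \<theta>/2 * h n \<le> card (untouched c k s)"
        have cl: "clock c s \<in> {0..1}" for c using clock_bounds[OF length_valid[OF s]] by auto
        have lo': "\<forall>k\<in>{1..B}. -1 * (degree_count (K n c) (dg n c) (touched c s) k
            - degree_count (K n c) (dg n c) {} k * clock c s ^ k) \<le> \<theta> * h n" for c
        proof
          fix k assume k: "k \<in> {1..B}"
          have "real (degree_count (K n c) (dg n c) {} k) * clock c s ^ k \<le> (card (untouched c k []) + 2) * clock c s ^ k"
            using initial[of c k] cl[of c] by (intro mult_right_mono) auto
          also have "\<dots> \<le> card (untouched c k []) * clock c s ^ k + 2"
            using cl[of c] by (simp add: algebra_simps power_le_one)
          finally have "degree_count (K n c) (dg n c) {} k * clock c s ^ k \<le> card (untouched c k []) * clock c s ^ k + 2" .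
          moreover have "2 \<le> \<theta>/2 * h n" using elim(2) \<theta> by (simp add: field_simps)
          moreover have "card (untouched c k []) * clock c s ^ k - \<theta>/2 * h n \<le> degree_count (K n c) (dg n c) (touched c s) k"
            using lo[OF k, of c] unfolding unt .
          ultimately show "-1 * (degree_count (K n c) (dg n c) (touched c s) k
            - degree_count (K n c) (dg n c) {} k * clock c s ^ k) \<le> \<theta> * h n"
            unfolding unt by simp
        qed
        have F: "fluid_bounds (K n c) (dg n c) (h n) (if c then Dl else Dr) B \<theta> \<epsilon>0" for c
          using elim(4) by blast
        note FF = F[unfolded fluid_bounds_def, THEN spec, THEN bspec, THEN bspec, OF _ cl, THEN mp, of "-1", OF _ lo']
        show "(\<forall>c. h n * (clock c s * G c (clock c s) - \<epsilon>0) \<le> asleep c s) \<and>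
            K n True * (pgf Dl (clock True s) - \<epsilon>0) \<le> card ({1..K n True} - touched True s)"
          using FF FF[of True] unfolding G_def asleep_def by (simp add: algebra_simps)
      qed
      also have "\<dots> \<le> \<delta> * card bijs" using elim(3) by (intro mult_right_mono) (simp_all add: field_simps)
      finally have bad: "card ?bad \<le> \<delta> * card (\<Omega> n)" unfolding bijs_eq .
      have "{\<omega> \<in> \<Omega> n. card (conn n \<omega> `` {v, w}) > N n * (1 - pgf Dl z1 + \<epsilon>)} \<subseteq> ?bad"
      proof
        fix \<omega> assume \<omega>: "\<omega> \<in> {\<omega> \<in> \<Omega> n. card (conn n \<omega> `` {v, w}) > N n * (1 - pgf Dl z1 + \<epsilon>)}"
        hence b: "\<omega> \<in> bijs" by (simp add: bijs_eq)
        have False if vwT: "{v, w} \<subseteq> T" and union: "union_of_components \<omega> T"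
            and size: "K n True * (pgf Dl z1 - \<epsilon>0) \<le> card ({1..K n True} - T)" for T
        proof -
          note T = vwT union[unfolded union_of_components_def, THEN conjunct1]
            union[unfolded union_of_components_def, THEN conjunct2] size
          have "conn n \<omega> `` {u} \<subseteq> T" if "u \<in> T" for u
            unfolding conn_def
          proof (rule joined_closed[OF _ that])
            fix x y assume "x \<in> half_edges (N n) (d n)" "y \<in> half_edges (N n) (d n)" "fst (\<omega> x) = fst (\<omega> y)" "fst x \<in> T"
            thus "fst y \<in> T" using T(3) unfolding half_edges_eq by blast
          qed
          from this[of v] this[of w] have "conn n \<omega> `` {v, w} \<subseteq> T" using T(1) by auto
          hence "card (conn n \<omega> `` {v, w}) \<le> card T" using T(2) by (intro card_mono) (auto intro: finite_subset)
          moreover have "card T \<le> K n True" using card_mono[OF _ T(2)] by simp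
          moreover have "card ({1..K n True} - T) = K n True - card T"
            using T(2) finite_subset[OF T(2)] by (simp add: card_Diff_subset)
          ultimately have "card (conn n \<omega> `` {v, w}) \<le> N n * (1 - pgf Dl z1 + \<epsilon>0)"
            using T(4) by (simp add: K_def of_nat_diff algebra_simps)
          also have "\<dots> \<le> N n * (1 - pgf Dl z1 + \<epsilon>)" using \<epsilon>0 by (intro mult_left_mono) auto
          finally show False using \<omega> by simp
        qed
        note escape = this
        show "\<omega> \<in> ?bad"
        proof (intro CollectI conjI notI)
          show "\<omega> \<in> bijs" by (rule b)
        qed (elim exE conjE, erule (2) escape)
      qed
      hence "card {\<omega> \<in> \<Omega> n. card (conn n \<omega> `` {v, w}) > N n * (1 - pgf Dl z1 + \<epsilon>)} \<le> card ?bad"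
        by (rule card_mono[rotated]) (rule finite_subset[OF _ finite_bijs], rule Collect_restrict)
      thus "card {\<omega> \<in> \<Omega> n. card (conn n \<omega> `` {v, w}) > N n * (1 - pgf Dl z1 + \<epsilon>)} \<le> \<delta> * card (\<Omega> n)"
        using bad by linarith
    qed
  qed
qed

text \<open>
  Where \<open>f(z) < z\<close> holds from \<open>z2\<close> up to \<open>1\<close>, the exploration by components finds a component that
  takes the clock down to \<open>z2\<close>. The group clock is kept above half of \<open>G_l(z2)\<close>, which suffices because
  \<open>G_r(G_l(z2)) < z2\<close>.
\<close>

lemma large_component:
  fixes z2 \<epsilon> \<delta> :: real
  assumes z2: "0 < z2" "z2 < 1" and below: "\<And>z. z \<in> {z2..<1} \<Longrightarrow> G False (G True z) < z"
    and \<epsilon>: "\<epsilon> > 0" and \<delta>: "\<delta> > 0"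
  shows "eventually (\<lambda>n. card {\<omega> \<in> \<Omega> n. \<forall>C \<in> {1..N n} // conn n \<omega>. card C < N n * (1 - pgf Dl z2 - \<epsilon>)}
     \<le> \<delta> * card (\<Omega> n)) sequentially"
proof -
  (* the value of the group clock at which the individuals would run out at z2 *)
  define y0 where "y0 = G True z2"
  have f2: "G False y0 < z2" using below[of z2] z2 by (simp add: y0_def)
  have y01: "y0 \<in> {0..1}" "0 < y0" using pgf_range[of z2 "tilde Dl"] pgf_pos[of z2 "tilde Dl"] z2
    by (auto simp: y0_def G_def)
  have y0: "0 < y0" "y0 < 1"
    using y01 f2 z2 by (auto simp: G_def less_le)
  define \<kappa> where "\<kappa> = mean Dl + 1"
  have \<kappa>: "\<kappa> > 0" using pmf_tilde(1)[OF Dl] by (simp add: \<kappa>_def)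
  (* eventually h \<le> \<kappa> N, so the steps made before the last waking cost at most N \<epsilon>/2 *)
  define \<rho> where "\<rho> = min (1/2) (\<epsilon> / (4 * \<kappa>))"
  have \<rho>: "0 < \<rho>" "\<rho> < 1" "\<rho> * (4 * \<kappa>) \<le> \<epsilon>" using \<epsilon> \<kappa> by (auto simp: \<rho>_def min_def field_simps)
  obtain c where c: "c > 0"
    "\<And>z y. z \<in> {z2..1} \<Longrightarrow> y \<in> {y0/2..1} \<Longrightarrow> \<not> (y > 1 - \<rho> \<and> z > 1 - \<rho>) \<Longrightarrow>
           c \<le> z * y - z * G True z \<or> c \<le> z * y - y * G False y"
    using survival_gap[OF z2, of "y0/2" \<rho> "tilde Dr" "tilde Dl"] y0 \<rho> below unfolding G_def by auto
  define b where "b = y0/2 * (z2 - G False y0)"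
  have b: "b > 0" using y0 f2 by (simp add: b_def)
  define \<epsilon>0 where "\<epsilon>0 = min (\<epsilon>/2) (min c b) / 2"
  have \<epsilon>0: "\<epsilon>0 > 0" "\<epsilon>0 < \<epsilon>/2" "\<epsilon>0 < c" "\<epsilon>0 < b" using \<epsilon> c b by (auto simp: \<epsilon>0_def min_def)
  obtain B \<theta> where \<theta>: "(\<theta>::real) > 0"
    "eventually (\<lambda>n. \<forall>c. fluid_bounds (K n c) (dg n c) (h n) (if c then Dl else Dr) B \<theta> \<epsilon>0) sequentially"
    using fluid_sides[OF \<epsilon>0(1)] by blast
  have e1: "eventually (\<lambda>n. 2 / (z2 * (y0/2)) \<le> real (h n)) sequentially" by (rule eventually_h_ge)
  have e2: "eventually (\<lambda>n. real (h n) / real (N n) < \<kappa>) sequentially"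
    using order_tendstoD(2)[OF mean_l, of \<kappa>] by (simp add: \<kappa>_def h_def)
  have e3: "eventually (\<lambda>n. (run_bound0 / \<theta>\<^sup>2) / h n \<le> \<delta>) sequentially"
    for run_bound0 by (rule eventually_bound_le[OF \<delta>])
  from e1 e2 e3[of "degree_exploration.run_bound (min z2 (y0/2)) B"] \<theta>(2) show ?thesis
  proof eventually_elim
    case (elim n)
    interpret degree_exploration "K n" "dg n" "h n" "{}" by (rule degree_exploration)
    interpret community_graph "N n" "M n" "d n" "Com n" by (rule community_graph)
    have unt: "card (untouched c k s) = degree_count (K n c) (dg n c) (touched c s) k" for c k s
      by (simp add: untouched_def degree_count_def)
    have t0: "touched c [] = {}" for c by (simp add: touched_def)
    let ?bad = "{\<omega> \<in> bijs. \<not> (\<forall>R. joins_communities \<omega> R \<longrightarrow> (\<exists>v0 S. S \<subseteq> {1..K n True} \<and> (\<forall>v\<in>S. (v0, v) \<in> R) \<and>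
               K n True * (1 - pgf Dl z2 - \<epsilon>0) - 2 * \<rho> * h n \<le> card S))}"
    have "card ?bad \<le> run_bound (min z2 (y0/2)) B / (\<theta>\<^sup>2 * h n) * card bijs"
    proof (rule exploration_by_components[where G = G])
      show "0 < z2" "z2 < 1" "0 < y0" "y0 < 1" "0 < \<theta>" "0 < \<rho>" "\<rho> < 1" using z2 y0 \<theta> \<rho> by auto
      show "2 \<le> h n * (z2 * (y0/2))" using elim(1) z2 y0 by (simp add: field_simps)
      show "pgf Dl z \<le> pgf Dl z2" if "z \<in> {0..z2}" for z using that z2 by (intro pgf_mono) auto
    next
      fix z y :: real assume "z \<in> {z2..1}" "y \<in> {y0/2..1}" "\<not> (y > 1 - \<rho> \<and> z > 1 - \<rho>)"
      from c(2)[OF this] show "z * y > z * G True z + \<epsilon>0 \<or> z * y > y * G False y + \<epsilon>0"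
        using \<epsilon>0 by auto
    next
      fix z y :: real assume zy: "z \<in> {z2..1}" "y \<in> {y0/2..y0}"
      have "G False y \<le> G False y0" unfolding G_def using zy y0 by (intro pgf_mono) auto
      hence "z2 - G False y0 \<le> z - G False y" using zy by simp
      hence "b \<le> y * (z - G False y)" unfolding b_def using zy y0 f2 by (intro mult_mono) auto
      thus "z * y > y * G False y + \<epsilon>0" using \<epsilon>0 by (simp add: algebra_simps)
    next
      fix s assume s: "valid s" and
        up: "\<And>c k. k \<in> {1..B} \<Longrightarrow> card (untouched c k s) \<le> card (untouched c k []) * clock c s ^ k + \<theta> * h n"
      have cl: "clock c s \<in> {0..1}" for c using clock_bounds[OF length_valid[OF s]] by auto
      have up': "\<forall>k\<in>{1..B}. 1 * (degree_count (K n c) (dg n c) (touched c s) k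
          - degree_count (K n c) (dg n c) {} k * clock c s ^ k) \<le> \<theta> * h n" for c
        using up[of _ c] unfolding unt t0 by (simp add: algebra_simps)
      have F: "fluid_bounds (K n c) (dg n c) (h n) (if c then Dl else Dr) B \<theta> \<epsilon>0" for c
        using elim(4) by blast
      note FF = F[unfolded fluid_bounds_def, THEN spec, THEN bspec, THEN bspec, OF _ cl, THEN mp, of 1, OF _ up']
      show "(\<forall>c. asleep c s \<le> h n * (clock c s * G c (clock c s) + \<epsilon>0)) \<and>
          card ({1..K n True} - touched True s) \<le> K n True * (pgf Dl (clock True s) + \<epsilon>0)"
        using FF FF[of True] unfolding G_def asleep_def by (simp add: algebra_simps)
    qed simp
    also have "\<dots> \<le> \<delta> * card bijs" using elim(3) by (intro mult_right_mono) (simp_all add: field_simps)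
    finally have bad: "card ?bad \<le> \<delta> * card (\<Omega> n)" unfolding bijs_eq .
    have "{\<omega> \<in> \<Omega> n. \<forall>C \<in> {1..N n} // conn n \<omega>. card C < N n * (1 - pgf Dl z2 - \<epsilon>)} \<subseteq> ?bad"
    proof
      fix \<omega> assume \<omega>: "\<omega> \<in> {\<omega> \<in> \<Omega> n. \<forall>C \<in> {1..N n} // conn n \<omega>. card C < N n * (1 - pgf Dl z2 - \<epsilon>)}"
      hence b: "\<omega> \<in> bijs" and m: "\<omega> \<in> matchings (N n) (M n) (d n) (Com n)" by (auto simp: bijs_eq \<Omega>_def)
      let ?R = "conn n \<omega>"
      have eq: "equiv {1..N n} ?R" unfolding conn_def by (rule equiv_joined)
      have same: "\<forall>x\<in>H True. \<forall>y\<in>H True. fst (\<omega> x) = fst (\<omega> y) \<longrightarrow> (fst x, fst y) \<in> ?R"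
        unfolding conn_def half_edges_eq using joined_if_same_community[OF m] by blast
      have False if S: "S \<subseteq> {1..K n True}" "\<forall>v\<in>S. (v0, v) \<in> ?R"
          "K n True * (1 - pgf Dl z2 - \<epsilon>0) - 2 * \<rho> * h n \<le> card S" for v0 S
      proof -
        define C where "C = (if S = {} then ?R `` {1} else ?R `` {v0})"
        have "1 \<in> {1..N n}" using N_pos[of n] by simp
        moreover have "v0 \<in> {1..N n}" if "S \<noteq> {}" using S(2) that eq equiv_type[OF eq] by blast
        ultimately have C: "C \<in> {1..N n} // ?R" 
          unfolding C_def by (cases "S = {}") (auto simp del: atLeastAtMost_iff intro: quotientI)
        have "C \<subseteq> {1..N n}" using C eq by (meson in_quotient_imp_subset)
        hence "finite C" by (rule finite_subset) simp
        moreover have "S \<subseteq> C" using S(2) by (auto simp: C_def)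
        ultimately have "real (card S) \<le> real (card C)" by (simp add: card_mono)
        moreover have "2 * \<rho> * h n \<le> N n * (\<epsilon> / 2)"
        proof -
          have "h n \<le> \<kappa> * N n" using elim(2) N_pos[of n] by (simp add: field_simps)
          hence "2 * \<rho> * h n \<le> 2 * \<rho> * (\<kappa> * N n)" using \<rho> by (intro mult_left_mono) auto
          also have "\<dots> = N n * (\<rho> * (4 * \<kappa>) / 2)" by simp
          also have "\<dots> \<le> N n * (\<epsilon> / 2)" using \<rho>(3) by (intro mult_left_mono divide_right_mono) auto
          finally show ?thesis .
        qed
        moreover have "N n * \<epsilon>0 \<le> N n * (\<epsilon> / 2)" using \<epsilon>0 by (intro mult_left_mono) auto
        moreover have "N n * (1 - pgf Dl z2 - \<epsilon>0) = N n * (1 - pgf Dl z2 - \<epsilon>) + N n * (\<epsilon>/2) + N n * (\<epsilon>/2) - N n * \<epsilon>0"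
          by (simp add: algebra_simps)
        ultimately have "N n * (1 - pgf Dl z2 - \<epsilon>) \<le> card C" using S(3) unfolding K_def if_True by linarith
        thus False using \<omega> C by fastforce
      qed
      moreover have "trans ?R" "refl_on {1..K n True} ?R" using eq by (auto simp: equiv_def K_def)
      hence "joins_communities \<omega> ?R" using same by (simp add: joins_communities_def)
      ultimately show "\<omega> \<in> ?bad" using b by blast
    qed
    hence "card {\<omega> \<in> \<Omega> n. \<forall>C \<in> {1..N n} // conn n \<omega>. card C < N n * (1 - pgf Dl z2 - \<epsilon>)} \<le> card ?bad"
      by (intro card_mono) (simp_all add: finite_bijs)
    thus ?case using bad by linarith
  qed
qed

end

section \<open>From two individuals to the largest components\<close>

context rigc_sequence
begin

lemma conn_Image_subset: "conn n \<omega> `` S \<subseteq> {1..N n}"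
  by (auto simp: conn_def joined_def connectivity_def)

text \<open>
  Double counting of pairs of individuals. It turns a bound that is uniform in fixed starting points
  into one about components that depend on the matching, at the price of the squared density \<open>\<tau>\<close>.
\<close>

lemma many_pairs:
  fixes \<tau> \<delta> t :: real
  assumes A: "A \<subseteq> \<Omega> n" and \<tau>: "\<tau> > 0"
    and big: "\<And>\<omega>. \<omega> \<in> A \<Longrightarrow> \<exists>X Y. X \<subseteq> {1..N n} \<and> Y \<subseteq> {1..N n} \<and> \<tau> * N n \<le> card X \<and> \<tau> * N n \<le> card Y \<and>
       (\<forall>v\<in>X. \<forall>w\<in>Y. t < card (conn n \<omega> `` {v, w}))"
    and rare: "\<And>v w. v \<in> {1..N n} \<Longrightarrow> w \<in> {1..N n} \<Longrightarrow>
       card {\<omega> \<in> \<Omega> n. t < card (conn n \<omega> `` {v, w})} \<le> \<delta> * card (\<Omega> n)"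
  shows "card A * \<tau>\<^sup>2 \<le> \<delta> * card (\<Omega> n)"
proof -
  define P where "P = {1..N n} \<times> {1..N n}"
  define Q where "Q \<omega> p \<longleftrightarrow> t < card (conn n \<omega> `` {fst p, snd p})" for \<omega> p
  have fA: "finite A" using A finite_\<Omega> finite_subset by blast
  have fP: "finite P" by (simp add: P_def)
  have "card A * (\<tau> * N n)\<^sup>2 = (\<Sum>\<omega>\<in>A. (\<tau> * N n)\<^sup>2)" by simp
  also have "\<dots> \<le> (\<Sum>\<omega>\<in>A. real (card {p \<in> P. Q \<omega> p}))"
  proof (rule sum_mono)
    fix \<omega> assume "\<omega> \<in> A"
    from big[OF this] obtain X Y where XY: "X \<subseteq> {1..N n}" "Y \<subseteq> {1..N n}" "\<tau> * N n \<le> card X" "\<tau> * N n \<le> card Y"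
       "\<forall>v\<in>X. \<forall>w\<in>Y. t < card (conn n \<omega> `` {v, w})"
      by (elim exE conjE) (rule that; assumption)
    have "(\<tau> * N n)\<^sup>2 \<le> real (card X) * real (card Y)"
      unfolding power2_eq_square using XY \<tau> by (intro mult_mono) auto
    also have "\<dots> = real (card (X \<times> Y))" by (simp add: card_cartesian_product)
    also have "card (X \<times> Y) \<le> card {p \<in> P. Q \<omega> p}"
      using XY fP by (intro card_mono) (auto simp: P_def Q_def)
    finally show "(\<tau> * N n)\<^sup>2 \<le> real (card {p \<in> P. Q \<omega> p})" by simp
  qed
  also have "\<dots> = (\<Sum>\<omega>\<in>A. \<Sum>p\<in>P. of_bool (Q \<omega> p))"
    using fP by (simp add: Int_def)
  also have "\<dots> = (\<Sum>p\<in>P. \<Sum>\<omega>\<in>A. of_bool (Q \<omega> p))" by (rule sum.swap)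
  also have "\<dots> = (\<Sum>p\<in>P. real (card {\<omega> \<in> A. Q \<omega> p}))"
    using fA by (simp add: Int_def)
  also have "\<dots> \<le> (\<Sum>p\<in>P. \<delta> * card (\<Omega> n))"
  proof (rule sum_mono)
    fix p assume p: "p \<in> P"
    have "card {\<omega> \<in> A. Q \<omega> p} \<le> card {\<omega> \<in> \<Omega> n. Q \<omega> p}"
      using A finite_\<Omega>[of n] by (intro card_mono) auto
    also have "real \<dots> \<le> \<delta> * card (\<Omega> n)"
      using rare[of "fst p" "snd p"] p by (auto simp: P_def Q_def)
    finally show "real (card {\<omega> \<in> A. Q \<omega> p}) \<le> \<delta> * card (\<Omega> n)" by simp
  qed
  also have "\<dots> = (N n)\<^sup>2 * (\<delta> * card (\<Omega> n))"
    by (simp add: P_def card_cartesian_product power2_eq_square)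
  finally have "(N n)\<^sup>2 * (card A * \<tau>\<^sup>2) \<le> (N n)\<^sup>2 * (\<delta> * card (\<Omega> n))"
    by (simp add: power_mult_distrib algebra_simps)
  thus ?thesis using N_pos[of n] by (simp add: mult_le_cancel_left)
qed

lemma conv_in_probabilityI:
  fixes X :: "nat \<Rightarrow> matching \<Rightarrow> real"
  assumes "\<And>\<epsilon> \<delta> :: real. \<epsilon> > 0 \<Longrightarrow> \<delta> > 0 \<Longrightarrow>
     eventually (\<lambda>n. card {\<omega> \<in> \<Omega> n. \<bar>X n \<omega> - c\<bar> > \<epsilon>} \<le> \<delta> * card (\<Omega> n)) sequentially"
  shows "conv_in_probability (\<lambda>n. random_matching (N n) (M n) (d n) (Com n)) X c"
  unfolding conv_in_probability_def
proof (intro allI impI)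
  fix \<epsilon> :: real assume \<epsilon>: "\<epsilon> > 0"
  let ?p = "\<lambda>n. measure_pmf.prob (random_matching (N n) (M n) (d n) (Com n)) {\<omega>. \<bar>X n \<omega> - c\<bar> > \<epsilon>}"
  let ?k = "\<lambda>n. card {\<omega> \<in> \<Omega> n. \<bar>X n \<omega> - c\<bar> > \<epsilon>}"
  have prob: "?p n
      = ?k n / card (\<Omega> n)" for n
  proof -
    have "\<Omega> n \<noteq> {}" using card_\<Omega>_pos[of n] by auto
    thus ?thesis unfolding random_matching_def \<Omega>_def[symmetric]
      by (subst measure_pmf_of_set) (auto simp: finite_\<Omega> Int_def)
  qed
  show "(\<lambda>n. ?p n) \<longlonglongrightarrow> 0"
  proof (rule tendstoI)
    fix e :: real assume e: "e > 0"
    have "eventually (\<lambda>n. ?k n \<le> e / 2 * card (\<Omega> n)) sequentially"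
      using assms[OF \<epsilon>, of "e / 2"] e by simp
    thus "eventually (\<lambda>n. dist (?p n) 0 < e) sequentially"
    proof eventually_elim
      case (elim n)
      have "?k n / card (\<Omega> n) \<le> e / 2"
        using elim card_\<Omega>_pos[of n] by (simp add: pos_divide_le_eq)
      hence "?k n / card (\<Omega> n) < e" using e by linarith
      thus ?case unfolding prob dist_real_def by simp
    qed
  qed
qed

lemma pgf_Dl_le: "z \<in> {0..1} \<Longrightarrow> pgf Dl z \<le> z"
proof -
  assume z: "z \<in> {0..1}"
  have "pgf Dl z \<le> measure_pmf.expectation Dl (\<lambda>_. z)"
    unfolding pgf_def using z Dl(2)
    by (intro integral_mono_AE integrable_pgf) (auto simp: AE_measure_pmf_iff intro!: power_le_one_iff[THEN iffD2] power_decreasing[of 1, simplified] gr0I Suc_leI)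
  thus ?thesis by simp
qed

lemma pgf_Dl_close:
  fixes \<epsilon> :: real
  assumes "\<eta> \<in> {0..1}" "\<epsilon> > 0"
  obtains r where "r > 0" "\<And>x. x \<in> {0..1} \<Longrightarrow> \<bar>x - \<eta>\<bar> < r \<Longrightarrow> \<bar>pgf Dl x - pgf Dl \<eta>\<bar> < \<epsilon>"
  using continuous_on_pgf[of Dl] assms unfolding continuous_on_iff dist_real_def by metis

context
  fixes \<eta> :: real
  assumes \<eta>: "\<eta> \<in> {0..1}" "G False (G True \<eta>) = \<eta>"
    and above: "\<And>x. x \<in> {0..<\<eta>} \<Longrightarrow> x < G False (G True x)"
begin

text \<open>For \<open>\<eta> = 0\<close> the limit is the whole graph; otherwise approach \<open>\<eta>\<close> from below.\<close>

lemma rare_large_pairs: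
  fixes \<epsilon> \<delta> :: real
  assumes \<epsilon>: "\<epsilon> > 0" and \<delta>: "\<delta> > 0"
  shows "eventually (\<lambda>n. \<forall>v\<in>{1..N n}. \<forall>w\<in>{1..N n}.
    card {\<omega> \<in> \<Omega> n. card (conn n \<omega> `` {v, w}) > N n * (1 - pgf Dl \<eta> + \<epsilon>)} \<le> \<delta> * card (\<Omega> n)) sequentially"
proof (cases "\<eta> = 0")
  case True
  have "pgf Dl \<eta> \<le> 0" using pgf_Dl_le[OF \<eta>(1)] True by simp
  hence "real (N n) * 1 \<le> N n * (1 - pgf Dl \<eta> + \<epsilon>)" for n using \<epsilon> by (intro mult_left_mono) auto
  moreover have "card (conn n \<omega> `` S) \<le> N n" for n \<omega> S
    using card_mono[OF _ conn_Image_subset[of n \<omega> S]] by simp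
  ultimately have none: "{\<omega> \<in> \<Omega> n. card (conn n \<omega> `` {v, w}) > N n * (1 - pgf Dl \<eta> + \<epsilon>)} = {}" for n v w
    by (auto simp: not_less intro: order_trans[of _ "real (N n)"])
  show ?thesis unfolding none using \<delta> by simp
next
  case False
  hence \<eta>0: "0 < \<eta>" "\<eta> \<le> 1" using \<eta>(1) by auto
  obtain r where r: "r > 0" "\<And>x. x \<in> {0..1} \<Longrightarrow> \<bar>x - \<eta>\<bar> < r \<Longrightarrow> \<bar>pgf Dl x - pgf Dl \<eta>\<bar> < \<epsilon>/2"
    using pgf_Dl_close[OF \<eta>(1), of "\<epsilon>/2"] \<epsilon> by auto
  define z1 where "z1 = max (\<eta>/2) (\<eta> - r/2)"
  have z1: "0 < z1" "z1 < \<eta>" "z1 < 1" "\<bar>z1 - \<eta>\<bar> < r" using \<eta>0 r(1) by (auto simp: z1_def max_def)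
  have close: "\<bar>pgf Dl z1 - pgf Dl \<eta>\<bar> < \<epsilon>/2" using z1 by (intro r(2)) auto
  have "z < G False (G True z)" if "z \<in> {0..z1}" for z using that z1 by (intro above) auto
  from reach_from_two[OF z1(1,3) this, of "\<epsilon>/2" \<delta>] \<epsilon> \<delta>
  have "eventually (\<lambda>n. \<forall>v\<in>{1..N n}. \<forall>w\<in>{1..N n}.
    card {\<omega> \<in> \<Omega> n. card (conn n \<omega> `` {v, w}) > N n * (1 - pgf Dl z1 + \<epsilon>/2)} \<le> \<delta> * card (\<Omega> n)) sequentially"
    by simp
  thus ?thesis
  proof eventually_elim
    case (elim n)
    have "N n * (1 - pgf Dl z1 + \<epsilon>/2) \<le> N n * (1 - pgf Dl \<eta> + \<epsilon>)"
      using close by (intro mult_left_mono) (linarith, simp)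
    hence "card {\<omega> \<in> \<Omega> n. card (conn n \<omega> `` {v, w}) > N n * (1 - pgf Dl \<eta> + \<epsilon>)}
        \<le> card {\<omega> \<in> \<Omega> n. card (conn n \<omega> `` {v, w}) > N n * (1 - pgf Dl z1 + \<epsilon>/2)}" for v w
      using finite_\<Omega>[of n] by (intro card_mono) auto
    thus ?case using elim by (meson of_nat_mono order_trans)
  qed
qed

lemma large_component_exists:
  fixes \<epsilon> \<delta> :: real
  assumes super: "ext_mean (tilde Dl) * ext_mean (tilde Dr) > 1" and \<epsilon>: "\<epsilon> > 0" and \<delta>: "\<delta> > 0"
  shows "eventually (\<lambda>n. card {\<omega> \<in> \<Omega> n. \<forall>C \<in> {1..N n} // conn n \<omega>. card C < N n * (1 - pgf Dl \<eta> - \<epsilon>)}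
     \<le> \<delta> * card (\<Omega> n)) sequentially"
proof (cases "\<eta> = 1")
  case True
  have "{\<omega> \<in> \<Omega> n. \<forall>C \<in> {1..N n} // conn n \<omega>. card C < N n * (1 - pgf Dl \<eta> - \<epsilon>)} = {}" for n
  proof -
    have "N n * (1 - pgf Dl \<eta> - \<epsilon>) \<le> 0" using True \<epsilon> by simp
    moreover have "{1..N n} // conn n \<omega> \<noteq> {}" for \<omega>
      using N_pos[of n] by (auto simp: quotient_def)
    ultimately show ?thesis by (fastforce simp: not_less)
  qed
  note none = this
  show ?thesis unfolding none using \<delta> by simp
next
  case False
  hence \<eta>1: "0 \<le> \<eta>" "\<eta> < 1" using \<eta>(1) by auto
  obtain r where r: "r > 0" "\<And>x. x \<in> {0..1} \<Longrightarrow> \<bar>x - \<eta>\<bar> < r \<Longrightarrow> \<bar>pgf Dl x - pgf Dl \<eta>\<bar> < \<epsilon>/2"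
    using pgf_Dl_close[OF \<eta>(1), of "\<epsilon>/2"] \<epsilon> by auto
  define z2 where "z2 = min ((\<eta> + 1)/2) (\<eta> + r/2)"
  have z2: "\<eta> < z2" "0 < z2" "z2 < 1" "\<bar>z2 - \<eta>\<bar> < r" using \<eta>1 r(1) by (auto simp: z2_def min_def)
  have close: "\<bar>pgf Dl z2 - pgf Dl \<eta>\<bar> < \<epsilon>/2" using z2 by (intro r(2)) auto
  have "G False (G True z) < z" if "z \<in> {z2..<1}" for z
    using supercritical_below[OF super \<eta>(1), of z] \<eta>(2) that z2 by (simp add: G_def)
  from large_component[OF z2(2,3) this, of "\<epsilon>/2" \<delta>] \<epsilon> \<delta>
  have "eventually (\<lambda>n. card {\<omega> \<in> \<Omega> n. \<forall>C \<in> {1..N n} // conn n \<omega>. card C < N n * (1 - pgf Dl z2 - \<epsilon>/2)}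
     \<le> \<delta> * card (\<Omega> n)) sequentially" by simp
  thus ?thesis
  proof eventually_elim
    case (elim n)
    have "N n * (1 - pgf Dl \<eta> - \<epsilon>) \<le> N n * (1 - pgf Dl z2 - \<epsilon>/2)"
      using close by (intro mult_left_mono) (linarith, simp)
    hence "card {\<omega> \<in> \<Omega> n. \<forall>C \<in> {1..N n} // conn n \<omega>. card C < N n * (1 - pgf Dl \<eta> - \<epsilon>)}
        \<le> card {\<omega> \<in> \<Omega> n. \<forall>C \<in> {1..N n} // conn n \<omega>. card C < N n * (1 - pgf Dl z2 - \<epsilon>/2)}"
      using finite_\<Omega>[of n] by (intro card_mono) fastforce+
    thus ?case using elim by linarith
  qed
qed

context
  fixes C1 C2 :: "nat \<Rightarrow> matching \<Rightarrow> nat set"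
  assumes largest: "\<And>n \<omega>. \<omega> \<in> \<Omega> n \<Longrightarrow>
    two_largest_components (RIGC (N n) (M n) (d n) (Com n) \<omega>) (C1 n \<omega>) (C2 n \<omega>)"
begin

lemma equiv_conn: "equiv {1..N n} (conn n \<omega>)"
  unfolding conn_def by (rule community_graph.equiv_joined[OF community_graph])

lemma largest_props:
  assumes "\<omega> \<in> \<Omega> n"
  shows "C1 n \<omega> \<in> {1..N n} // conn n \<omega>"
    and "\<And>C. C \<in> {1..N n} // conn n \<omega> \<Longrightarrow> card C \<le> card (C1 n \<omega>)"
    and "C2 n \<omega> = {} \<or> (C2 n \<omega> \<in> {1..N n} // conn n \<omega> \<and> C2 n \<omega> \<noteq> C1 n \<omega>)"
  using largest[OF assms] unfolding two_largest_components_def components_joined conn_def[symmetric]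
  by (auto split: if_splits)

lemma component_subset: "C \<in> {1..N n} // conn n \<omega> \<Longrightarrow> C \<subseteq> {1..N n}"
  using equiv_conn in_quotient_imp_subset by blast

lemma component_Image:
  assumes "C \<in> {1..N n} // conn n \<omega>" "v \<in> C" shows "conn n \<omega> `` {v} = C"
  using assms equiv_conn[of n \<omega>] by (metis Image_singleton_iff equiv_class_eq quotientE)

lemma rare_large_C1:
  fixes \<epsilon> \<delta> :: real
  assumes \<epsilon>: "\<epsilon> > 0" and \<delta>: "\<delta> > 0"
  shows "eventually (\<lambda>n. card {\<omega> \<in> \<Omega> n. card (C1 n \<omega>) > N n * (1 - pgf Dl \<eta> + \<epsilon>)} \<le> \<delta> * card (\<Omega> n)) sequentially"
proof -
  have "eventually (\<lambda>n. \<forall>v\<in>{1..N n}. \<forall>w\<in>{1..N n}.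
    card {\<omega> \<in> \<Omega> n. card (conn n \<omega> `` {v, w}) > N n * (1 - pgf Dl \<eta> + \<epsilon>)} \<le> (\<delta> * \<epsilon>\<^sup>2) * card (\<Omega> n)) sequentially"
    using \<epsilon> \<delta> by (intro rare_large_pairs) auto
  thus ?thesis
  proof eventually_elim
    case (elim n)
    let ?A = "{\<omega> \<in> \<Omega> n. card (C1 n \<omega>) > N n * (1 - pgf Dl \<eta> + \<epsilon>)}"
    have "card ?A * \<epsilon>\<^sup>2 \<le> (\<delta> * \<epsilon>\<^sup>2) * card (\<Omega> n)"
    proof (rule many_pairs[where t = "N n * (1 - pgf Dl \<eta> + \<epsilon>)"])
      fix \<omega> assume \<omega>: "\<omega> \<in> ?A"
      hence C1: "C1 n \<omega> \<in> {1..N n} // conn n \<omega>" using largest_props by blast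
      have "N n * \<epsilon> \<le> N n * (1 - pgf Dl \<eta> + \<epsilon>)"
        using pgf_range[OF \<eta>(1), of Dl] by (intro mult_left_mono) auto
      hence "\<epsilon> * N n \<le> card (C1 n \<omega>)" using \<omega> by (simp add: mult.commute)
      moreover have "conn n \<omega> `` {v, w} = C1 n \<omega>" if "v \<in> C1 n \<omega>" "w \<in> C1 n \<omega>" for v w
        using component_Image[OF C1 that(1)] component_Image[OF C1 that(2)] by auto
      ultimately show "\<exists>X Y. X \<subseteq> {1..N n} \<and> Y \<subseteq> {1..N n} \<and> \<epsilon> * N n \<le> card X \<and> \<epsilon> * N n \<le> card Y \<and>
         (\<forall>v\<in>X. \<forall>w\<in>Y. N n * (1 - pgf Dl \<eta> + \<epsilon>) < card (conn n \<omega> `` {v, w}))"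
        using component_subset[OF C1] \<omega> by (intro exI[of _ "C1 n \<omega>"]) auto
    qed (use elim \<epsilon> in auto)
    hence "card ?A * \<epsilon>\<^sup>2 \<le> (\<delta> * card (\<Omega> n)) * \<epsilon>\<^sup>2" by (simp add: mult_ac)
    thus ?case using \<epsilon> by (simp add: mult_le_cancel_right)
  qed
qed

lemma rare_small_C1:
  fixes \<epsilon> \<delta> :: real
  assumes super: "ext_mean (tilde Dl) * ext_mean (tilde Dr) > 1" and \<epsilon>: "\<epsilon> > 0" and \<delta>: "\<delta> > 0"
  shows "eventually (\<lambda>n. card {\<omega> \<in> \<Omega> n. card (C1 n \<omega>) < N n * (1 - pgf Dl \<eta> - \<epsilon>)} \<le> \<delta> * card (\<Omega> n)) sequentially"
  using large_component_exists[OF assms]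
proof eventually_elim
  case (elim n)
  have "card {\<omega> \<in> \<Omega> n. card (C1 n \<omega>) < N n * (1 - pgf Dl \<eta> - \<epsilon>)}
      \<le> card {\<omega> \<in> \<Omega> n. \<forall>C \<in> {1..N n} // conn n \<omega>. card C < N n * (1 - pgf Dl \<eta> - \<epsilon>)}"
    using finite_\<Omega>[of n] largest_props(2) by (intro card_mono) (fastforce intro: le_less_trans)+
  thus ?case using elim by linarith
qed

text \<open>Outside the supercritical case the limit is \<open>0\<close> and only the upper bound has content.\<close>

lemma conv_C1:
  assumes sub: "ext_mean (tilde Dl) * ext_mean (tilde Dr) > 1 \<or> pgf Dl \<eta> = 1"
  shows "conv_in_probability (\<lambda>n. random_matching (N n) (M n) (d n) (Com n))
     (\<lambda>n \<omega>. real (card (C1 n \<omega>)) / real (N n)) (1 - pgf Dl \<eta>)"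
proof (rule conv_in_probabilityI)
  fix \<epsilon> \<delta> :: real assume \<epsilon>: "\<epsilon> > 0" and \<delta>: "\<delta> > 0"
  have up: "eventually (\<lambda>n. card {\<omega> \<in> \<Omega> n. card (C1 n \<omega>) > N n * (1 - pgf Dl \<eta> + \<epsilon>)} \<le> \<delta>/2 * card (\<Omega> n)) sequentially"
    using \<epsilon> \<delta> by (intro rare_large_C1) auto
  have lo: "eventually (\<lambda>n. card {\<omega> \<in> \<Omega> n. card (C1 n \<omega>) < N n * (1 - pgf Dl \<eta> - \<epsilon>)} \<le> \<delta>/2 * card (\<Omega> n)) sequentially"
  proof (cases "pgf Dl \<eta> = 1")
    case True
    have "\<not> real (card C) < N n * (1 - pgf Dl \<eta> - \<epsilon>)" for n and C :: "nat set"
      using True \<epsilon> by (simp add: not_less mult_nonneg_nonneg order_trans[OF _ of_nat_0_le_iff])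
    thus ?thesis using \<delta> by simp
  next
    case False
    thus ?thesis using sub \<epsilon> \<delta> by (intro rare_small_C1) auto
  qed
  from up lo show "eventually (\<lambda>n. card {\<omega> \<in> \<Omega> n. \<bar>real (card (C1 n \<omega>)) / real (N n) - (1 - pgf Dl \<eta>)\<bar> > \<epsilon>}
      \<le> \<delta> * card (\<Omega> n)) sequentially"
  proof eventually_elim
    case (elim n)
    have N: "real (N n) > 0" using N_pos by simp
    let ?B = "{\<omega> \<in> \<Omega> n. \<bar>real (card (C1 n \<omega>)) / real (N n) - (1 - pgf Dl \<eta>)\<bar> > \<epsilon>}"
    let ?U = "{\<omega> \<in> \<Omega> n. card (C1 n \<omega>) > N n * (1 - pgf Dl \<eta> + \<epsilon>)}"
    let ?L = "{\<omega> \<in> \<Omega> n. card (C1 n \<omega>) < N n * (1 - pgf Dl \<eta> - \<epsilon>)}"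
    have "?B \<subseteq> ?U \<union> ?L"
    proof
      fix \<omega> assume \<omega>: "\<omega> \<in> ?B"
      define x where "x = real (card (C1 n \<omega>)) / real (N n)"
      have cx: "real (card (C1 n \<omega>)) = N n * x" using N by (simp add: x_def)
      have "x > 1 - pgf Dl \<eta> + \<epsilon> \<or> x < 1 - pgf Dl \<eta> - \<epsilon>" using \<omega> by (auto simp: x_def[symmetric] abs_less_iff abs_if split: if_splits)
      thus "\<omega> \<in> ?U \<union> ?L" using \<omega> N by (auto simp: cx)
    qed
    hence "card ?B \<le> card (?U \<union> ?L)"
      using finite_\<Omega>[of n] by (intro card_mono) auto
    also have "\<dots> \<le> card ?U + card ?L" by (rule card_Un_le)
    finally have "real (card ?B)
        \<le> real (card ?U) + real (card ?L)" by linarith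
    thus ?case using elim by linarith
  qed
qed

text \<open>
  If the second component were of linear size, individuals \<open>v\<close> and \<open>w\<close> of the two largest components
  would together reach more than the typical size of the largest component alone.
\<close>

lemma conv_C2:
  assumes super: "ext_mean (tilde Dl) * ext_mean (tilde Dr) > 1"
  shows "conv_in_probability (\<lambda>n. random_matching (N n) (M n) (d n) (Com n))
     (\<lambda>n \<omega>. real (card (C2 n \<omega>)) / real (N n)) 0"
proof (rule conv_in_probabilityI)
  fix \<epsilon> \<delta> :: real assume \<epsilon>: "\<epsilon> > 0" and \<delta>: "\<delta> > 0"
  have up: "eventually (\<lambda>n. \<forall>v\<in>{1..N n}. \<forall>w\<in>{1..N n}.
    card {\<omega> \<in> \<Omega> n. card (conn n \<omega> `` {v, w}) > N n * (1 - pgf Dl \<eta> + \<epsilon>/4)} \<le> (\<delta>/2 * \<epsilon>\<^sup>2) * card (\<Omega> n)) sequentially"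
    using \<epsilon> \<delta> by (intro rare_large_pairs) auto
  have lo: "eventually (\<lambda>n. card {\<omega> \<in> \<Omega> n. card (C1 n \<omega>) < N n * (1 - pgf Dl \<eta> - \<epsilon>/4)} \<le> \<delta>/2 * card (\<Omega> n)) sequentially"
    using \<epsilon> \<delta> by (intro rare_small_C1[OF super]) auto
  from up lo show "eventually (\<lambda>n. card {\<omega> \<in> \<Omega> n. \<bar>real (card (C2 n \<omega>)) / real (N n) - 0\<bar> > \<epsilon>}
      \<le> \<delta> * card (\<Omega> n)) sequentially"
  proof eventually_elim
    case (elim n)
    have N: "real (N n) > 0" using N_pos by simp
    let ?L = "{\<omega> \<in> \<Omega> n. card (C1 n \<omega>) < N n * (1 - pgf Dl \<eta> - \<epsilon>/4)}"
    let ?B = "{\<omega> \<in> \<Omega> n. \<bar>real (card (C2 n \<omega>)) / real (N n) - 0\<bar> > \<epsilon>}"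
    let ?A = "?B - ?L"
    have "card ?A * \<epsilon>\<^sup>2 \<le> (\<delta>/2 * \<epsilon>\<^sup>2) * card (\<Omega> n)"
    proof (rule many_pairs[where t = "N n * (1 - pgf Dl \<eta> + \<epsilon>/4)"])
      fix \<omega> assume \<omega>: "\<omega> \<in> ?A"
      hence \<Omega>: "\<omega> \<in> \<Omega> n" by simp
      have C1: "C1 n \<omega> \<in> {1..N n} // conn n \<omega>" using largest_props(1)[OF \<Omega>] .
      have c2: "\<epsilon> * N n < card (C2 n \<omega>)" using \<omega> N by (simp add: pos_less_divide_eq)
      have c1: "N n * (1 - pgf Dl \<eta> - \<epsilon>/4) \<le> card (C1 n \<omega>)" using \<omega> by (simp add: not_less)
      have "C2 n \<omega> \<noteq> {}" using c2 \<epsilon> N by (auto simp: mult_less_0_iff)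
      hence C2: "C2 n \<omega> \<in> {1..N n} // conn n \<omega>" "C2 n \<omega> \<noteq> C1 n \<omega>" using largest_props(3)[OF \<Omega>] by auto
      have le: "card (C2 n \<omega>) \<le> card (C1 n \<omega>)" by (rule largest_props(2)[OF \<Omega> C2(1)])
      have disj: "C1 n \<omega> \<inter> C2 n \<omega> = {}" using quotient_disj[OF equiv_conn C1 C2(1)] C2(2) by auto
      have fin: "finite (C1 n \<omega>)" "finite (C2 n \<omega>)"
        using component_subset[OF C1] component_subset[OF C2(1)] finite_subset by blast+
      have "N n * (1 - pgf Dl \<eta> + \<epsilon>/4) < card (conn n \<omega> `` {v, w})" if "v \<in> C1 n \<omega>" "w \<in> C2 n \<omega>" for v w
      proof -
        have "conn n \<omega> `` {v, w} = C1 n \<omega> \<union> C2 n \<omega>"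
          using component_Image[OF C1 that(1)] component_Image[OF C2(1) that(2)] by auto
        hence "real (card (conn n \<omega> `` {v, w})) = real (card (C1 n \<omega>)) + real (card (C2 n \<omega>))"
          using card_Un_disjoint[OF fin disj] by simp
        moreover have "N n * (1 - pgf Dl \<eta> + \<epsilon>/4) = N n * (1 - pgf Dl \<eta> - \<epsilon>/4) + \<epsilon> * N n - \<epsilon>/2 * N n"
          by (simp add: algebra_simps)
        moreover have "0 < \<epsilon>/2 * N n" using \<epsilon> N by simp
        ultimately show ?thesis using c1 c2 by linarith
      qed
      thus "\<exists>X Y. X \<subseteq> {1..N n} \<and> Y \<subseteq> {1..N n} \<and> \<epsilon> * N n \<le> card X \<and> \<epsilon> * N n \<le> card Y \<and>
         (\<forall>v\<in>X. \<forall>w\<in>Y. N n * (1 - pgf Dl \<eta> + \<epsilon>/4) < card (conn n \<omega> `` {v, w}))"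
        using component_subset[OF C1] component_subset[OF C2(1)] c2 le
        by (intro exI[of _ "C1 n \<omega>"] exI[of _ "C2 n \<omega>"]) auto
    qed (use elim \<epsilon> in auto)
    hence "card ?A * \<epsilon>\<^sup>2 \<le> (\<delta>/2 * card (\<Omega> n)) * \<epsilon>\<^sup>2" by (simp add: mult_ac)
    hence A: "card ?A \<le> \<delta>/2 * card (\<Omega> n)" using \<epsilon> by (simp add: mult_le_cancel_right)
    have "card ?B \<le> card (?A \<union> ?L)" using finite_\<Omega>[of n] by (intro card_mono) auto
    also have "\<dots> \<le> card ?A + card ?L" by (rule card_Un_le)
    finally have "real (card ?B) \<le> real (card ?A) + real (card ?L)" by linarith
    thus ?case using A elim(2) by linarith
  qed
qed

end

end

end

theorem theorem2p6:
  fixes \<H> :: "graph set"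
    and N M :: "nat \<Rightarrow> nat"
    and d\<^sub>l :: "nat \<Rightarrow> nat \<Rightarrow> nat"
    and Com :: "nat \<Rightarrow> nat \<Rightarrow> graph"
    and D\<^sub>l D\<^sub>r :: "nat pmf"
    and \<mu> :: "graph pmf"
    and C\<^sub>1 C\<^sub>2 :: "nat \<Rightarrow> matching \<Rightarrow> nat set"
  assumes communities: "community_set \<H>"
    and N_pos: "\<And>n. N n > 0" and M_pos: "\<And>n. M n > 0"
    and N_lim: "filterlim N at_top sequentially"
    and M_lim: "filterlim M at_top sequentially"
    and d\<^sub>l_pos: "\<And>n v. v \<in> {1..N n} \<Longrightarrow> d\<^sub>l n v \<ge> 1"
    and Com_in: "\<And>n a. a \<in> {1..M n} \<Longrightarrow> Com n a \<in> \<H>"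
    and half_edges_eq: "\<And>n. (\<Sum>v = 1..N n. d\<^sub>l n v) = (\<Sum>a = 1..M n. order (Com n a))"
    and A: "0 \<notin> set_pmf D\<^sub>l"
           "conv_in_distribution (\<lambda>n. empirical_law (N n) (d\<^sub>l n)) D\<^sub>l"
    and B: "integrable (measure_pmf D\<^sub>l) real"
           "(\<lambda>n. mean (empirical_law (N n) (d\<^sub>l n))) \<longlonglongrightarrow> mean D\<^sub>l"
    and C: "set_pmf \<mu> \<subseteq> \<H>"
           "\<And>H. H \<in> \<H> \<Longrightarrow>
              (\<lambda>n. real (card {a \<in> {1..M n}. Com n a = H}) / real (M n)) \<longlonglongrightarrow> pmf \<mu> H"
    and D\<^sub>r: "D\<^sub>r = map_pmf order \<mu>"
    and D: "integrable (measure_pmf D\<^sub>r) real"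
           "(\<lambda>n. mean (empirical_law (M n) (\<lambda>a. order (Com n a)))) \<longlonglongrightarrow> mean D\<^sub>r"
    and nondegenerate: "pmf D\<^sub>l 2 + pmf D\<^sub>r 2 < 2"
    and largest: "\<And>n \<omega>. \<omega> \<in> matchings (N n) (M n) (d\<^sub>l n) (Com n) \<Longrightarrow>
           two_largest_components (RIGC (N n) (M n) (d\<^sub>l n) (Com n) \<omega>) (C\<^sub>1 n \<omega>) (C\<^sub>2 n \<omega>)"
  shows "\<exists>\<eta>\<^sub>l \<xi>\<^sub>l :: real.
           \<eta>\<^sub>l \<in> {0..1} \<and>
           \<eta>\<^sub>l = pgf (tilde D\<^sub>r) (pgf (tilde D\<^sub>l) \<eta>\<^sub>l) \<and>
           (\<forall>x \<in> {0..1}. x = pgf (tilde D\<^sub>r) (pgf (tilde D\<^sub>l) x) \<longrightarrow> \<eta>\<^sub>l \<le> x) \<and>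
           \<xi>\<^sub>l = 1 - pgf D\<^sub>l \<eta>\<^sub>l \<and> \<xi>\<^sub>l \<in> {0..1} \<and>
           conv_in_probability (\<lambda>n. random_matching (N n) (M n) (d\<^sub>l n) (Com n))
             (\<lambda>n \<omega>. real (card (C\<^sub>1 n \<omega>)) / real (N n)) \<xi>\<^sub>l \<and>
           (\<xi>\<^sub>l > 0 \<longleftrightarrow> ext_mean (tilde D\<^sub>l) * ext_mean (tilde D\<^sub>r) > 1) \<and>
           (ext_mean (tilde D\<^sub>l) * ext_mean (tilde D\<^sub>r) > 1 \<longrightarrow>
             conv_in_probability (\<lambda>n. random_matching (N n) (M n) (d\<^sub>l n) (Com n))
               (\<lambda>n \<omega>. real (card (C\<^sub>2 n \<omega>)) / real (N n)) 0)"
proof -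
  have conn: "connected_simple_graph H" if "H \<in> \<H>" for H
    using communities that by (simp add: community_set_def)
  have order_pos: "1 \<le> order H" if "H \<in> \<H>" for H
    using conn[OF that] by (simp add: connected_simple_graph_def)
  have Dr0: "0 \<notin> set_pmf D\<^sub>r"
    using C(1) order_pos unfolding D\<^sub>r by fastforce
  interpret rigc_sequence N M d\<^sub>l Com D\<^sub>l D\<^sub>r
  proof
    show "connected_simple_graph (Com n a)" if "a \<in> {1..M n}" for n a by (rule conn[OF Com_in[OF that]])
    show "(\<lambda>n. real (\<Sum>v = 1..N n. d\<^sub>l n v) / real (N n)) \<longlonglongrightarrow> mean D\<^sub>l"
      using B(2) N_pos by (simp add: mean_empirical_law)
    show "(\<lambda>n. real (\<Sum>a = 1..M n. order (Com n a)) / real (M n)) \<longlonglongrightarrow> mean D\<^sub>r"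
      using D(2) M_pos by (simp add: mean_empirical_law)
    show "(\<lambda>n. real (degree_count (N n) (d\<^sub>l n) {} k) / real (N n)) \<longlonglongrightarrow> pmf D\<^sub>l k" for k
      using conv_in_distribution_pmf[OF A(2), of k] N_pos by (simp add: pmf_empirical_law degree_count_def)
    show "(\<lambda>n. real (degree_count (M n) (\<lambda>a. order (Com n a)) {} k) / real (M n)) \<longlonglongrightarrow> pmf D\<^sub>r k" for k
      unfolding D\<^sub>r by (rule order_count_lim[OF conn Com_in C(1) C(2)])
  qed (use N_pos M_pos N_lim d\<^sub>l_pos half_edges_eq A(1) B(1) D(1) Dr0 in auto)
  define f where "f x = pgf (tilde D\<^sub>r) (pgf (tilde D\<^sub>l) x)" for x
  have fG: "f x = G False (G True x)" for x by (simp add: f_def G_def)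
  have "continuous_on {0..1} f" unfolding f_def
    using pgf_range by (intro continuous_on_compose2[OF continuous_on_pgf continuous_on_pgf]) blast
  moreover have "f x \<in> {0..1}" if "x \<in> {0..1}" for x unfolding f_def by (intro pgf_range that)
  ultimately obtain \<eta> where \<eta>: "\<eta> \<in> {0..1}" "f \<eta> = \<eta>" "\<And>x. x \<in> {0..1} \<Longrightarrow> f x = x \<Longrightarrow> \<eta> \<le> x"
    and above: "\<And>x. x \<in> {0..<\<eta>} \<Longrightarrow> x < f x"
    using smallest_fixed_point[of f] by (auto simp: f_def)
  have nd: "\<not> (pmf (tilde D\<^sub>l) 1 = 1 \<and> pmf (tilde D\<^sub>r) 1 = 1)"
    using tilde_eq_1_imp[OF Dl] tilde_eq_1_imp[OF Dr] nondegenerate by auto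
  have super_iff: "\<eta> < 1 \<longleftrightarrow> ext_mean (tilde D\<^sub>l) * ext_mean (tilde D\<^sub>r) > 1"
  proof
    assume "\<eta> < 1"
    hence "\<eta> \<in> {0..<1}" using \<eta>(1) by auto
    thus "ext_mean (tilde D\<^sub>l) * ext_mean (tilde D\<^sub>r) > 1"
      using subcritical_above[OF _ nd, of \<eta>] \<eta>(2) unfolding f_def by (metis less_irrefl not_less)
  next
    assume "ext_mean (tilde D\<^sub>l) * ext_mean (tilde D\<^sub>r) > 1"
    then obtain x0 where x0: "x0 < 1" "\<forall>x\<in>{x0<..<1}. f x < x"
      using supercritical_near_1 unfolding f_def by blast
    define x where "x = (max 0 x0 + 1) / 2"
    have x: "x \<in> {x0<..<1}" "0 \<le> x" "x < 1" using x0(1) by (auto simp: x_def)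
    have "f x < x" using x x0 by blast
    hence "\<not> x < \<eta>" using above[of x] x by force
    thus "\<eta> < 1" using x by simp
  qed
  have \<xi>_pos: "1 - pgf D\<^sub>l \<eta> > 0 \<longleftrightarrow> \<eta> < 1"
    using pgf_Dl_le[OF \<eta>(1)] \<eta>(1) by (cases "\<eta> = 1") auto
  have \<xi>_range: "1 - pgf D\<^sub>l \<eta> \<in> {0..1}" using pgf_range[OF \<eta>(1), of D\<^sub>l] by auto
  have \<eta>G: "G False (G True \<eta>) = \<eta>" and aboveG: "\<And>x. x \<in> {0..<\<eta>} \<Longrightarrow> x < G False (G True x)"
    using \<eta>(2) above by (simp_all add: fG)
  have lg: "\<And>n \<omega>. \<omega> \<in> \<Omega> n \<Longrightarrow>
      two_largest_components (RIGC (N n) (M n) (d\<^sub>l n) (Com n) \<omega>) (C\<^sub>1 n \<omega>) (C\<^sub>2 n \<omega>)"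
    using largest by (simp add: \<Omega>_def)
  have "ext_mean (tilde D\<^sub>l) * ext_mean (tilde D\<^sub>r) > 1 \<or> pgf D\<^sub>l \<eta> = 1"
    using super_iff \<xi>_pos \<xi>_range by auto
  note c1 = conv_C1[OF \<eta>(1) \<eta>G aboveG lg this]
  note c2 = conv_C2[OF \<eta>(1) \<eta>G aboveG lg]
  show ?thesis
  proof (rule exI[of _ \<eta>], rule exI[of _ "1 - pgf D\<^sub>l \<eta>"], intro conjI)
    show "\<eta> = pgf (tilde D\<^sub>r) (pgf (tilde D\<^sub>l) \<eta>)" using \<eta>(2) by (simp add: f_def)
    show "\<forall>x \<in> {0..1}. x = pgf (tilde D\<^sub>r) (pgf (tilde D\<^sub>l) x) \<longrightarrow> \<eta> \<le> x"
      using \<eta>(3) unfolding f_def by metis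
    show "1 - pgf D\<^sub>l \<eta> > 0 \<longleftrightarrow> ext_mean (tilde D\<^sub>l) * ext_mean (tilde D\<^sub>r) > 1"
      using super_iff \<xi>_pos by blast
    show "ext_mean (tilde D\<^sub>l) * ext_mean (tilde D\<^sub>r) > 1 \<longrightarrow>
             conv_in_probability (\<lambda>n. random_matching (N n) (M n) (d\<^sub>l n) (Com n))
               (\<lambda>n \<omega>. real (card (C\<^sub>2 n \<omega>)) / real (N n)) 0"
      using c2 by blast
  qed (use \<eta>(1) \<xi>_range c1 in auto)
qed

end
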